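(* Let $d\in\mathbb{N}$ and let $\Omega\subset\mathbb{R}^d$ be a spatial domain. Let $\nu\in L^\infty(\Omega;\mathbb{R}^{d\times d})$ be pointwise symmetric, $\nu(\omega)^\top=\nu(\omega)$ for all $\omega\in\Omega$, and uniformly positive, i.e. there is $\underline{\nu}>0$ with $v^\top\nu(\omega)v\ge\underline{\nu}\|v\|_{\mathbb{R}^d}^2$ for all $v\in\mathbb{R}^d$ and $\omega\in\Omega$. Let $\mathbf{b}\in L^\infty(\Omega;\mathbb{R}^d)\cap H(\operatorname{div},\Omega)$ with $\operatorname{div}\mathbf{b}=0$ a.e. on $\Omega$, and let $\mathbf{c}\in L^\infty(\Omega;\mathbb{R})$ with $\mathbf{c}(\omega)\ge 0$ for a.e. $\omega\in\Omega$. Let $D=\{x\in H^1_0(\Omega)\,|\,\nu\nabla x\in H(\operatorname{div},\Omega)\}$, let $\mathcal{H}:L^2(\Omega)\supset D\to L^2(\Omega)$ be given by $\mathcal{H}x=-\operatorname{div}(\nu\nabla x)+\mathbf{c}x$, and let $\mathcal{S}$ be given by $\mathcal{S}x=\mathbf{b}^\top\nabla x$, regarded as an operator $\mathcal{S}:H^1_0(\Omega)\to L^2(\Omega)$. Then the preconditioned operator $$I+\mathcal{H}^{-1}\mathcal{S}:H^1_0(\Omega)\to H^1_0(\Omega)$$ is bounded.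
   Context: The operators come from the stationary advection-diffusion-reaction equation $-\operatorname{div}(\nu\nabla x)+\mathbf{b}^\top\nabla x+\mathbf{c}x=f$ on $\Omega$ with $x=0$ on $\partial\Omega$, whose operator is $\mathcal{A}=\mathcal{H}+\mathcal{S}$. $H(\operatorname{div},\Omega)$ is the space of vector fields $\Omega\to\mathbb{R}^d$ with components in $L^2(\Omega)$ whose weak divergence belongs to $L^2(\Omega)$. $H^1_0(\Omega)$ is the space of functions in $H^1(\Omega)$ with vanishing trace on the boundary, with the $H^1$-norm. $\mathcal{H}^{-1}:L^2(\Omega)\to D\subset H^1_0(\Omega)$ denotes the inverse of $\mathcal{H}:D\to L^2(\Omega)$. *)

theory Defs
  imports "HOL-Analysis.Analysis"
begin

section \<open>Functions modulo equality almost everywhere\<close>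

text \<open>
  Elements of function spaces over \<open>\<Omega>\<close> are represented by functions on the whole of
  \<open>real^'n\<close>; only their values on \<open>\<Omega>\<close> matter, and two functions represent the same element
  iff they agree a.e.\ on \<open>\<Omega>\<close>. Bijectivity, inverse and linearity of operators are therefore
  understood modulo \<open>ae_eq \<Omega>\<close>.
\<close>

definition ae_eq :: "(real^'n) set \<Rightarrow> (real^'n \<Rightarrow> 'b) \<Rightarrow> (real^'n \<Rightarrow> 'b) \<Rightarrow> bool" where
  "ae_eq \<Omega> f g \<longleftrightarrow> (AE \<omega> in lebesgue_on \<Omega>. f \<omega> = g \<omega>)"

text \<open>The equivalence in the second conjunct says that \<open>T\<close> respects \<open>ae_eq\<close> and is injective
  on equivalence classes.\<close>

definition ae_bij_betw ::
  "(real^'n) set \<Rightarrow> ((real^'n \<Rightarrow> real) \<Rightarrow> (real^'n \<Rightarrow> real)) \<Rightarrow>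
   (real^'n \<Rightarrow> real) set \<Rightarrow> (real^'n \<Rightarrow> real) set \<Rightarrow> bool" where
  "ae_bij_betw \<Omega> T V W \<longleftrightarrow>
     (\<forall>x\<in>V. T x \<in> W) \<and>
     (\<forall>x\<in>V. \<forall>y\<in>V. ae_eq \<Omega> (T x) (T y) \<longleftrightarrow> ae_eq \<Omega> x y) \<and>
     (\<forall>f\<in>W. \<exists>x\<in>V. ae_eq \<Omega> (T x) f)"

definition ae_inv_into ::
  "(real^'n) set \<Rightarrow> (real^'n \<Rightarrow> real) set \<Rightarrow> ((real^'n \<Rightarrow> real) \<Rightarrow> (real^'n \<Rightarrow> real)) \<Rightarrow>
   (real^'n \<Rightarrow> real) \<Rightarrow> (real^'n \<Rightarrow> real)" where
  "ae_inv_into \<Omega> V T f = (SOME x. x \<in> V \<and> ae_eq \<Omega> (T x) f)"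

text \<open>A bounded linear operator from \<open>(V, p)\<close> to \<open>(W, q)\<close>, where \<open>p\<close> and \<open>q\<close> are the norms.\<close>

definition bounded_operator ::
  "(real^'n) set \<Rightarrow> (real^'n \<Rightarrow> real) set \<Rightarrow> ((real^'n \<Rightarrow> real) \<Rightarrow> real) \<Rightarrow>
   (real^'n \<Rightarrow> real) set \<Rightarrow> ((real^'n \<Rightarrow> real) \<Rightarrow> real) \<Rightarrow>
   ((real^'n \<Rightarrow> real) \<Rightarrow> (real^'n \<Rightarrow> real)) \<Rightarrow> bool" where
  "bounded_operator \<Omega> V p W q T \<longleftrightarrow>
     (\<forall>x\<in>V. T x \<in> W) \<and>
     (\<forall>x\<in>V. \<forall>y\<in>V. ae_eq \<Omega> x y \<longrightarrow> ae_eq \<Omega> (T x) (T y)) \<and>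
     (\<forall>x\<in>V. \<forall>y\<in>V. ae_eq \<Omega> (T (\<lambda>\<omega>. x \<omega> + y \<omega>)) (\<lambda>\<omega>. T x \<omega> + T y \<omega>)) \<and>
     (\<forall>a. \<forall>x\<in>V. ae_eq \<Omega> (T (\<lambda>\<omega>. a * x \<omega>)) (\<lambda>\<omega>. a * T x \<omega>)) \<and>
     (\<exists>C. \<forall>x\<in>V. q (T x) \<le> C * p x)"


section \<open>Lebesgue spaces\<close>

definition L2 :: "(real^'n) set \<Rightarrow> (real^'n \<Rightarrow> real) set" where
  "L2 \<Omega> = {f. f \<in> borel_measurable (lebesgue_on \<Omega>) \<and>
              integrable (lebesgue_on \<Omega>) (\<lambda>\<omega>. (f \<omega>)\<^sup>2)}"

definition L2_vec :: "(real^'n) set \<Rightarrow> (real^'n \<Rightarrow> real^'n) set" where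
  "L2_vec \<Omega> = {F. \<forall>i. (\<lambda>\<omega>. F \<omega> $ i) \<in> L2 \<Omega>}"

definition Linf :: "(real^'n) set \<Rightarrow> (real^'n \<Rightarrow> 'b::real_normed_vector) set" where
  "Linf \<Omega> = {f. f \<in> borel_measurable (lebesgue_on \<Omega>) \<and>
                (\<exists>C. AE \<omega> in lebesgue_on \<Omega>. norm (f \<omega>) \<le> C)}"


section \<open>Test functions and weak derivatives\<close>

definition partial_deriv :: "'n \<Rightarrow> (real^'n \<Rightarrow> real) \<Rightarrow> (real^'n \<Rightarrow> real)" where
  "partial_deriv i f = (\<lambda>\<omega>. frechet_derivative f (at \<omega>) (axis i 1))"

text \<open>\<open>C\<^sup>\<infinity>\<close>: all iterated partial derivatives exist and are (totally) differentiable, hence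
  in particular continuous.\<close>

definition smooth :: "(real^'n \<Rightarrow> real) \<Rightarrow> bool" where
  "smooth f \<longleftrightarrow> (\<forall>is :: 'n list. \<forall>\<omega>. (foldr partial_deriv is f) differentiable (at \<omega>))"

definition test_fun :: "(real^'n) set \<Rightarrow> (real^'n \<Rightarrow> real) set" where
  "test_fun \<Omega> = {\<phi>. smooth \<phi> \<and> compact (closure {\<omega>. \<phi> \<omega> \<noteq> 0}) \<and> closure {\<omega>. \<phi> \<omega> \<noteq> 0} \<subseteq> \<Omega>}"

definition has_weak_grad ::
  "(real^'n) set \<Rightarrow> (real^'n \<Rightarrow> real) \<Rightarrow> (real^'n \<Rightarrow> real^'n) \<Rightarrow> bool" where
  "has_weak_grad \<Omega> u G \<longleftrightarrow> u \<in> L2 \<Omega> \<and> G \<in> L2_vec \<Omega> \<and>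
     (\<forall>\<phi>\<in>test_fun \<Omega>. \<forall>i.
        (LINT \<omega>|lebesgue_on \<Omega>. u \<omega> * partial_deriv i \<phi> \<omega>) =
        - (LINT \<omega>|lebesgue_on \<Omega>. G \<omega> $ i * \<phi> \<omega>))"

definition has_weak_div ::
  "(real^'n) set \<Rightarrow> (real^'n \<Rightarrow> real^'n) \<Rightarrow> (real^'n \<Rightarrow> real) \<Rightarrow> bool" where
  "has_weak_div \<Omega> F g \<longleftrightarrow> F \<in> L2_vec \<Omega> \<and> g \<in> L2 \<Omega> \<and>
     (\<forall>\<phi>\<in>test_fun \<Omega>.
        (LINT \<omega>|lebesgue_on \<Omega>. (\<Sum>i\<in>UNIV. F \<omega> $ i * partial_deriv i \<phi> \<omega>)) =
        - (LINT \<omega>|lebesgue_on \<Omega>. g \<omega> * \<phi> \<omega>))"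

text \<open>Weak gradient and weak divergence are unique up to \<open>ae_eq \<Omega>\<close> (for open \<open>\<Omega>\<close>).\<close>

definition weak_grad :: "(real^'n) set \<Rightarrow> (real^'n \<Rightarrow> real) \<Rightarrow> (real^'n \<Rightarrow> real^'n)" where
  "weak_grad \<Omega> u = (SOME G. has_weak_grad \<Omega> u G)"

definition weak_div :: "(real^'n) set \<Rightarrow> (real^'n \<Rightarrow> real^'n) \<Rightarrow> (real^'n \<Rightarrow> real)" where
  "weak_div \<Omega> F = (SOME g. has_weak_div \<Omega> F g)"


section \<open>Sobolev spaces\<close>

definition Hdiv :: "(real^'n) set \<Rightarrow> (real^'n \<Rightarrow> real^'n) set" where
  "Hdiv \<Omega> = {F. \<exists>g. has_weak_div \<Omega> F g}"

definition H1 :: "(real^'n) set \<Rightarrow> (real^'n \<Rightarrow> real) set" where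
  "H1 \<Omega> = {u. \<exists>G. has_weak_grad \<Omega> u G}"

definition H1_norm :: "(real^'n) set \<Rightarrow> (real^'n \<Rightarrow> real) \<Rightarrow> real" where
  "H1_norm \<Omega> u = sqrt ((LINT \<omega>|lebesgue_on \<Omega>. (u \<omega>)\<^sup>2) +
                       (LINT \<omega>|lebesgue_on \<Omega>. (norm (weak_grad \<Omega> u \<omega>))\<^sup>2))"

text \<open>
  No regularity of the boundary is assumed, so there is no trace operator on \<open>H1 \<Omega>\<close> in general.
  Vanishing trace has its usual meaning for arbitrary domains: the function is a limit, in the
  \<open>H1\<close>-norm, of smooth functions with compact support in \<open>\<Omega>\<close>. For bounded Lipschitz domains this
  is the kernel of the trace operator.
\<close>

definition H10 :: "(real^'n) set \<Rightarrow> (real^'n \<Rightarrow> real) set" where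
  "H10 \<Omega> = {u \<in> H1 \<Omega>. \<exists>\<phi> :: nat \<Rightarrow> real^'n \<Rightarrow> real.
              (\<forall>k. \<phi> k \<in> test_fun \<Omega>) \<and>
              (\<lambda>k. H1_norm \<Omega> (\<lambda>\<omega>. u \<omega> - \<phi> k \<omega>)) \<longlonglongrightarrow> 0}"


section \<open>The advection-diffusion-reaction operators\<close>

definition dom_H :: "(real^'n) set \<Rightarrow> (real^'n \<Rightarrow> real^'n^'n) \<Rightarrow> (real^'n \<Rightarrow> real) set" where
  "dom_H \<Omega> \<nu> = {x \<in> H10 \<Omega>. (\<lambda>\<omega>. \<nu> \<omega> *v weak_grad \<Omega> x \<omega>) \<in> Hdiv \<Omega>}"

definition op_H ::
  "(real^'n) set \<Rightarrow> (real^'n \<Rightarrow> real^'n^'n) \<Rightarrow> (real^'n \<Rightarrow> real) \<Rightarrow>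
   (real^'n \<Rightarrow> real) \<Rightarrow> (real^'n \<Rightarrow> real)" where
  "op_H \<Omega> \<nu> c x = (\<lambda>\<omega>. - weak_div \<Omega> (\<lambda>\<xi>. \<nu> \<xi> *v weak_grad \<Omega> x \<xi>) \<omega> + c \<omega> * x \<omega>)"

definition op_S ::
  "(real^'n) set \<Rightarrow> (real^'n \<Rightarrow> real^'n) \<Rightarrow> (real^'n \<Rightarrow> real) \<Rightarrow> (real^'n \<Rightarrow> real)" where
  "op_S \<Omega> b x = (\<lambda>\<omega>. b \<omega> \<bullet> weak_grad \<Omega> x \<omega>)"

definition inv_H ::
  "(real^'n) set \<Rightarrow> (real^'n \<Rightarrow> real^'n^'n) \<Rightarrow> (real^'n \<Rightarrow> real) \<Rightarrow>
   (real^'n \<Rightarrow> real) \<Rightarrow> (real^'n \<Rightarrow> real)" where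
  "inv_H \<Omega> \<nu> c = ae_inv_into \<Omega> (dom_H \<Omega> \<nu>) (op_H \<Omega> \<nu> c)"

end

theory Submission
  imports Defs
begin

text \<open>
  The operator \<open>\<H>\<close> is handled through its weak form: \<open>x \<in> D\<close> and \<open>\<H> x = f\<close> hold
  iff \<open>a(x, \<phi>) = \<langle>f, \<phi>\<rangle>\<close> for all test functions \<open>\<phi>\<close>, where
  \<open>a(u, v) = \<integral> \<nu> \<nabla>u \<bullet> \<nabla>v + c u v\<close> is symmetric and \<open>a(u, u) \<ge> \<nu>0 \<parallel>\<nabla>u\<parallel>\<^sup>2\<close>.

  On a bounded domain the inequality of Poincare makes \<open>a\<close> coercive, and a minimizing sequence of
  test functions for \<open>a(\<phi>, \<phi>) - 2 \<langle>f, \<phi>\<rangle>\<close> converges in the \<open>H\<^sup>1\<close>-norm to the solution.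

  On an unbounded domain there is no Poincare inequality. If \<open>\<H>\<close> is bijective, however, its inverse
  \<open>T\<close> is a symmetric positive operator defined on all of \<open>L\<^sup>2\<close>, hence bounded by the theorem of
  Hellinger and Toeplitz; \<open>\<nu>0 \<parallel>\<nabla>Tf\<parallel>\<^sup>2 \<le> a(Tf, Tf) = \<langle>f, Tf\<rangle>\<close> then bounds \<open>T\<close> from \<open>L\<^sup>2\<close> to \<open>H\<^sup>1\<close>,
  and \<open>\<S>\<close> is bounded from \<open>H\<^sup>1\<close> to \<open>L\<^sup>2\<close> because \<open>b\<close> is.
\<close>

section \<open>Positive semidefinite forms on spaces of real functions\<close>

text \<open>Elements are functions rather than classes modulo \<open>ae_eq\<close>, and
  \<open>weak_grad\<close>, \<open>weak_div\<close> and \<open>inv_H\<close> are arbitrary choices.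
  They are linear only almost everywhere, whereas the integrals formed from them are exactly linear.
  The abstract part therefore speaks of real-valued semidefinite forms and never of a quotient
  space. It serves three times: for the \<open>L2\<close> product, for the energy form on test
  functions, and for \<open>L2_ip (T f) g\<close> with \<open>T\<close> the inverse. The third use
  closes a gap: the gliding hump bounds only the quadratic form of \<open>T\<close>, and
  Cauchy-Schwarz for this form, applied to \<open>f\<close> and \<open>T f\<close>, turns that into
  a bound on \<open>T f\<close> itself. The arbitrary choices are harmless because weak derivatives
  are unique almost everywhere. This rests on the fundamental lemma of the calculus of variations,
  the reason for the bump functions and the boxes. Since \<open>H10\<close> consists of limits of
  test functions, existence is settled on test functions with classical gradients; only the limit is
  weak.\<close>

locale psd_form =
  fixes V :: "('x \<Rightarrow> real) set" and B :: "('x \<Rightarrow> real) \<Rightarrow> ('x \<Rightarrow> real) \<Rightarrow> real"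
  assumes zero_mem: "(\<lambda>x. 0) \<in> V"
    and lin_mem: "f \<in> V \<Longrightarrow> g \<in> V \<Longrightarrow> (\<lambda>x. s * f x + t * g x) \<in> V"
    and lin_left: "f \<in> V \<Longrightarrow> g \<in> V \<Longrightarrow> h \<in> V \<Longrightarrow>
      B (\<lambda>x. s * f x + t * g x) h = s * B f h + t * B g h"
    and sym: "f \<in> V \<Longrightarrow> g \<in> V \<Longrightarrow> B f g = B g f"
    and nonneg: "f \<in> V \<Longrightarrow> 0 \<le> B f f"
begin

section \<open>Seminorm and Cauchy-Schwarz inequality\<close>

definition nrm :: "('x \<Rightarrow> real) \<Rightarrow> real" where
  "nrm f = sqrt (B f f)"

definition conv :: "(nat \<Rightarrow> 'x \<Rightarrow> real) \<Rightarrow> ('x \<Rightarrow> real) \<Rightarrow> bool" where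
  "conv s f \<longleftrightarrow> (\<lambda>k. nrm (\<lambda>x. s k x - f x)) \<longlonglongrightarrow> 0"

lemma lin_right:
  assumes "f \<in> V" "g \<in> V" "h \<in> V"
  shows "B h (\<lambda>x. s * f x + t * g x) = s * B h f + t * B h g"
  unfolding sym[OF assms(3) lin_mem[OF assms(1,2)]] sym[OF assms(3,1)] sym[OF assms(3,2)]
  by (rule lin_left[OF assms])

lemma add_mem: "f \<in> V \<Longrightarrow> g \<in> V \<Longrightarrow> (\<lambda>x. f x + g x) \<in> V"
  using lin_mem[of f g 1 1] by simp

lemma diff_mem: "f \<in> V \<Longrightarrow> g \<in> V \<Longrightarrow> (\<lambda>x. f x - g x) \<in> V"
  using lin_mem[of f g 1 "-1"] by simp

lemma scale_mem: "f \<in> V \<Longrightarrow> (\<lambda>x. s * f x) \<in> V"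
  using lin_mem[of f f s 0] by simp

lemma diff_left: "f \<in> V \<Longrightarrow> g \<in> V \<Longrightarrow> h \<in> V \<Longrightarrow> B (\<lambda>x. f x - g x) h = B f h - B g h"
  using lin_left[of f g h 1 "-1"] by simp

lemma scale_left: "f \<in> V \<Longrightarrow> h \<in> V \<Longrightarrow> B (\<lambda>x. s * f x) h = s * B f h"
  using lin_left[of f f h s 0] by simp

lemma quad:
  assumes "f \<in> V" "g \<in> V"
  shows "B (\<lambda>x. s * f x + t * g x) (\<lambda>x. s * f x + t * g x) =
    s\<^sup>2 * B f f + 2 * s * t * B f g + t\<^sup>2 * B g g"
  unfolding lin_left[OF assms lin_mem[OF assms]] lin_right[OF assms assms(1)]
    lin_right[OF assms assms(2)] sym[OF assms(2,1)]
  by (simp add: power2_eq_square algebra_simps)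

lemma quad_diff:
  assumes "f \<in> V" "g \<in> V"
  shows "B (\<lambda>x. f x - g x) (\<lambda>x. f x - g x) = B f f - 2 * B f g + B g g"
  using quad[OF assms, of 1 "-1"] by simp

lemma cauchy_schwarz_sq:
  assumes f: "f \<in> V" and g: "g \<in> V"
  shows "(B f g)\<^sup>2 \<le> B f f * B g g"
proof -
  have q: "0 \<le> s\<^sup>2 * B f f + 2 * s * t * B f g + t\<^sup>2 * B g g" for s t
    using nonneg[OF lin_mem[OF f g, of s t]] quad[OF f g, of s t] by simp
  show ?thesis
  proof (cases "B g g = 0")
    case True
    have "B f g = 0"
    proof (rule ccontr)
      assume n: "B f g \<noteq> 0"
      \<comment> \<open>For \<open>B g g = 0\<close> the quadratic is affine in \<open>t\<close>; a
        nonzero slope would allow every value, and this \<open>t\<close> is chosen to produce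
        -1.\<close>
      have "0 \<le> B f f + 2 * (-(B f f + 1) / (2 * B f g)) * B f g"
        using q[of 1 "-(B f f + 1) / (2 * B f g)"] True by simp
      also have "\<dots> = -1" using n by (simp add: field_simps)
      finally show False by simp
    qed
    then show ?thesis using True by simp
  next
    case False
    then have pos: "B g g > 0" using nonneg[OF g] by simp
    \<comment> \<open>The minimizing ratio \<open>t / s = - B f g / B g g\<close>, scaled so that no
      division occurs.\<close>
    have "0 \<le> (B g g)\<^sup>2 * B f f + 2 * B g g * (- B f g) * B f g + (- B f g)\<^sup>2 * B g g"
      by (rule q)
    also have "\<dots> = B g g * (B f f * B g g - (B f g)\<^sup>2)"
      by (simp add: power2_eq_square algebra_simps)
    finally show ?thesis using pos by (simp add: zero_le_mult_iff)
  qed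
qed

lemma nrm_nonneg: "f \<in> V \<Longrightarrow> 0 \<le> nrm f"
  by (simp add: nrm_def nonneg)

lemma nrm_sq: "f \<in> V \<Longrightarrow> (nrm f)\<^sup>2 = B f f"
  by (simp add: nrm_def nonneg)

lemma cauchy_schwarz:
  assumes "f \<in> V" "g \<in> V"
  shows "\<bar>B f g\<bar> \<le> nrm f * nrm g"
  using real_sqrt_le_mono[OF cauchy_schwarz_sq[OF assms]]
  by (simp add: nrm_def real_sqrt_mult)

lemma nrm_add:
  assumes f: "f \<in> V" and g: "g \<in> V"
  shows "nrm (\<lambda>x. f x + g x) \<le> nrm f + nrm g"
proof (rule power2_le_imp_le)
  have "(nrm (\<lambda>x. f x + g x))\<^sup>2 = B f f + 2 * B f g + B g g"
    using quad[OF f g, of 1 1] nrm_sq[OF add_mem[OF f g]] by simp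
  also have "\<dots> \<le> (nrm f + nrm g)\<^sup>2"
    using cauchy_schwarz[OF f g] nrm_sq[OF f] nrm_sq[OF g] by (simp add: power2_sum)
  finally show "(nrm (\<lambda>x. f x + g x))\<^sup>2 \<le> (nrm f + nrm g)\<^sup>2" .
qed (simp add: f g nrm_nonneg)

lemma nrm_diff_commute:
  assumes f: "f \<in> V" and g: "g \<in> V"
  shows "nrm (\<lambda>x. f x - g x) = nrm (\<lambda>x. g x - f x)"
  by (simp add: nrm_def quad_diff f g sym[OF g f])

lemma nrm_diff_triangle:
  assumes "f \<in> V" "g \<in> V" "h \<in> V"
  shows "nrm (\<lambda>x. f x - h x) \<le> nrm (\<lambda>x. f x - g x) + nrm (\<lambda>x. g x - h x)"
  using nrm_add[OF diff_mem diff_mem, of f g g h] assms by simp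

lemma nrm_scale: "f \<in> V \<Longrightarrow> nrm (\<lambda>x. s * f x) = \<bar>s\<bar> * nrm f"
  using quad[of f f s 0] by (simp add: nrm_def real_sqrt_mult)

section \<open>Convergence in the seminorm\<close>

lemma conv_left:
  assumes s: "\<And>k. s k \<in> V" and f: "f \<in> V" and g: "g \<in> V" and c: "conv s f"
  shows "(\<lambda>k. B (s k) g) \<longlonglongrightarrow> B f g"
proof -
  have "(\<lambda>k. B (s k) g - B f g) \<longlonglongrightarrow> 0"
  proof (rule Lim_null_comparison)
    show "\<forall>\<^sub>F k in sequentially. norm (B (s k) g - B f g) \<le> nrm (\<lambda>x. s k x - f x) * nrm g"
      using cauchy_schwarz[OF diff_mem[OF s f] g] diff_left[OF s f g] by simp
    show "(\<lambda>k. nrm (\<lambda>x. s k x - f x) * nrm g) \<longlonglongrightarrow> 0"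
      using tendsto_mult_left_zero[OF c[unfolded conv_def]] .
  qed
  then show ?thesis using LIM_zero_iff by blast
qed

lemma conv_right:
  assumes s: "\<And>k. s k \<in> V" and f: "f \<in> V" and g: "g \<in> V" and c: "conv s f"
  shows "(\<lambda>k. B g (s k)) \<longlonglongrightarrow> B g f"
  using conv_left[OF assms] sym[OF s g] sym[OF f g] by simp

lemma conv_quad:
  assumes s: "\<And>k. s k \<in> V" and f: "f \<in> V" and c: "conv s f"
  shows "(\<lambda>k. B (s k) (s k)) \<longlonglongrightarrow> B f f"
proof -
  \<comment> \<open>Expanding around \<open>f\<close> leaves a squared distance and a term linear in
    \<open>s k\<close>, so \<open>conv_left\<close> suffices.\<close>
  have "(\<lambda>k. (nrm (\<lambda>x. s k x - f x))\<^sup>2 + 2 * B (s k) f - B f f) \<longlonglongrightarrow> 0\<^sup>2 + 2 * B f f - B f f"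
    using c[unfolded conv_def] conv_left[OF s f f c] by (intro tendsto_intros)
  moreover have "(nrm (\<lambda>x. s k x - f x))\<^sup>2 + 2 * B (s k) f - B f f = B (s k) (s k)" for k
    using quad_diff[OF s f] nrm_sq[OF diff_mem[OF s f]] by simp
  ultimately show ?thesis by simp
qed

lemma conv_lin:
  assumes s: "\<And>k. s k \<in> V" and f: "f \<in> V" and r: "\<And>k. r k \<in> V" and g: "g \<in> V"
    and sf: "conv s f" and rg: "conv r g"
  shows "conv (\<lambda>k x. a * s k x + b * r k x) (\<lambda>x. a * f x + b * g x)"
  unfolding conv_def
proof (rule Lim_null_comparison)
  have "nrm (\<lambda>x. (a * s k x + b * r k x) - (a * f x + b * g x)) \<le>
      \<bar>a\<bar> * nrm (\<lambda>x. s k x - f x) + \<bar>b\<bar> * nrm (\<lambda>x. r k x - g x)" for k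
  proof -
    have "(\<lambda>x. (a * s k x + b * r k x) - (a * f x + b * g x)) =
        (\<lambda>x. a * (s k x - f x) + b * (r k x - g x))"
      by (simp add: fun_eq_iff algebra_simps)
    then show ?thesis
      using nrm_add[OF scale_mem scale_mem, OF diff_mem[OF s f] diff_mem[OF r g], of a k b k]
      by (simp add: nrm_scale[OF diff_mem[OF s f]] nrm_scale[OF diff_mem[OF r g]])
  qed
  moreover have "0 \<le> nrm (\<lambda>x. (a * s k x + b * r k x) - (a * f x + b * g x))" for k
    by (intro nrm_nonneg diff_mem lin_mem s f r g)
  ultimately show "\<forall>\<^sub>F k in sequentially. norm (nrm (\<lambda>x. (a * s k x + b * r k x) - (a * f x + b * g x))) \<le>
      \<bar>a\<bar> * nrm (\<lambda>x. s k x - f x) + \<bar>b\<bar> * nrm (\<lambda>x. r k x - g x)"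
    by simp
  show "(\<lambda>k. \<bar>a\<bar> * nrm (\<lambda>x. s k x - f x) + \<bar>b\<bar> * nrm (\<lambda>x. r k x - g x)) \<longlonglongrightarrow> 0"
    using tendsto_add[OF tendsto_mult_right_zero[OF sf[unfolded conv_def]]
        tendsto_mult_right_zero[OF rg[unfolded conv_def]]] by simp
qed

text \<open>Riesz representation without completeness: the representing element may lie outside
  \<open>V\<close>, so a Cauchy sequence in \<open>V\<close> stands for it. The sequence minimizes
  \<open>J f = B f f - 2 * l f\<close>, which is bounded below by completing the square; the
  parallelogram law makes it Cauchy, and near-minimality along each direction \<open>f\<close>
  yields the limit equation.\<close>

lemma riesz_sequence:
  assumes l_lin: "\<And>f g s t. f \<in> V \<Longrightarrow> g \<in> V \<Longrightarrow> l (\<lambda>x. s * f x + t * g x) = s * l f + t * l g"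
    and l_bd: "\<And>f. f \<in> V \<Longrightarrow> l f \<le> K * nrm f"
  obtains s where "\<And>k. s k \<in> V"
    and "\<And>e. e > 0 \<Longrightarrow> \<exists>N. \<forall>m\<ge>N. \<forall>n\<ge>N. nrm (\<lambda>x. s m x - s n x) < e"
    and "\<And>f. f \<in> V \<Longrightarrow> (\<lambda>k. B (s k) f) \<longlonglongrightarrow> l f"
proof -
  define J where "J f = B f f - 2 * l f" for f
  have J_lower: "- K\<^sup>2 \<le> J f" if f: "f \<in> V" for f
  proof -
    have "0 \<le> (nrm f - K)\<^sup>2" by simp
    then show ?thesis
      using l_bd[OF f] nrm_sq[OF f] unfolding J_def
      by (simp add: power2_diff algebra_simps)
  qed
  then have bdd: "bdd_below (J ` V)" by (auto intro!: bdd_belowI)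
  define d where "d = Inf (J ` V)"
  have d_le: "d \<le> J f" if "f \<in> V" for f
    unfolding d_def using bdd that by (auto intro: cInf_lower)
  have "\<exists>f\<in>V. J f < d + 1 / real (Suc k)" for k
    using cInf_lessD[of "J ` V" "d + 1 / real (Suc k)"] zero_mem unfolding d_def by auto
  then obtain s where s: "\<And>k. s k \<in> V" and sJ: "\<And>k. J (s k) < d + 1 / real (Suc k)"
    by metis
  have inv0: "(\<lambda>k. 1 / real (Suc k)) \<longlonglongrightarrow> 0"
    using LIMSEQ_inverse_real_of_nat by (simp add: inverse_eq_divide)
  have diff: "B (\<lambda>x. s m x - s n x) (\<lambda>x. s m x - s n x) \<le> 2 / real (Suc m) + 2 / real (Suc n)" for m n
  proof -
    have mid: "(\<lambda>x. 1/2 * s m x + 1/2 * s n x) \<in> V" by (rule lin_mem[OF s s])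
    \<comment> \<open>Parallelogram law at the midpoint; the linear parts of the three
      \<open>J\<close> terms cancel.\<close>
    have "B (\<lambda>x. s m x - s n x) (\<lambda>x. s m x - s n x) =
        2 * J (s m) + 2 * J (s n) - 4 * J (\<lambda>x. 1/2 * s m x + 1/2 * s n x)"
      unfolding J_def quad_diff[OF s s] quad[OF s s] l_lin[OF s s]
      by (simp add: power2_eq_square)
    then show ?thesis using d_le[OF mid] sJ[of m] sJ[of n] by simp
  qed
  show thesis
  proof
    show "s k \<in> V" for k by (rule s)
  next
    fix e :: real assume e: "e > 0"
    obtain N where N: "1 / real (Suc k) < e\<^sup>2 / 4" if "k \<ge> N" for k
      using order_tendstoD(2)[OF inv0, of "e\<^sup>2 / 4"] e
      by (auto simp: eventually_sequentially)
    show "\<exists>N. \<forall>m\<ge>N. \<forall>n\<ge>N. nrm (\<lambda>x. s m x - s n x) < e"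
    proof (intro exI allI impI)
      fix m n assume "N \<le> m" "N \<le> n"
      then have "B (\<lambda>x. s m x - s n x) (\<lambda>x. s m x - s n x) < e\<^sup>2"
        using diff[of m n] N[of m] N[of n] by simp
      then show "nrm (\<lambda>x. s m x - s n x) < e"
        unfolding nrm_def using e by (simp add: real_less_lsqrt)
    qed
  next
    fix f assume f: "f \<in> V"
    have sq: "(B (s k) f - l f)\<^sup>2 \<le> (B f f + 1) * (1 / real (Suc k))" for k
    proof -
      define r where "r = B (s k) f - l f"
      \<comment> \<open>The minimizer of \<open>2 * t * r + t\<^sup>2 * (B f f + 1)\<close>. The
        added 1 keeps the denominator positive when \<open>f\<close> has seminorm 0.\<close>
      define t where "t = - r / (B f f + 1)"
      have P: "B f f + 1 > 0" using nonneg[OF f] by simp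
      have "J (\<lambda>x. 1 * s k x + t * f x) = J (s k) + 2 * t * r + t\<^sup>2 * B f f"
        unfolding J_def quad[OF s f] l_lin[OF s f] r_def by (simp add: algebra_simps)
      then have "0 \<le> 1 / real (Suc k) + 2 * t * r + t\<^sup>2 * B f f"
        using d_le[OF lin_mem[OF s[of k] f, of 1 t]] sJ[of k] by linarith
      also have "\<dots> \<le> 1 / real (Suc k) + 2 * t * r + t\<^sup>2 * (B f f + 1)"
        by (simp add: algebra_simps)
      also have "\<dots> = 1 / real (Suc k) - r\<^sup>2 / (B f f + 1)"
      proof -
        have tD: "t * (B f f + 1) = - r" using P by (simp add: t_def)
        have "2 * t * r + t\<^sup>2 * (B f f + 1) = 2 * t * r + t * (t * (B f f + 1))"
          by (simp add: power2_eq_square)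
        also have "\<dots> = - (r\<^sup>2 / (B f f + 1))"
          unfolding tD by (simp add: t_def power2_eq_square)
        finally show ?thesis by simp
      qed
      finally have "r\<^sup>2 / (B f f + 1) \<le> 1 / real (Suc k)" by simp
      then show ?thesis using P unfolding r_def by (simp add: divide_le_eq mult.commute)
    qed
    have "(\<lambda>k. (B (s k) f - l f)\<^sup>2) \<longlonglongrightarrow> 0"
    proof (rule Lim_null_comparison)
      show "\<forall>\<^sub>F k in sequentially. norm ((B (s k) f - l f)\<^sup>2) \<le> (B f f + 1) * (1 / real (Suc k))"
        using sq by simp
      show "(\<lambda>k. (B f f + 1) * (1 / real (Suc k))) \<longlonglongrightarrow> 0"
        using tendsto_mult_right_zero[OF inv0] .
    qed
    then have "(\<lambda>k. B (s k) f - l f) \<longlonglongrightarrow> 0"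
      using tendsto_real_sqrt[of "\<lambda>k. (B (s k) f - l f)\<^sup>2" 0]
      by (simp add: tendsto_rabs_zero_iff)
    then show "(\<lambda>k. B (s k) f) \<longlonglongrightarrow> l f" using LIM_zero_iff by blast
  qed
qed

text \<open>Hellinger--Toeplitz by a gliding hump: the increments are small compared with \<open>T\<close> of the
  preceding partial sums, and their signs keep the mixed terms of \<open>B (T s) s\<close> nonnegative.\<close>

lemma hellinger_toeplitz:
  assumes complete: "\<And>s. (\<And>k. s k \<in> V) \<Longrightarrow>
      (\<And>e. e > 0 \<Longrightarrow> \<exists>N. \<forall>m\<ge>N. \<forall>n\<ge>N. nrm (\<lambda>x. s m x - s n x) < e) \<Longrightarrow> \<exists>f\<in>V. conv s f"
    and T_mem: "\<And>f. f \<in> V \<Longrightarrow> T f \<in> V"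
    and T_lin: "\<And>f g h s t. f \<in> V \<Longrightarrow> g \<in> V \<Longrightarrow> h \<in> V \<Longrightarrow>
      B (T (\<lambda>x. s * f x + t * g x)) h = s * B (T f) h + t * B (T g) h"
    and T_sym: "\<And>f g. f \<in> V \<Longrightarrow> g \<in> V \<Longrightarrow> B (T f) g = B f (T g)"
    and T_pos: "\<And>f. f \<in> V \<Longrightarrow> 0 \<le> B (T f) f"
  shows "\<exists>K\<ge>0. \<forall>f\<in>V. B (T f) f \<le> K * B f f"
proof (rule ccontr)
  assume neg: "\<not> ?thesis"
  \<comment> \<open>The form is exactly linear in \<open>f\<close> even where \<open>T\<close> is
    linear only up to null functions; \<open>T_lin\<close> is stated after pairing for this
    reason.\<close>
  interpret Tf: psd_form V "\<lambda>f g. B (T f) g"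
    using zero_mem lin_mem T_lin T_pos T_sym sym T_mem by unfold_locales auto
  have big: "\<exists>g\<in>V. nrm g \<le> d \<and> 1 \<le> B (T g) g" if d: "d > 0" for d
  proof -
    \<comment> \<open>Negating the claim with \<open>K = 1 / d\<^sup>2\<close>; dividing
      \<open>f\<close> by the square root of \<open>B (T f) f\<close> then gives the required small
      vector.\<close>
    obtain f where f: "f \<in> V" and fb: "B (T f) f > (1 / d\<^sup>2) * B f f"
      using neg d by (meson not_le divide_nonneg_nonneg zero_le_one zero_le_power2)
    define r where "r = B (T f) f"
    have r: "r > 0" using fb nonneg[OF f] unfolding r_def
      by (smt (verit) divide_nonneg_nonneg mult_nonneg_nonneg zero_le_power2)
    have "B f f \<le> d\<^sup>2 * r"
      using fb d unfolding r_def by (simp add: divide_less_eq mult.commute less_imp_le)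
    then have "nrm f \<le> d * sqrt r"
      unfolding nrm_def using d real_sqrt_le_mono by (fastforce simp: real_sqrt_mult)
    then have "nrm (\<lambda>x. (1 / sqrt r) * f x) \<le> d"
      using r by (simp only: nrm_scale[OF f]) (simp add: field_simps)
    moreover have "B (T (\<lambda>x. (1 / sqrt r) * f x)) (\<lambda>x. (1 / sqrt r) * f x) = 1"
      using Tf.quad[OF f f, of "1 / sqrt r" 0] r by (simp add: r_def power_divide)
    ultimately show ?thesis using scale_mem[OF f] by (metis order_refl)
  qed
  \<comment> \<open>A pair holds a partial sum and the radius within which all later sums must stay.
    The product condition makes a change of that size alter \<open>B (T s)\<close> by at most 1,
    with \<open>s\<close> the partial sum; the power of 1/2 gives the Cauchy property.\<close>
  define Q where "Q n p \<longleftrightarrow> fst p \<in> V \<and> 0 < snd p \<and> snd p \<le> (1/2)^n \<and>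
      snd p * nrm (T (fst p)) \<le> 1 \<and> real n \<le> B (T (fst p)) (fst p)"
    for n and p :: "('x \<Rightarrow> real) \<times> real"
  define R where "R n p q \<longleftrightarrow> nrm (\<lambda>x. fst q x - fst p x) \<le> snd p / 2 \<and> snd q \<le> snd p / 2"
    for n :: nat and p q :: "('x \<Rightarrow> real) \<times> real"
  have "\<exists>p. \<forall>n. Q n (p n) \<and> R n (p n) (p (Suc n))"
  proof (rule dependent_nat_choice)
    have "B (T (\<lambda>x. 0)) (\<lambda>x. 0) = 0"
      using Tf.scale_left[OF zero_mem zero_mem, of 0] by simp
    moreover have nn: "0 \<le> nrm (T (\<lambda>x. 0))" by (rule nrm_nonneg[OF T_mem[OF zero_mem]])
    ultimately show "\<exists>p. Q 0 p"
      unfolding Q_def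
      by (intro exI[of _ "(\<lambda>x. 0, 1 / (1 + nrm (T (\<lambda>x. 0))))"])
        (simp add: zero_mem divide_le_eq)
  next
    fix p :: "('x \<Rightarrow> real) \<times> real" and n :: nat
    assume Qp: "Q n p"
    define s d where "s = fst p" and "d = snd p"
    have s: "s \<in> V" and d: "0 < d" "d \<le> (1/2)^n" and sn: "real n \<le> B (T s) s"
      using Qp by (auto simp: Q_def s_def d_def)
    obtain g where g: "g \<in> V" "nrm g \<le> d / 2" "1 \<le> B (T g) g" using big[of "d/2"] d by auto
    define e :: real where "e = (if B (T s) g \<ge> 0 then 1 else -1)"
    define s' where "s' = (\<lambda>x. 1 * s x + e * g x)"
    have s': "s' \<in> V" unfolding s'_def by (rule lin_mem[OF s g(1)])
    have ee: "e\<^sup>2 = 1" "\<bar>e\<bar> = 1" "e * B (T s) g \<ge> 0" by (auto simp: e_def)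
    define d' where "d' = min (d / 2) (1 / (1 + nrm (T s')))"
    have nn: "0 \<le> nrm (T s')" by (rule nrm_nonneg[OF T_mem[OF s']])
    have "d' * nrm (T s') \<le> (1 / (1 + nrm (T s'))) * nrm (T s')"
      unfolding d'_def using nn by (intro mult_right_mono) auto
    also have "\<dots> \<le> 1" using nn by (simp add: divide_le_eq)
    finally have d'T: "d' * nrm (T s') \<le> 1" .
    have d': "0 < d'" "d' \<le> d / 2" using d nn by (auto simp: d'_def)
    then have d'n: "d' \<le> (1/2)^Suc n" using d by simp
    have growth: "B (T s') s' \<ge> real (Suc n)"
      unfolding s'_def Tf.quad[OF s g(1)] using ee sn g(3) by simp
    have close: "nrm (\<lambda>x. s' x - s x) \<le> d / 2"
      unfolding s'_def using nrm_scale[OF g(1), of e] ee g(2) by simp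
    show "\<exists>q. Q (Suc n) q \<and> R n p q"
      unfolding Q_def R_def using s' d'T d' d'n growth close
      by (intro exI[of _ "(s', d')"]) (simp add: s_def d_def)
  qed
  then obtain p where Qp: "\<And>n. Q n (p n)" and Rp: "\<And>n. R n (p n) (p (Suc n))" by blast
  define s d where "s n = fst (p n)" and "d n = snd (p n)" for n
  have s: "s n \<in> V" and d0: "0 < d n" and d_le: "d n \<le> (1/2)^n"
    and dT: "d n * nrm (T (s n)) \<le> 1" and sT: "real n \<le> B (T (s n)) (s n)" for n
    using Qp[of n] by (auto simp: Q_def s_def d_def)
  have step: "nrm (\<lambda>x. s (Suc n) x - s n x) \<le> d n / 2" and dstep: "d (Suc n) \<le> d n / 2" for n
    using Rp[of n] by (auto simp: R_def s_def d_def)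
  \<comment> \<open>Subtracting \<open>d (n + k)\<close> closes the induction: a step costs at most
    \<open>d (n + k) / 2\<close>, and halving lowers \<open>d\<close> by at least as much.\<close>
  have tail: "nrm (\<lambda>x. s (n + k) x - s n x) \<le> d n - d (n + k)" for n k
  proof (induction k)
    case 0
    show ?case using scale_left[OF zero_mem zero_mem, of 0] by (simp add: nrm_def)
  next
    case (Suc k)
    have "nrm (\<lambda>x. s (Suc (n + k)) x - s n x) \<le> d (n + k) / 2 + (d n - d (n + k))"
      using nrm_diff_triangle[OF s[of "Suc (n+k)"] s[of "n+k"] s[of n]] step[of "n+k"] Suc by simp
    then show ?case using dstep[of "n+k"] by simp
  qed
  have tail': "nrm (\<lambda>x. s m x - s n x) \<le> d n" if "n \<le> m" for m n
    using tail[of n "m - n"] d0[of m] that by simp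
  have "\<exists>f\<in>V. conv s f"
  proof (rule complete[OF s])
    fix e :: real assume e: "e > 0"
    then obtain N where N: "(1/2::real)^N < e" using real_arch_pow_inv[of e "1/2"] by auto
    have "nrm (\<lambda>x. s m x - s n x) < e" if "m \<ge> N" "n \<ge> N" for m n
    proof -
      have pw: "(1/2::real)^k < e" if "k \<ge> N" for k
        by (rule le_less_trans[OF power_decreasing[OF that] N]) auto
      show ?thesis
        using tail'[of m n] tail'[of n m] d_le[of m] d_le[of n] pw[OF that(1)] pw[OF that(2)]
          nrm_diff_commute[OF s s, of m n] by (cases "n \<le> m") (auto)
    qed
    then show "\<exists>N. \<forall>m\<ge>N. \<forall>n\<ge>N. nrm (\<lambda>x. s m x - s n x) < e" by blast
  qed
  then obtain f where f: "f \<in> V" and sf: "conv s f" by blast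
  have ftail: "nrm (\<lambda>x. f x - s n x) \<le> d n" for n
  proof (rule field_le_epsilon)
    fix e :: real assume "e > 0"
    then have "\<forall>\<^sub>F m in sequentially. nrm (\<lambda>x. s m x - f x) < e"
      by (rule order_tendstoD(2)[OF sf[unfolded conv_def]])
    then obtain N where N: "\<And>m. m \<ge> N \<Longrightarrow> nrm (\<lambda>x. s m x - f x) < e"
      unfolding eventually_sequentially by blast
    define m where "m = max n N"
    have m: "m \<ge> n" "nrm (\<lambda>x. s m x - f x) < e" using N[of m] by (auto simp: m_def)
    then show "nrm (\<lambda>x. f x - s n x) \<le> d n + e"
      using nrm_diff_triangle[OF f s[of m] s[of n]] tail'[OF m(1)] nrm_diff_commute[OF f s, of m]
      by simp
  qed
  \<comment> \<open>Symmetry moves \<open>T\<close> from \<open>s n\<close> to the fixed limit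
    \<open>f\<close>, and the remainder is at most 1 by the choice of \<open>d n\<close>. The left
    side grows without bound, the right side is constant.\<close>
  have bound: "real n \<le> (nrm f + 1) * nrm (T f) + 1" for n
  proof -
    have "real n \<le> B (T (s n)) (s n)" by (rule sT)
    also have "\<dots> = B (s n) (T f) - B (T (s n)) (\<lambda>x. f x - s n x)"
      using T_sym[OF s f, of n] diff_left[OF f s T_mem[OF s], of n n]
        sym[OF T_mem[OF s] diff_mem[OF f s], of n n] sym[OF T_mem[OF s] f, of n]
        sym[OF T_mem[OF s] s, of n n] by simp
    also have "\<dots> \<le> nrm (s n) * nrm (T f) + nrm (T (s n)) * nrm (\<lambda>x. f x - s n x)"
      using cauchy_schwarz[OF s T_mem[OF f], of n]
        cauchy_schwarz[OF T_mem[OF s] diff_mem[OF f s], of n n] by simp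
    also have "\<dots> \<le> (nrm f + 1) * nrm (T f) + 1"
    proof (rule add_mono)
      have "nrm (s n) \<le> nrm f + nrm (\<lambda>x. s n x - f x)"
        using nrm_add[OF f diff_mem[OF s f], of n] by simp
      also have "\<dots> \<le> nrm f + 1"
        using ftail[of n] nrm_diff_commute[OF f s, of n] d_le[of n]
          power_le_one[of "1/2::real" n] by simp
      finally show "nrm (s n) * nrm (T f) \<le> (nrm f + 1) * nrm (T f)"
        by (intro mult_right_mono nrm_nonneg T_mem f)
      have "nrm (T (s n)) * nrm (\<lambda>x. f x - s n x) \<le> nrm (T (s n)) * d n"
        by (intro mult_left_mono ftail nrm_nonneg T_mem s)
      then show "nrm (T (s n)) * nrm (\<lambda>x. f x - s n x) \<le> 1"
        using dT[of n] by (simp add: mult.commute)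
    qed
    finally show ?thesis .
  qed
  show False
    using bound reals_Archimedean2 by (meson not_le)
qed

end

section \<open>The space of square integrable functions\<close>

definition L2_ip :: "(real^'n) set \<Rightarrow> (real^'n \<Rightarrow> real) \<Rightarrow> (real^'n \<Rightarrow> real) \<Rightarrow> real" where
  "L2_ip \<Omega> f g = (LINT \<omega>|lebesgue_on \<Omega>. f \<omega> * g \<omega>)"

lemma L2_measurable: "f \<in> L2 \<Omega> \<Longrightarrow> f \<in> borel_measurable (lebesgue_on \<Omega>)"
  by (simp add: L2_def)

lemma L2_mult_integrable:
  assumes f: "f \<in> L2 \<Omega>" and g: "g \<in> L2 \<Omega>"
  shows "integrable (lebesgue_on \<Omega>) (\<lambda>\<omega>. f \<omega> * g \<omega>)"
proof (rule Bochner_Integration.integrable_bound)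
  show "integrable (lebesgue_on \<Omega>) (\<lambda>\<omega>. (f \<omega>)\<^sup>2 + (g \<omega>)\<^sup>2)"
    using f g by (auto simp: L2_def)
  show "(\<lambda>\<omega>. f \<omega> * g \<omega>) \<in> borel_measurable (lebesgue_on \<Omega>)"
    using f g by (auto simp: L2_def)
  have "\<bar>a * b\<bar> \<le> \<bar>a\<^sup>2 + b\<^sup>2\<bar>" for a b :: real
  proof -
    have "0 \<le> (\<bar>a\<bar> - \<bar>b\<bar>)\<^sup>2" by simp
    then have "2 * (\<bar>a\<bar> * \<bar>b\<bar>) \<le> a\<^sup>2 + b\<^sup>2" by (simp add: power2_diff)
    moreover have "0 \<le> \<bar>a\<bar> * \<bar>b\<bar>" by simp
    ultimately show ?thesis unfolding abs_mult by linarith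
  qed
  then show "AE \<omega> in lebesgue_on \<Omega>. norm (f \<omega> * g \<omega>) \<le> norm ((f \<omega>)\<^sup>2 + (g \<omega>)\<^sup>2)"
    by simp
qed

lemma L2_lin:
  assumes f: "f \<in> L2 \<Omega>" and g: "g \<in> L2 \<Omega>"
  shows "(\<lambda>\<omega>. s * f \<omega> + t * g \<omega>) \<in> L2 \<Omega>"
proof -
  have "integrable (lebesgue_on \<Omega>) (\<lambda>\<omega>. s\<^sup>2 * (f \<omega>)\<^sup>2 + (2 * s * t) * (f \<omega> * g \<omega>) + t\<^sup>2 * (g \<omega>)\<^sup>2)"
    using f g L2_mult_integrable[OF f g] by (auto simp: L2_def)
  moreover have "(\<lambda>\<omega>. s\<^sup>2 * (f \<omega>)\<^sup>2 + (2 * s * t) * (f \<omega> * g \<omega>) + t\<^sup>2 * (g \<omega>)\<^sup>2) =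
      (\<lambda>\<omega>. (s * f \<omega> + t * g \<omega>)\<^sup>2)"
    by (simp add: fun_eq_iff power2_sum power_mult_distrib algebra_simps)
  ultimately show ?thesis using f g by (auto simp: L2_def)
qed

interpretation L2: psd_form "L2 \<Omega>" "L2_ip \<Omega>" for \<Omega> :: "(real^'n) set"
proof
  fix f g h :: "real^'n \<Rightarrow> real" and s t :: real
  show "(\<lambda>x. 0) \<in> L2 \<Omega>" by (simp add: L2_def)
  show "f \<in> L2 \<Omega> \<Longrightarrow> g \<in> L2 \<Omega> \<Longrightarrow> (\<lambda>x. s * f x + t * g x) \<in> L2 \<Omega>" by (rule L2_lin)
  show "f \<in> L2 \<Omega> \<Longrightarrow> g \<in> L2 \<Omega> \<Longrightarrow> L2_ip \<Omega> f g = L2_ip \<Omega> g f"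
    by (simp add: L2_ip_def mult.commute)
  show "f \<in> L2 \<Omega> \<Longrightarrow> 0 \<le> L2_ip \<Omega> f f" by (simp add: L2_ip_def)
  assume "f \<in> L2 \<Omega>" "g \<in> L2 \<Omega>" "h \<in> L2 \<Omega>"
  then show "L2_ip \<Omega> (\<lambda>x. s * f x + t * g x) h = s * L2_ip \<Omega> f h + t * L2_ip \<Omega> g h"
    using L2_mult_integrable[of f \<Omega> h] L2_mult_integrable[of g \<Omega> h]
    by (simp add: L2_ip_def distrib_right mult.assoc)
qed

abbreviation L2_norm :: "(real^'n) set \<Rightarrow> (real^'n \<Rightarrow> real) \<Rightarrow> real" where
  "L2_norm \<Omega> \<equiv> psd_form.nrm (L2_ip \<Omega>)"

abbreviation L2_conv :: "(real^'n) set \<Rightarrow> (nat \<Rightarrow> real^'n \<Rightarrow> real) \<Rightarrow> (real^'n \<Rightarrow> real) \<Rightarrow> bool" where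
  "L2_conv \<Omega> \<equiv> psd_form.conv (L2_ip \<Omega>)"

lemma L2_ip_cong:
  assumes "f \<in> L2 \<Omega>" "f' \<in> L2 \<Omega>" "g \<in> L2 \<Omega>" "g' \<in> L2 \<Omega>"
    and "ae_eq \<Omega> f f'" "ae_eq \<Omega> g g'"
  shows "L2_ip \<Omega> f g = L2_ip \<Omega> f' g'"
  unfolding L2_ip_def using assms
  by (intro integral_cong_AE borel_measurable_times L2_measurable) (auto simp: ae_eq_def)

lemma L2_ip_self_eq_0:
  assumes f: "f \<in> L2 \<Omega>"
  shows "L2_ip \<Omega> f f = 0 \<longleftrightarrow> ae_eq \<Omega> f (\<lambda>\<omega>. 0)"
  using integral_nonneg_eq_0_iff_AE[OF L2_mult_integrable[OF f f]]
  by (simp add: L2_ip_def ae_eq_def)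

lemma ae_eq_iff_diff: "ae_eq \<Omega> f g \<longleftrightarrow> ae_eq \<Omega> (\<lambda>\<omega>. f \<omega> - g \<omega> :: real) (\<lambda>\<omega>. 0)"
  by (simp add: ae_eq_def)

lemma L2_mult_bounded:
  assumes m: "m \<in> borel_measurable (lebesgue_on \<Omega>)"
    and C: "AE \<omega> in lebesgue_on \<Omega>. \<bar>m \<omega>\<bar> \<le> C" and f: "f \<in> L2 \<Omega>"
  shows "(\<lambda>\<omega>. m \<omega> * f \<omega>) \<in> L2 \<Omega>"
    and "L2_ip \<Omega> (\<lambda>\<omega>. m \<omega> * f \<omega>) (\<lambda>\<omega>. m \<omega> * f \<omega>) \<le> C\<^sup>2 * L2_ip \<Omega> f f"
proof -
  have ff: "integrable (lebesgue_on \<Omega>) (\<lambda>\<omega>. C\<^sup>2 * (f \<omega> * f \<omega>))"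
    using L2_mult_integrable[OF f f] by simp
  have le: "AE \<omega> in lebesgue_on \<Omega>. (m \<omega> * f \<omega>) * (m \<omega> * f \<omega>) \<le> C\<^sup>2 * (f \<omega> * f \<omega>)"
    using C
  proof eventually_elim
    case (elim \<omega>)
    then have "(m \<omega>)\<^sup>2 \<le> C\<^sup>2" by (metis abs_ge_zero power2_abs power_mono)
    then have "(m \<omega>)\<^sup>2 * (f \<omega>)\<^sup>2 \<le> C\<^sup>2 * (f \<omega>)\<^sup>2" by (intro mult_right_mono) auto
    then show ?case by (simp add: power2_eq_square algebra_simps)
  qed
  have meas: "(\<lambda>\<omega>. (m \<omega> * f \<omega>) * (m \<omega> * f \<omega>)) \<in> borel_measurable (lebesgue_on \<Omega>)"
    using m L2_measurable[OF f] by measurable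
  have int: "integrable (lebesgue_on \<Omega>) (\<lambda>\<omega>. (m \<omega> * f \<omega>) * (m \<omega> * f \<omega>))"
    by (rule Bochner_Integration.integrable_bound[OF ff meas]) (use le in auto)
  then show "(\<lambda>\<omega>. m \<omega> * f \<omega>) \<in> L2 \<Omega>"
    using m L2_measurable[OF f] by (auto simp: L2_def power2_eq_square)
  have "L2_ip \<Omega> (\<lambda>\<omega>. m \<omega> * f \<omega>) (\<lambda>\<omega>. m \<omega> * f \<omega>) \<le> (LINT \<omega>|lebesgue_on \<Omega>. C\<^sup>2 * (f \<omega> * f \<omega>))"
    unfolding L2_ip_def by (rule integral_mono_AE[OF int ff le])
  then show "L2_ip \<Omega> (\<lambda>\<omega>. m \<omega> * f \<omega>) (\<lambda>\<omega>. m \<omega> * f \<omega>) \<le> C\<^sup>2 * L2_ip \<Omega> f f"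
    by (simp add: L2_ip_def)
qed

lemma L2_sum:
  assumes "finite I" "\<And>i. i \<in> I \<Longrightarrow> f i \<in> L2 \<Omega>"
  shows "(\<lambda>\<omega>. \<Sum>i\<in>I. f i \<omega>) \<in> L2 \<Omega>"
  using assms by (induction I rule: finite_induct) (auto simp: L2.zero_mem L2.add_mem)

text \<open>The square root of a strictly positive integrable function, available because Lebesgue
  measure is sigma-finite. Strict positivity allows the weight to be divided out again in pointwise
  limits.\<close>

lemma L2_positive_weight:
  fixes \<Omega> :: "(real^'n) set"
  assumes \<Omega>: "\<Omega> \<in> sets lebesgue"
  obtains h :: "real^'n \<Rightarrow> real" where "h \<in> L2 \<Omega>" "\<And>\<omega>. h \<omega> > 0"
proof -
  obtain w :: "real^'n \<Rightarrow> real" where w: "w \<in> borel_measurable lborel" "\<And>x. w x > 0" "integrable lborel w"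
    using sigma_finite_measure.obtain_positive_integrable_function[OF sigma_finite_lborel] by metis
  have "integrable lebesgue w" using w(1,3) by (simp add: integrable_completion)
  then have "integrable (lebesgue_on \<Omega>) w"
    using \<Omega> integrable_mult_indicator[of \<Omega> lebesgue w] by (simp add: integrable_restrict_space)
  moreover have "(\<lambda>\<omega>. sqrt (w \<omega>)) \<in> borel_measurable (lebesgue_on \<Omega>)"
    using borel_measurable_integrable[OF calculation] by measurable
  moreover have "(sqrt (w \<omega>))\<^sup>2 = w \<omega>" for \<omega> using w(2)[of \<omega>] by simp
  ultimately have "(\<lambda>\<omega>. sqrt (w \<omega>)) \<in> L2 \<Omega>" by (simp add: L2_def)
  then show thesis using that w(2) by simp
qed

text \<open>The weight turns \<open>L\<^sup>2\<close>-Cauchy sequences into \<open>L\<^sup>1\<close>-Cauchy ones even when \<open>\<Omega>\<close> has infinite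
  measure, so that an a.e. convergent subsequence exists; Fatou's lemma does the rest.\<close>

lemma L2_complete:
  fixes \<Omega> :: "(real^'n) set"
  assumes \<Omega>: "\<Omega> \<in> sets lebesgue" and s: "\<And>k. s k \<in> L2 \<Omega>"
    and cauchy: "\<And>e. e > 0 \<Longrightarrow> \<exists>N. \<forall>m\<ge>N. \<forall>n\<ge>N. L2_norm \<Omega> (\<lambda>x. s m x - s n x) < e"
  shows "\<exists>f\<in>L2 \<Omega>. L2_conv \<Omega> s f"
proof -
  let ?M = "lebesgue_on \<Omega>"
  obtain h :: "real^'n \<Rightarrow> real" where h: "h \<in> L2 \<Omega>" and hpos: "\<And>\<omega>. h \<omega> > 0"
    using L2_positive_weight[OF \<Omega>] by blast
  have L1: "(LINT \<omega>|?M. norm (h \<omega> * s i \<omega> - h \<omega> * s j \<omega>)) \<le> L2_norm \<Omega> h * L2_norm \<Omega> (\<lambda>x. s i x - s j x)"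
    for i j
  proof -
    have d: "(\<lambda>x. s i x - s j x) \<in> L2 \<Omega>" by (rule L2.diff_mem[OF s s])
    then have d': "(\<lambda>x. \<bar>s i x - s j x\<bar>) \<in> L2 \<Omega>" by (auto simp: L2_def)
    have "(LINT \<omega>|?M. norm (h \<omega> * s i \<omega> - h \<omega> * s j \<omega>)) = L2_ip \<Omega> h (\<lambda>x. \<bar>s i x - s j x\<bar>)"
      unfolding L2_ip_def using hpos
      by (simp add: abs_mult less_imp_le flip: right_diff_distrib)
    also have "\<dots> \<le> L2_norm \<Omega> h * L2_norm \<Omega> (\<lambda>x. \<bar>s i x - s j x\<bar>)"
      using L2.cauchy_schwarz[OF h d'] by simp
    also have "L2_norm \<Omega> (\<lambda>x. \<bar>s i x - s j x\<bar>) = L2_norm \<Omega> (\<lambda>x. s i x - s j x)"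
      by (simp add: L2.nrm_def L2_ip_def)
    finally show ?thesis .
  qed
  obtain r where r: "strict_mono r" and rC: "AE \<omega> in ?M. Cauchy (\<lambda>i. h \<omega> * s (r i) \<omega>)"
  proof (rule cauchy_L1_AE_cauchy_subseq[of ?M "\<lambda>k \<omega>. h \<omega> * s k \<omega>"])
    show "integrable ?M (\<lambda>\<omega>. h \<omega> * s n \<omega>)" for n by (rule L2_mult_integrable[OF h s])
    fix e :: real assume e: "e > 0"
    have hn: "0 \<le> L2_norm \<Omega> h" by (rule L2.nrm_nonneg[OF h])
    then have "e / (L2_norm \<Omega> h + 1) > 0" using e by simp
    then obtain N where N: "\<And>m n. m \<ge> N \<Longrightarrow> n \<ge> N \<Longrightarrow>
        L2_norm \<Omega> (\<lambda>x. s m x - s n x) < e / (L2_norm \<Omega> h + 1)"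
      using cauchy by meson
    have "(LINT \<omega>|?M. norm (h \<omega> * s i \<omega> - h \<omega> * s j \<omega>)) < e" if "i \<ge> N" "j \<ge> N" for i j
    proof -
      have "(LINT \<omega>|?M. norm (h \<omega> * s i \<omega> - h \<omega> * s j \<omega>)) \<le> L2_norm \<Omega> h * (e / (L2_norm \<Omega> h + 1))"
        using order_trans[OF L1[of i j] mult_left_mono[OF less_imp_le[OF N[OF that]] hn]] .
      also have "\<dots> < e" using hn e by (simp add: divide_less_eq)
      finally show ?thesis .
    qed
    then show "\<exists>N. \<forall>i\<ge>N. \<forall>j\<ge>N. (LINT \<omega>|?M. norm (h \<omega> * s i \<omega> - h \<omega> * s j \<omega>)) < e" by blast
  qed blast
  define f where "f \<omega> = lim (\<lambda>i. s (r i) \<omega>)" for \<omega>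
  have f_meas: "f \<in> borel_measurable ?M"
    unfolding f_def using L2_measurable[OF s] by (intro borel_measurable_lim_metric) auto
  have f_lim: "AE \<omega> in ?M. (\<lambda>i. s (r i) \<omega>) \<longlonglongrightarrow> f \<omega>"
    using rC
  proof eventually_elim
    case (elim \<omega>)
    then obtain l where "(\<lambda>i. h \<omega> * s (r i) \<omega>) \<longlonglongrightarrow> l"
      using Cauchy_convergent convergentD by blast
    then have "(\<lambda>i. h \<omega> * s (r i) \<omega> / h \<omega>) \<longlonglongrightarrow> l / h \<omega>"
      using hpos[of \<omega>] by (intro tendsto_divide) auto
    then have "(\<lambda>i. s (r i) \<omega>) \<longlonglongrightarrow> l / h \<omega>" using hpos[of \<omega>] by simp
    then show ?case unfolding f_def using convergentI convergent_LIMSEQ_iff by blast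
  qed
  \<comment> \<open>Fatou's lemma along the subsequence, with \<open>n\<close> fixed. Membership in
    \<open>L2\<close> is part of the claim because \<open>f\<close> itself is not yet known to be
    square integrable.\<close>
  have est: "(\<lambda>x. s n x - f x) \<in> L2 \<Omega> \<and> L2_norm \<Omega> (\<lambda>x. s n x - f x) \<le> e"
    if e: "e > 0" and N: "\<And>m. m \<ge> N \<Longrightarrow> L2_norm \<Omega> (\<lambda>x. s m x - s n x) < e" for e n N
  proof -
    have "(\<integral>\<^sup>+\<omega>. ennreal ((s n \<omega> - f \<omega>)\<^sup>2) \<partial>?M) =
        (\<integral>\<^sup>+\<omega>. liminf (\<lambda>i. ennreal ((s (r i) \<omega> - s n \<omega>)\<^sup>2)) \<partial>?M)"
    proof (rule nn_integral_cong_AE)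
      show "AE \<omega> in ?M. ennreal ((s n \<omega> - f \<omega>)\<^sup>2) = liminf (\<lambda>i. ennreal ((s (r i) \<omega> - s n \<omega>)\<^sup>2))"
        using f_lim
      proof eventually_elim
        case (elim \<omega>)
        have "(\<lambda>i. ennreal ((s (r i) \<omega> - s n \<omega>)\<^sup>2)) \<longlonglongrightarrow> ennreal ((f \<omega> - s n \<omega>)\<^sup>2)"
          by (intro tendsto_intros elim tendsto_ennrealI)
        then show ?case using lim_imp_Liminf[OF sequentially_bot] by (metis power2_commute)
      qed
    qed
    also have "\<dots> \<le> liminf (\<lambda>i. \<integral>\<^sup>+\<omega>. ennreal ((s (r i) \<omega> - s n \<omega>)\<^sup>2) \<partial>?M)"
      using L2_measurable[OF s] by (intro nn_integral_liminf) measurable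
    also have "\<dots> \<le> ennreal (e\<^sup>2)"
    proof (rule Liminf_le)
      show "sequentially \<noteq> bot" by simp
      show "\<forall>\<^sub>F i in sequentially. (\<integral>\<^sup>+\<omega>. ennreal ((s (r i) \<omega> - s n \<omega>)\<^sup>2) \<partial>?M) \<le> ennreal (e\<^sup>2)"
      proof (rule eventually_sequentiallyI[of N])
        fix i assume "N \<le> i"
        then have "N \<le> r i" using seq_suble[OF r, of i] by simp
        then have "L2_norm \<Omega> (\<lambda>x. s (r i) x - s n x) \<le> e" using N less_imp_le by blast
        then have "(L2_norm \<Omega> (\<lambda>x. s (r i) x - s n x))\<^sup>2 \<le> e\<^sup>2"
          using L2.nrm_nonneg[OF L2.diff_mem[OF s s]] by (intro power_mono) auto
        moreover have "(\<integral>\<^sup>+\<omega>. ennreal ((s (r i) \<omega> - s n \<omega>)\<^sup>2) \<partial>?M) =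
            ennreal ((L2_norm \<Omega> (\<lambda>x. s (r i) x - s n x))\<^sup>2)"
          using nn_integral_eq_integral[OF L2_mult_integrable[OF L2.diff_mem[OF s s] L2.diff_mem[OF s s]]]
          by (simp add: L2.nrm_sq L2.diff_mem s) (simp add: L2_ip_def power2_eq_square)
        ultimately show "(\<integral>\<^sup>+\<omega>. ennreal ((s (r i) \<omega> - s n \<omega>)\<^sup>2) \<partial>?M) \<le> ennreal (e\<^sup>2)"
          by (simp add: ennreal_leI)
      qed
    qed
    finally have le: "(\<integral>\<^sup>+\<omega>. ennreal ((s n \<omega> - f \<omega>)\<^sup>2) \<partial>?M) \<le> ennreal (e\<^sup>2)" .
    have meas: "(\<lambda>\<omega>. s n \<omega> - f \<omega>) \<in> borel_measurable ?M"
      using f_meas L2_measurable[OF s] by measurable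
    have int: "integrable ?M (\<lambda>\<omega>. (s n \<omega> - f \<omega>)\<^sup>2)"
      by (rule integrableI_nonneg)
        (use meas le in \<open>auto simp: le_less_trans[OF le] intro: borel_measurable_power\<close>)
    then have d: "(\<lambda>x. s n x - f x) \<in> L2 \<Omega>" using meas by (simp add: L2_def)
    have "ennreal (LINT \<omega>|?M. (s n \<omega> - f \<omega>)\<^sup>2) \<le> ennreal (e\<^sup>2)"
      using le nn_integral_eq_integral[OF int] by simp
    then have "L2_ip \<Omega> (\<lambda>x. s n x - f x) (\<lambda>x. s n x - f x) \<le> e\<^sup>2"
      by (simp add: L2_ip_def power2_eq_square)
    then show ?thesis using d e by (simp add: L2.nrm_def real_le_lsqrt)
  qed
  obtain N1 where N1: "\<And>m n. m \<ge> N1 \<Longrightarrow> n \<ge> N1 \<Longrightarrow> L2_norm \<Omega> (\<lambda>x. s m x - s n x) < 1"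
    using cauchy[of 1] by auto
  have "(\<lambda>x. s N1 x - f x) \<in> L2 \<Omega>" using est[of 1 N1 N1] N1 by auto
  then have f: "f \<in> L2 \<Omega>" using L2.diff_mem[OF s[of N1]] by fastforce
  have "L2_conv \<Omega> s f"
    unfolding L2.conv_def
  proof (rule LIMSEQ_I)
    fix e :: real assume e: "e > 0"
    then obtain N where N: "\<And>m n. m \<ge> N \<Longrightarrow> n \<ge> N \<Longrightarrow> L2_norm \<Omega> (\<lambda>x. s m x - s n x) < e / 2"
      using cauchy[of "e/2"] by auto
    have "norm (L2_norm \<Omega> (\<lambda>x. s n x - f x) - 0) < e" if "n \<ge> N" for n
      using est[of "e/2" N n] N[OF _ that] e L2.nrm_nonneg[OF L2.diff_mem[OF s f, of n]] by simp
    then show "\<exists>no. \<forall>n\<ge>no. norm (L2_norm \<Omega> (\<lambda>x. s n x - f x) - 0) < e" by blast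
  qed
  then show ?thesis using f by blast
qed

section \<open>Test functions and integration by parts\<close>

lemma partial_deriv_eqI:
  "(f has_derivative f') (at \<omega>) \<Longrightarrow> partial_deriv i f \<omega> = f' (axis i 1)"
  unfolding partial_deriv_def using frechet_derivative_at by metis

lemma smooth_differentiable: "smooth f \<Longrightarrow> f differentiable (at \<omega>)"
  unfolding smooth_def by (metis foldr_Nil id_apply)

lemma smooth_partial_deriv: "smooth f \<Longrightarrow> smooth (partial_deriv i f)"
  unfolding smooth_def
proof (intro allI)
  fix js \<omega> assume "\<forall>js \<omega>. foldr partial_deriv js f differentiable at \<omega>"
  \<comment> \<open>\<open>foldr\<close> applies the last list entry first, so \<open>i\<close> is
    appended at the end.\<close>
  then have "foldr partial_deriv (js @ [i]) f differentiable at \<omega>" by blast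
  then show "foldr partial_deriv js (partial_deriv i f) differentiable at \<omega>" by simp
qed

lemma smooth_continuous: "smooth f \<Longrightarrow> continuous_on A f"
  by (simp add: continuous_at_imp_continuous_on differentiable_imp_continuous_within smooth_differentiable)

lemma partial_deriv_lin:
  assumes "\<And>\<omega>. f differentiable (at \<omega>)" "\<And>\<omega>. g differentiable (at \<omega>)"
  shows "partial_deriv i (\<lambda>\<omega>. s * f \<omega> + t * g \<omega>) =
    (\<lambda>\<omega>. s * partial_deriv i f \<omega> + t * partial_deriv i g \<omega>)"
proof
  fix \<omega>
  have "((\<lambda>\<omega>. s * f \<omega> + t * g \<omega>) has_derivative
      (\<lambda>v. s * frechet_derivative f (at \<omega>) v + t * frechet_derivative g (at \<omega>) v)) (at \<omega>)"
    using assms[of \<omega>] by (intro derivative_intros) (auto simp: frechet_derivative_works)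
  from partial_deriv_eqI[OF this]
  show "partial_deriv i (\<lambda>\<omega>. s * f \<omega> + t * g \<omega>) \<omega> =
    s * partial_deriv i f \<omega> + t * partial_deriv i g \<omega>"
    by (simp add: partial_deriv_def)
qed

lemma partial_deriv_mult:
  assumes "f differentiable (at \<omega>)" "g differentiable (at \<omega>)"
  shows "partial_deriv i (\<lambda>\<omega>. f \<omega> * g \<omega>) \<omega> = f \<omega> * partial_deriv i g \<omega> + partial_deriv i f \<omega> * g \<omega>"
proof -
  have "((\<lambda>\<omega>. f \<omega> * g \<omega>) has_derivative
      (\<lambda>v. f \<omega> * frechet_derivative g (at \<omega>) v + frechet_derivative f (at \<omega>) v * g \<omega>)) (at \<omega>)"
    using assms by (intro derivative_intros) (auto simp: frechet_derivative_works)
  from partial_deriv_eqI[OF this] show ?thesis by (simp add: partial_deriv_def)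
qed

lemma smooth_lin:
  assumes f: "smooth f" and g: "smooth g"
  shows "smooth (\<lambda>\<omega>. s * f \<omega> + t * g \<omega>)"
proof -
  have eq: "foldr partial_deriv js (\<lambda>\<omega>. s * f \<omega> + t * g \<omega>) =
      (\<lambda>\<omega>. s * foldr partial_deriv js f \<omega> + t * foldr partial_deriv js g \<omega>)" for js
    by (induction js) (use f g in \<open>auto simp: partial_deriv_lin smooth_def\<close>)
  show ?thesis
    unfolding smooth_def eq using f g unfolding smooth_def
    by (auto intro!: derivative_intros)
qed

lemma test_fun_smooth: "\<phi> \<in> test_fun \<Omega> \<Longrightarrow> smooth \<phi>"
  by (simp add: test_fun_def)

lemma compact_subset: "compact S \<Longrightarrow> closed T \<Longrightarrow> T \<subseteq> S \<Longrightarrow> compact T"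
  using closed_Int_compact[of T S] by (simp add: Int_absorb2)

lemma test_fun_lin:
  assumes "\<phi> \<in> test_fun \<Omega>" "\<psi> \<in> test_fun \<Omega>"
  shows "(\<lambda>\<omega>. s * \<phi> \<omega> + t * \<psi> \<omega>) \<in> test_fun \<Omega>"
proof -
  let ?S = "closure {\<omega>. \<phi> \<omega> \<noteq> 0} \<union> closure {\<omega>. \<psi> \<omega> \<noteq> 0}"
  have S: "compact ?S" "?S \<subseteq> \<Omega>" using assms by (auto simp: test_fun_def)
  have "{\<omega>. s * \<phi> \<omega> + t * \<psi> \<omega> \<noteq> 0} \<subseteq> ?S"
    using closure_subset[of "{\<omega>. \<phi> \<omega> \<noteq> 0}"] closure_subset[of "{\<omega>. \<psi> \<omega> \<noteq> 0}"]
    by (auto simp: subset_iff) (metis add_0 mult_zero_right)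
  then have sub: "closure {\<omega>. s * \<phi> \<omega> + t * \<psi> \<omega> \<noteq> 0} \<subseteq> ?S" by (intro closure_minimal) auto
  have "compact (closure {\<omega>. s * \<phi> \<omega> + t * \<psi> \<omega> \<noteq> 0})"
    by (rule compact_subset[OF S(1) closed_closure sub])
  then show ?thesis using sub S assms by (auto simp: test_fun_def smooth_lin)
qed

lemma zero_test_fun: "(\<lambda>\<omega>. 0) \<in> test_fun \<Omega>"
proof -
  have eq: "foldr partial_deriv js (\<lambda>\<omega>. 0) = (\<lambda>\<omega>. 0)" for js :: "'a list"
    by (induction js) (auto simp: fun_eq_iff intro!: partial_deriv_eqI)
  show ?thesis by (simp add: test_fun_def smooth_def eq)
qed

lemma partial_deriv_eq_0_outside:
  assumes K: "closed K" "\<And>\<omega>. \<omega> \<notin> K \<Longrightarrow> f \<omega> = 0" and \<omega>: "\<omega> \<notin> K"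
  shows "partial_deriv i f \<omega> = 0"
proof -
  have "(f has_derivative (\<lambda>v. 0)) (at \<omega>)"
    by (rule has_derivative_transform_within_open[of "\<lambda>_. 0" _ _ _ "- K"])
      (use K \<omega> in \<open>auto simp: open_Compl\<close>)
  then show ?thesis by (rule partial_deriv_eqI)
qed

lemma test_fun_support:
  assumes "\<phi> \<in> test_fun \<Omega>"
  obtains K where "compact K" "K \<subseteq> \<Omega>" "\<And>\<omega>. \<omega> \<notin> K \<Longrightarrow> \<phi> \<omega> = 0"
    "\<And>\<omega> i. \<omega> \<notin> K \<Longrightarrow> partial_deriv i \<phi> \<omega> = 0"
proof -
  let ?K = "closure {\<omega>. \<phi> \<omega> \<noteq> 0}"
  have z: "\<phi> \<omega> = 0" if "\<omega> \<notin> ?K" for \<omega>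
    using that closure_subset[of "{\<omega>. \<phi> \<omega> \<noteq> 0}"] by blast
  show thesis
  proof (rule that)
    show "compact ?K" "?K \<subseteq> \<Omega>" using assms unfolding test_fun_def by blast+
    show "\<phi> \<omega> = 0" if "\<omega> \<notin> ?K" for \<omega> using z that .
    show "partial_deriv i \<phi> \<omega> = 0" if "\<omega> \<notin> ?K" for \<omega> i
      using partial_deriv_eq_0_outside[OF closed_closure z that] .
  qed
qed

section \<open>Integration by parts on the whole space\<close>

lemma integrable_continuous_compact_support:
  fixes f :: "real^'n \<Rightarrow> real"
  assumes c: "continuous_on UNIV f" and K: "compact K" "\<And>x. x \<notin> K \<Longrightarrow> f x = 0"
  shows "integrable lborel f"
proof -
  have "integrable lborel (\<lambda>x. indicator K x *\<^sub>R f x)"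
    using c K(1) by (intro borel_integrable_compact) (auto intro: continuous_on_subset)
  moreover have "(\<lambda>x. indicator K x *\<^sub>R f x) = f"
    using K(2) by (auto simp: fun_eq_iff indicator_def)
  ultimately show ?thesis by simp
qed

text \<open>Passage from \<open>\<Omega>\<close> to the whole space. Applied to integrands
  containing a test function, it is why no boundary terms ever appear.\<close>

lemma lebesgue_on_lborel:
  fixes f :: "real^'n \<Rightarrow> real"
  assumes \<Omega>: "\<Omega> \<in> sets lebesgue" and f: "f \<in> borel_measurable borel"
    and z: "\<And>x. x \<notin> \<Omega> \<Longrightarrow> f x = 0"
  shows "integrable (lebesgue_on \<Omega>) f \<longleftrightarrow> integrable lborel f"
    and "(LINT \<omega>|lebesgue_on \<Omega>. f \<omega>) = (LINT \<omega>|lborel. f \<omega>)"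
proof -
  have eq: "(\<lambda>x. indicator \<Omega> x *\<^sub>R f x) = f" using z by (auto simp: fun_eq_iff indicator_def)
  show "integrable (lebesgue_on \<Omega>) f \<longleftrightarrow> integrable lborel f"
    using \<Omega> f eq integrable_completion[of f lborel] by (simp add: integrable_restrict_space)
  show "(LINT \<omega>|lebesgue_on \<Omega>. f \<omega>) = (LINT \<omega>|lborel. f \<omega>)"
    using \<Omega> f eq integral_completion[of f lborel] by (simp add: integral_restrict_space)
qed

lemma lborel_integral_translate:
  fixes f :: "real^'n \<Rightarrow> real"
  assumes "f \<in> borel_measurable borel"
  shows "(LINT x|lborel. f (a + x)) = (LINT x|lborel. f x)"
proof -
  have "(LINT x|lborel. f x) = (LINT x|distr lborel borel ((+) a). f x)"
    by (simp add: lborel_distr_plus)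
  also have "\<dots> = (LINT x|lborel. f (a + x))"
    using assms by (intro integral_distr) auto
  finally show ?thesis by simp
qed

lemma has_real_derivative_line:
  assumes d: "\<And>x. f differentiable (at x)"
  shows "((\<lambda>t. f (t *\<^sub>R axis i 1 + x)) has_real_derivative
    partial_deriv i f (t *\<^sub>R axis i 1 + x)) (at t)"
proof -
  let ?D = "frechet_derivative f (at (t *\<^sub>R axis i 1 + x))"
  have D: "(f has_derivative ?D) (at (t *\<^sub>R axis i 1 + x))"
    using d frechet_derivative_works by blast
  have l: "((\<lambda>t. t *\<^sub>R axis i 1 + x) has_derivative (\<lambda>h. h *\<^sub>R axis i 1)) (at t)"
    by (auto intro!: derivative_eq_intros)
  have "((\<lambda>t. f (t *\<^sub>R axis i 1 + x)) has_derivative (\<lambda>h. ?D (h *\<^sub>R axis i 1))) (at t)"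
    using has_derivative_compose[OF l D] .
  moreover have "?D (h *\<^sub>R axis i 1) = partial_deriv i f (t *\<^sub>R axis i 1 + x) * h" for h
    using linear_scale[OF has_derivative_linear[OF D]] by (simp add: partial_deriv_def)
  ultimately show ?thesis by (simp add: has_field_derivative_def)
qed

text \<open>The difference quotients in direction \<open>i\<close> integrate to 0 by translation invariance.\<close>

lemma integral_partial_deriv_eq_0:
  fixes f :: "real^'n \<Rightarrow> real"
  assumes d: "\<And>x. f differentiable (at x)" and c: "continuous_on UNIV (partial_deriv i f)"
    and K: "compact K" "\<And>x. x \<notin> K \<Longrightarrow> f x = 0"
  shows "(LINT x|lborel. partial_deriv i f x) = 0"
proof -
  let ?e = "axis i 1 :: real^'n"
  have cf: "continuous_on UNIV f"
    using d by (simp add: continuous_at_imp_continuous_on differentiable_imp_continuous_within)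
  have int: "integrable lborel f" by (rule integrable_continuous_compact_support[OF cf K])
  have fm[measurable]: "f \<in> borel_measurable borel"
    using cf by (rule borel_measurable_continuous_onI)
  have pm[measurable]: "partial_deriv i f \<in> borel_measurable borel"
    using c by (rule borel_measurable_continuous_onI)
  have pK: "partial_deriv i f x = 0" if "x \<notin> K" for x
    using partial_deriv_eq_0_outside[OF compact_imp_closed[OF K(1)] K(2) that] .
  obtain M where M: "\<And>x. \<bar>partial_deriv i f x\<bar> \<le> M"
  proof -
    have "bounded (partial_deriv i f ` K)"
      using K(1) c by (intro compact_imp_bounded compact_continuous_image)
        (auto intro: continuous_on_subset)
    then obtain M where M: "\<And>x. x \<in> K \<Longrightarrow> \<bar>partial_deriv i f x\<bar> \<le> M" "M > 0"
      by (force simp: bounded_pos)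
    then have "\<bar>partial_deriv i f x\<bar> \<le> M" for x by (cases "x \<in> K") (auto simp: pK)
    then show thesis by (rule that)
  qed
  obtain R where R: "\<And>x. x \<in> K \<Longrightarrow> norm x \<le> R"
    using compact_imp_bounded[OF K(1)] unfolding bounded_iff by blast
  define h where "h k = 1 / real (Suc k)" for k
  have h: "0 < h k" "h k \<le> 1" for k by (auto simp: h_def)
  have h0: "h \<longlonglongrightarrow> 0"
    unfolding h_def using LIMSEQ_inverse_real_of_nat by (simp add: inverse_eq_divide)
  define q where "q k x = (f (h k *\<^sub>R ?e + x) - f x) / h k" for k x
  have "(\<lambda>k. LINT x|lborel. q k x) \<longlonglongrightarrow> (LINT x|lborel. partial_deriv i f x)"
  \<comment> \<open>The mean value theorem bounds each quotient by \<open>M\<close>. The shifts have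
    length at most 1, so all quotients vanish outside the ball of radius
    \<open>R + 1\<close>.\<close>
  proof (rule integral_dominated_convergence[where w = "\<lambda>x. indicator (cball 0 (R + 1)) x *\<^sub>R M"])
    show "partial_deriv i f \<in> borel_measurable lborel" by simp
    show "q k \<in> borel_measurable lborel" for k unfolding q_def by measurable
    show "integrable lborel (\<lambda>x::real^'n. indicator (cball 0 (R + 1)) x *\<^sub>R M)"
      by (intro borel_integrable_compact) auto
    show "AE x in lborel. (\<lambda>k. q k x) \<longlonglongrightarrow> partial_deriv i f x"
    proof (rule AE_I2)
      fix x
      have "((\<lambda>t. (f (t *\<^sub>R ?e + x) - f x) / t) \<longlongrightarrow> partial_deriv i f x) (at 0)"
        using has_real_derivative_line[OF d, of i x 0] by (simp add: DERIV_def)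
      moreover have "filterlim h (at 0) sequentially"
        using h0 h(1) by (auto simp: filterlim_at less_imp_neq[symmetric])
      ultimately show "(\<lambda>k. q k x) \<longlonglongrightarrow> partial_deriv i f x"
        unfolding q_def by (rule filterlim_compose)
    qed
    show "AE x in lborel. norm (q k x) \<le> indicator (cball 0 (R + 1)) x *\<^sub>R M" for k
    proof (rule AE_I2)
      fix x
      show "norm (q k x) \<le> indicator (cball 0 (R + 1)) x *\<^sub>R M"
      proof (cases "norm x \<le> R + 1")
        case True
        obtain t where "f (h k *\<^sub>R ?e + x) - f (0 *\<^sub>R ?e + x) =
            (h k - 0) * partial_deriv i f (t *\<^sub>R ?e + x)"
          using MVT2[OF h(1)[of k] has_real_derivative_line[OF d]] by blast
        then have "q k x = partial_deriv i f (t *\<^sub>R ?e + x)"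
          using h[of k] by (simp add: q_def)
        then show ?thesis using True M by simp
      next
        case False
        then have "x \<notin> K" using R by force
        moreover have "norm x \<le> norm (h k *\<^sub>R ?e + x) + norm (h k *\<^sub>R ?e)"
          using norm_triangle_ineq4[of "h k *\<^sub>R ?e + x" "h k *\<^sub>R ?e"] by simp
        then have "h k *\<^sub>R ?e + x \<notin> K" using R[of "h k *\<^sub>R ?e + x"] False h[of k] by auto
        ultimately show ?thesis using False by (simp add: q_def K(2))
      qed
    qed
  qed
  moreover have "(LINT x|lborel. q k x) = 0" for k
  proof -
    have "integrable lborel (\<lambda>x. f (h k *\<^sub>R ?e + x))"
    proof (rule integrable_continuous_compact_support)
      show "continuous_on UNIV (\<lambda>x. f (h k *\<^sub>R ?e + x))"
        by (rule continuous_on_compose2[OF cf]) (auto intro!: continuous_intros)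
      show "compact ((\<lambda>x. x - h k *\<^sub>R ?e) ` K)"
        by (rule compact_continuous_image[OF _ K(1)]) (auto intro!: continuous_intros)
      show "f (h k *\<^sub>R ?e + x) = 0" if "x \<notin> (\<lambda>x. x - h k *\<^sub>R ?e) ` K" for x
      proof (rule K(2), rule notI)
        assume "h k *\<^sub>R ?e + x \<in> K"
        then have "(h k *\<^sub>R ?e + x) - h k *\<^sub>R ?e \<in> (\<lambda>x. x - h k *\<^sub>R ?e) ` K" by (rule imageI)
        then show False using that by simp
      qed
    qed
    then have "(LINT x|lborel. f (h k *\<^sub>R ?e + x) - f x) = 0"
      using int lborel_integral_translate[OF fm, of "h k *\<^sub>R ?e"] by simp
    then show ?thesis by (simp add: q_def)
  qed
  ultimately show ?thesis using LIMSEQ_unique[OF tendsto_const] by fastforce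
qed

text \<open>The derivative of \<open>f * g\<close> integrates to 0, and the product inherits compact
  support from \<open>g\<close> alone. Thus \<open>f\<close> may be a coordinate function, as the
  Poincare inequality requires.\<close>

lemma integration_by_parts:
  fixes f g :: "real^'n \<Rightarrow> real"
  assumes f: "\<And>x. f differentiable (at x)" "continuous_on UNIV (partial_deriv i f)"
    and g: "\<And>x. g differentiable (at x)" "continuous_on UNIV (partial_deriv i g)"
    and K: "compact K" "\<And>x. x \<notin> K \<Longrightarrow> g x = 0"
  shows "(LINT x|lborel. f x * partial_deriv i g x) = - (LINT x|lborel. partial_deriv i f x * g x)"
proof -
  have cf: "continuous_on UNIV f" and cg: "continuous_on UNIV g"
    using f(1) g(1) by (auto simp: continuous_at_imp_continuous_on differentiable_imp_continuous_within)
  have pd: "partial_deriv i (\<lambda>x. f x * g x) = (\<lambda>x. f x * partial_deriv i g x + partial_deriv i f x * g x)"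
    using partial_deriv_mult[OF f(1) g(1)] by blast
  have 0: "(LINT x|lborel. partial_deriv i (\<lambda>x. f x * g x) x) = 0"
  proof (rule integral_partial_deriv_eq_0[OF _ _ K(1)])
    show "(\<lambda>x. f x * g x) differentiable at x" for x using f(1) g(1) by (rule differentiable_mult)
    show "continuous_on UNIV (partial_deriv i (\<lambda>x. f x * g x))"
      unfolding pd using f(2) g(2) cf cg by (intro continuous_intros)
  qed (simp add: K(2))
  have "integrable lborel (\<lambda>x. f x * partial_deriv i g x)"
    by (rule integrable_continuous_compact_support[OF _ K(1)])
      (use g(2) cf partial_deriv_eq_0_outside[OF compact_imp_closed[OF K(1)] K(2)] in
        \<open>auto intro!: continuous_intros\<close>)
  moreover have "integrable lborel (\<lambda>x. partial_deriv i f x * g x)"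
    by (rule integrable_continuous_compact_support[OF _ K(1)])
      (use f(2) cg K(2) in \<open>auto intro!: continuous_intros\<close>)
  ultimately show ?thesis using 0 unfolding pd by simp
qed

section \<open>Bump functions and the fundamental lemma of the calculus of variations\<close>

text \<open>\<open>flat 1\<close> is the classical smooth function \<open>exp (- 1 / x)\<close>
  extended by 0. Polynomial factors in \<open>1 / x\<close> are included so that the family is
  closed under differentiation.\<close>

definition flat :: "real poly \<Rightarrow> real \<Rightarrow> real" where
  "flat p x = (if x \<le> 0 then 0 else poly p (1 / x) * exp (- 1 / x))"

lemma poly_times_exp_tendsto_0:
  fixes p :: "real poly"
  shows "((\<lambda>y. poly p y * exp (- y)) \<longlongrightarrow> 0) at_top"
proof -
  have "((\<lambda>y. \<Sum>i\<le>degree p. coeff p i * (y ^ i / exp y)) \<longlongrightarrow> (\<Sum>i\<le>degree p. coeff p i * 0)) at_top"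
    by (intro tendsto_intros tendsto_power_div_exp_0)
  moreover have "(\<Sum>i\<le>degree p. coeff p i * (y ^ i / exp y)) = poly p y * exp (- y)" for y
    by (simp add: poly_altdef sum_distrib_right exp_minus divide_inverse mult.assoc)
  ultimately show ?thesis by simp
qed

text \<open>With \<open>y = 1 / x\<close>, the chain rule turns \<open>p(y) exp(-y)\<close> into
  \<open>y\<^sup>2 (p(y) - p'(y)) exp(-y)\<close>, and \<open>[:0, 0, 1:]\<close> is the polynomial
  for the square of \<open>y\<close>. At 0 the exponential beats every polynomial.\<close>

lemma flat_has_derivative:
  "(flat p has_real_derivative flat ([:0, 0, 1:] * (p - pderiv p)) x) (at x)"
proof -
  consider "x < 0" | "x > 0" | "x = 0" by linarith
  then show ?thesis
  proof cases
    case 1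
    have "((\<lambda>x. 0) has_real_derivative 0) (at x)" by simp
    then have "(flat p has_real_derivative 0) (at x)"
      by (rule has_field_derivative_transform_within_open[where S = "{..<0}"])
        (use 1 in \<open>auto simp: flat_def\<close>)
    then show ?thesis using 1 by (simp add: flat_def)
  next
    case 2
    have "((\<lambda>x. poly p (1 / x) * exp (- 1 / x)) has_real_derivative
        flat ([:0, 0, 1:] * (p - pderiv p)) x) (at x)"
      by (rule derivative_eq_intros DERIV_chain2[OF poly_DERIV] refl | use 2 in force)+
        (use 2 in \<open>simp add: flat_def power2_eq_square field_simps\<close>)
    then show ?thesis
      by (rule has_field_derivative_transform_within_open[where S = "{0<..}"])
        (use 2 in \<open>auto simp: flat_def\<close>)
  next
    case 3
    \<comment> \<open>Substituting \<open>y = 1 / h\<close> in the difference quotient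
      \<open>flat p h / h\<close>: the division by \<open>h\<close> becomes the extra factor
      \<open>[:0, 1:]\<close>.\<close>
    have "((\<lambda>y. poly ([:0, 1:] * p) y * exp (- y)) \<longlongrightarrow> 0) at_top"
      by (rule poly_times_exp_tendsto_0)
    then have "((\<lambda>h. poly ([:0, 1:] * p) (inverse h) * exp (- inverse h)) \<longlongrightarrow> 0) (at_right 0)"
      by (rule filterlim_compose[OF _ filterlim_inverse_at_top_right])
    moreover have "\<forall>\<^sub>F h in at_right 0. poly ([:0, 1:] * p) (inverse h) * exp (- inverse h) = flat p h / h"
      by (rule eventually_mono[OF eventually_at_right_less])
        (auto simp: flat_def field_simps)
    ultimately have r: "((\<lambda>h. flat p h / h) \<longlongrightarrow> 0) (at_right 0)"
      by (rule Lim_transform_eventually)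
    have l: "((\<lambda>h. flat p h / h) \<longlongrightarrow> 0) (at_left 0)"
    proof (rule Lim_transform_eventually[OF tendsto_const[of 0]])
      show "\<forall>\<^sub>F h in at_left 0. 0 = flat p h / h"
        by (rule eventually_mono[OF eventually_at_left_real[of "-1"]]) (auto simp: flat_def)
    qed
    have "((\<lambda>h. flat p h / h) \<longlongrightarrow> 0) (at 0)" using l r by (simp add: filterlim_split_at)
    then show ?thesis using 3 by (simp add: DERIV_def flat_def)
  qed
qed

text \<open>A class of functions that contains the bump functions below and is closed under partial
  derivatives, so that its members are smooth.\<close>

inductive flat_algebra :: "(real^'n \<Rightarrow> real) \<Rightarrow> bool" where
  const: "flat_algebra (\<lambda>x. c)"
| coord: "flat_algebra (\<lambda>x. flat p (\<alpha> * x $ i + \<beta>))"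
| add: "flat_algebra f \<Longrightarrow> flat_algebra g \<Longrightarrow> flat_algebra (\<lambda>x. f x + g x)"
| mult: "flat_algebra f \<Longrightarrow> flat_algebra g \<Longrightarrow> flat_algebra (\<lambda>x. f x * g x)"

lemma flat_algebra_deriv:
  assumes "flat_algebra f"
  shows "(\<forall>x. f differentiable (at x)) \<and> (\<forall>j. flat_algebra (partial_deriv j f))"
  using assms
proof induction
  case (const c)
  have "partial_deriv j (\<lambda>x. c) = (\<lambda>x. 0)" for j :: 'a
    by (auto simp: fun_eq_iff intro!: partial_deriv_eqI)
  then show ?case by (simp add: flat_algebra.const)
next
  case (coord p \<alpha> i \<beta>)
  let ?q = "[:0, 0, 1:] * (p - pderiv p)"
  have D: "((\<lambda>x. flat p (\<alpha> * x $ i + \<beta>)) has_derivative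
      (\<lambda>v. flat ?q (\<alpha> * x $ i + \<beta>) * (\<alpha> * v $ i))) (at x)" for x :: "real^'a"
  proof -
    have "((\<lambda>x. \<alpha> * x $ i + \<beta>) has_derivative (\<lambda>v. \<alpha> * v $ i)) (at x)"
      by (rule derivative_eq_intros bounded_linear_imp_has_derivative[OF bounded_linear_vec_nth] refl | simp)+
    from has_derivative_compose[OF this flat_has_derivative[of p "\<alpha> * x $ i + \<beta>", unfolded has_field_derivative_def]]
    show ?thesis by simp
  qed
  have "partial_deriv j (\<lambda>x. flat p (\<alpha> * x $ i + \<beta>)) =
      (\<lambda>x. flat ?q (\<alpha> * x $ i + \<beta>) * (\<alpha> * (axis j 1 :: real^'a) $ i))" for j
    using partial_deriv_eqI[OF D] by (simp add: fun_eq_iff)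
  then have "flat_algebra (partial_deriv j (\<lambda>x. flat p (\<alpha> * x $ i + \<beta>)))" for j
    using flat_algebra.mult[OF flat_algebra.coord flat_algebra.const] by metis
  then show ?case using D by (auto simp: differentiable_def)
next
  case (add f g)
  then have "partial_deriv j (\<lambda>x. f x + g x) = (\<lambda>x. partial_deriv j f x + partial_deriv j g x)" for j
    using partial_deriv_lin[of f g j 1 1] by simp
  then show ?case using add by (auto intro: flat_algebra.add differentiable_add)
next
  case (mult f g)
  then have "partial_deriv j (\<lambda>x. f x * g x) =
      (\<lambda>x. f x * partial_deriv j g x + partial_deriv j f x * g x)" for j
    using partial_deriv_mult[of f _ g j] by blast
  then show ?case using mult
    by (auto intro!: flat_algebra.add flat_algebra.mult differentiable_mult)
qed

lemma flat_algebra_smooth: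
  assumes f: "flat_algebra f"
  shows "smooth f"
proof -
  have "flat_algebra (foldr partial_deriv js f)" for js
    by (induction js) (use f flat_algebra_deriv in auto)
  then show ?thesis unfolding smooth_def using flat_algebra_deriv by blast
qed

lemma flat_algebra_prod:
  assumes "finite I" "\<And>i. i \<in> I \<Longrightarrow> flat_algebra (f i)"
  shows "flat_algebra (\<lambda>x. \<Prod>i\<in>I. f i x)"
  using assms
  by (induction I rule: finite_induct) (auto intro: flat_algebra.const flat_algebra.mult)

text \<open>A smooth substitute for the indicator of \<open>box a b\<close>: for positive
  \<open>k\<close> a factor is \<open>exp (- 1 / (k * t))\<close> at distance \<open>t > 0\<close>
  inside a face and 0 beyond it, so letting \<open>k\<close> grow gives the indicator.\<close>

definition bump :: "real \<Rightarrow> real^'n \<Rightarrow> real^'n \<Rightarrow> real^'n \<Rightarrow> real" where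
  "bump k a b x = (\<Prod>i\<in>UNIV. flat 1 (k * (x $ i - a $ i)) * flat 1 (k * (b $ i - x $ i)))"

lemma smooth_bump: "smooth (bump k a b)"
proof -
  have 1: "flat_algebra (\<lambda>x. flat 1 (k * (x $ i - a $ i)))" for i
    using flat_algebra.coord[of 1 k i "- k * a $ i"] by (simp add: algebra_simps)
  have 2: "flat_algebra (\<lambda>x. flat 1 (k * (b $ i - x $ i)))" for i
    using flat_algebra.coord[of 1 "-k" i "k * b $ i"] by (simp add: algebra_simps)
  show ?thesis
    unfolding bump_def
    by (intro flat_algebra_smooth flat_algebra_prod flat_algebra.mult 1 2) auto
qed

lemma bump_eq_0: "k > 0 \<Longrightarrow> x \<notin> box a b \<Longrightarrow> bump k a b x = 0"
  by (auto simp: bump_def mem_box_cart flat_def not_less mult_le_0_iff zero_le_mult_iff)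

lemma flat_1_bounds: "0 \<le> flat 1 x \<and> flat 1 x \<le> 1"
  by (simp add: flat_def)

lemma bump_bounds: "0 \<le> bump k a b x \<and> bump k a b x \<le> 1"
  unfolding bump_def
  by (intro conjI prod_nonneg prod_le_1) (auto simp: flat_1_bounds intro: mult_le_one)

lemma bump_tendsto: "(\<lambda>k. bump (real (Suc k)) a b x) \<longlonglongrightarrow> indicator (box a b) x"
proof (cases "x \<in> box a b")
  case True
  have one: "(\<lambda>k. flat 1 (real (Suc k) * t)) \<longlonglongrightarrow> 1" if t: "t > 0" for t
  proof -
    have "(\<lambda>k. exp (- (inverse (real (Suc k)) / t))) \<longlonglongrightarrow> exp (- (0 / t))"
      using t by (intro tendsto_intros LIMSEQ_inverse_real_of_nat) auto
    moreover have "flat 1 (real (Suc k) * t) = exp (- (inverse (real (Suc k)) / t))" for k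
    proof -
      have "real (Suc k) * t > 0" using t by simp
      then show ?thesis using t by (simp add: flat_def divide_inverse mult.commute not_le del: of_nat_Suc)
    qed
    ultimately show ?thesis by simp
  qed
  have "(\<lambda>k. bump (real (Suc k)) a b x) \<longlonglongrightarrow> (\<Prod>i\<in>(UNIV::'a set). 1 * 1)"
    unfolding bump_def by (intro tendsto_prod tendsto_mult one) (use True in \<open>auto simp: mem_box_cart\<close>)
  then show ?thesis using True by simp
next
  case False
  then show ?thesis using bump_eq_0[OF _ False] by simp
qed

lemma bump_test_fun:
  assumes k: "k > 0" and sub: "cbox a b \<subseteq> \<Omega>"
  shows "bump k a b \<in> test_fun \<Omega>"
proof -
  have "{\<omega>. bump k a b \<omega> \<noteq> 0} \<subseteq> cbox a b"
    using bump_eq_0[OF k] box_subset_cbox by blast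
  then have cl: "closure {\<omega>. bump k a b \<omega> \<noteq> 0} \<subseteq> cbox a b"
    by (intro closure_minimal) auto
  have "compact (closure {\<omega>. bump k a b \<omega> \<noteq> 0})"
    by (rule compact_subset[OF compact_cbox closed_closure cl])
  then show ?thesis
    unfolding test_fun_def using smooth_bump cl sub by blast
qed

lemma test_fun_L2:
  assumes \<Omega>: "open \<Omega>" and \<phi>: "\<phi> \<in> test_fun \<Omega>"
  shows "\<phi> \<in> L2 \<Omega>" and "partial_deriv i \<phi> \<in> L2 \<Omega>"
proof -
  obtain K where K: "compact K" "K \<subseteq> \<Omega>" "\<And>\<omega>. \<omega> \<notin> K \<Longrightarrow> \<phi> \<omega> = 0"
    "\<And>\<omega> i. \<omega> \<notin> K \<Longrightarrow> partial_deriv i \<phi> \<omega> = 0"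
    using test_fun_support[OF \<phi>] by blast
  have "f \<in> L2 \<Omega>" if c: "continuous_on UNIV f" and z: "\<And>\<omega>. \<omega> \<notin> K \<Longrightarrow> f \<omega> = 0" for f
  proof -
    have c2: "continuous_on UNIV (\<lambda>x. (f x)\<^sup>2)" using c by (intro continuous_intros)
    have "integrable lborel (\<lambda>x. (f x)\<^sup>2)"
      by (rule integrable_continuous_compact_support[OF c2 K(1)]) (simp add: z)
    then have "integrable (lebesgue_on \<Omega>) (\<lambda>x. (f x)\<^sup>2)"
      using \<Omega> K(2) z borel_measurable_continuous_onI[OF c2]
      by (subst lebesgue_on_lborel) auto
    moreover have "f \<in> borel_measurable (lebesgue_on \<Omega>)"
      using \<Omega> c by (intro continuous_imp_measurable_on_sets_lebesgue)
        (auto intro: continuous_on_subset)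
    ultimately show ?thesis by (simp add: L2_def)
  qed
  then show "\<phi> \<in> L2 \<Omega>" "partial_deriv i \<phi> \<in> L2 \<Omega>"
    using K smooth_continuous test_fun_smooth[OF \<phi>] smooth_partial_deriv by blast+
qed

text \<open>Dominated convergence along bumps of increasing steepness, each of which is a test
  function because the closed box lies in \<open>\<Omega>\<close>. The indicator of that closed box
  is in \<open>L2\<close>, so its product with \<open>g\<close> is an integrable majorant.\<close>

lemma integral_box_eq_0:
  assumes \<Omega>: "open \<Omega>" and g: "g \<in> L2 \<Omega>"
    and orth: "\<forall>\<phi>\<in>test_fun \<Omega>. L2_ip \<Omega> g \<phi> = 0"
    and sub: "cbox a b \<subseteq> \<Omega>"
  shows "(\<lambda>x. indicator (box a b) x * g x) \<in> borel_measurable lebesgue"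
    and "integrable lebesgue (\<lambda>x. indicator (box a b) x * g x)"
    and "(LINT x|lebesgue. indicator (box a b) x * g x) = 0"
proof -
  let ?M = "lebesgue_on \<Omega>"
  have \<Omega>s: "\<Omega> \<inter> space lebesgue \<in> sets lebesgue" using \<Omega> by simp
  have ind: "(indicator (cbox a b) :: _ \<Rightarrow> real) \<in> L2 \<Omega>"
  proof -
    have "integrable lebesgue (indicator (cbox a b) :: _ \<Rightarrow> real)"
      by (intro integrable_real_indicator) (auto simp: emeasure_lborel_cbox_eq)
    then have "integrable ?M (indicator (cbox a b) :: _ \<Rightarrow> real)"
      using integrable_mult_indicator[of \<Omega> lebesgue "indicator (cbox a b) :: _ \<Rightarrow> real"] \<Omega>
      by (simp add: integrable_restrict_space)
    then show ?thesis
      by (simp add: L2_def power2_eq_square flip: indicator_inter_arith)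
  qed
  have gm: "g \<in> borel_measurable ?M" using g by (rule L2_measurable)
  have boxm: "(indicator (box a b) :: _ \<Rightarrow> real) \<in> borel_measurable ?M"
    by (intro measurable_restrict_space1 borel_measurable_indicator) auto
  have dom: "integrable ?M (\<lambda>x. \<bar>g x * indicator (cbox a b) x\<bar>)"
    using L2_mult_integrable[OF g ind] by (rule integrable_abs)
  have "(\<lambda>k. LINT x|?M. g x * bump (real (Suc k)) a b x) \<longlonglongrightarrow> (LINT x|?M. g x * indicator (box a b) x)"
  proof (rule integral_dominated_convergence[OF _ _ dom])
    show "(\<lambda>x. g x * indicator (box a b) x) \<in> borel_measurable ?M"
      using gm boxm by measurable
    show "(\<lambda>x. g x * bump (real (Suc k)) a b x) \<in> borel_measurable ?M" for k
      using gm L2_measurable[OF test_fun_L2(1)[OF \<Omega> bump_test_fun[OF _ sub]]]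
      by (intro borel_measurable_times) auto
    show "AE x in ?M. (\<lambda>k. g x * bump (real (Suc k)) a b x) \<longlonglongrightarrow> g x * indicator (box a b) x"
      by (intro AE_I2 tendsto_mult tendsto_const bump_tendsto)
    show "AE x in ?M. norm (g x * bump (real (Suc k)) a b x) \<le> \<bar>g x * indicator (cbox a b) x\<bar>" for k
    proof (rule AE_I2)
      fix x
      have "\<bar>bump (real (Suc k)) a b x\<bar> \<le> indicator (cbox a b) x"
      proof (cases "x \<in> box a b")
        case True
        then have "x \<in> cbox a b" using box_subset_cbox by blast
        then show ?thesis using bump_bounds[of "real (Suc k)" a b x] by simp
      qed (simp add: bump_eq_0)
      then show "norm (g x * bump (real (Suc k)) a b x) \<le> \<bar>g x * indicator (cbox a b) x\<bar>"
        by (simp add: abs_mult mult_left_mono)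
    qed
  qed
  moreover have "(LINT x|?M. g x * bump (real (Suc k)) a b x) = 0" for k
    using orth bump_test_fun[OF _ sub, of "real (Suc k)"] by (simp add: L2_ip_def)
  ultimately have z: "(LINT x|?M. g x * indicator (box a b) x) = 0"
    using LIMSEQ_unique[OF tendsto_const] by fastforce
  have int: "integrable ?M (\<lambda>x. g x * indicator (box a b) x)"
    by (rule Bochner_Integration.integrable_bound[OF dom])
      (use borel_measurable_times[OF gm boxm] box_subset_cbox[of a b] in
        \<open>auto simp: abs_mult split: split_indicator\<close>)
  have eq: "(\<lambda>x. indicator \<Omega> x *\<^sub>R (g x * indicator (box a b) x)) = (\<lambda>x. indicator (box a b) x * g x)"
    using sub box_subset_cbox[of a b] by (auto simp: fun_eq_iff indicator_def)
  show i: "integrable lebesgue (\<lambda>x. indicator (box a b) x * g x)"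
    using int eq by (simp add: integrable_restrict_space[OF \<Omega>s])
  then show "(\<lambda>x. indicator (box a b) x * g x) \<in> borel_measurable lebesgue"
    by (rule borel_measurable_integrable)
  show "(LINT x|lebesgue. indicator (box a b) x * g x) = 0"
    using z eq by (simp add: integral_restrict_space[OF \<Omega>s])
qed

lemma box_Int_box_cart:
  fixes a b c d :: "real^'n"
  shows "box a b \<inter> box c d = box (\<chi> i. max (a $ i) (c $ i)) (\<chi> i. min (b $ i) (d $ i))"
  by (auto simp: mem_box_cart set_eq_iff)

text \<open>Open boxes form an intersection-stable generator of the Borel sets, so vanishing
  integrals spread from boxes to all Borel sets; \<open>int0\<close> starts the complement step, the
  whole space being no box. A function with vanishing integral over every Borel set is 0 almost
  everywhere.\<close>

lemma AE_eq_0_if_box_integrals_eq_0: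
  fixes f :: "real^'n \<Rightarrow> real"
  assumes f: "integrable lborel f"
    and int0: "(LINT x|lborel. f x) = 0"
    and box0: "\<And>c d. (LINT x:box c d|lborel. f x) = 0"
  shows "AE x in lborel. f x = 0"
proof (rule density_unique_real[OF f integrable_zero])
  fix A :: "(real^'n) set" assume "A \<in> sets lborel"
  then have A: "A \<in> sigma_sets UNIV (range (\<lambda>(a, b). box a b))"
    unfolding sets_lborel borel_eq_box by simp
  have si: "set_integrable lborel B f" if "B \<in> sets lborel" for B
    unfolding set_integrable_def by (rule integrable_mult_indicator[OF that f])
  have stable: "Int_stable (range (\<lambda>(a, b). box a b :: (real^'n) set))"
    unfolding Int_stable_def by (auto simp: box_Int_box_cart)
  have gen: "range (\<lambda>(a, b). box a b :: (real^'n) set) \<subseteq> Pow UNIV" by simp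
  have sets: "B \<in> sets lborel"
    if "B \<in> sigma_sets UNIV (range (\<lambda>(a, b). box a b))" for B :: "(real^'n) set"
    using that unfolding sets_lborel borel_eq_box by simp
  have "(LINT x:A|lborel. f x) = 0"
    using stable gen A
  proof (induction rule: sigma_sets_induct_disjoint)
    case (compl B)
    have "(LINT x:UNIV - B|lborel. f x) + (LINT x:B|lborel. f x) = (LINT x:(UNIV - B) \<union> B|lborel. f x)"
      using sets[OF compl(1)] by (intro set_integral_Un[symmetric] si) auto
    also have "\<dots> = 0" using int0 by (simp add: set_lebesgue_integral_def)
    finally show ?case using compl(2) by simp
  next
    case (union B)
    have Bs: "B i \<in> sets lborel" for i using union(2) by (intro sets) auto
    have "(LINT x:(\<Union>i. B i)|lborel. f x) = (\<Sum>i. (LINT x:B i|lborel. f x))"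
      using union(1) Bs
      by (intro lebesgue_integral_countable_add si) (auto simp: disjoint_family_on_def)
    then show ?case using union(3) by simp
  qed (auto simp: box0 set_lebesgue_integral_def[of _ "{}"])
  then show "(LINT x:A|lborel. f x) = (LINT x:A|lborel. 0)" by simp
qed

text \<open>Localization to a box makes \<open>g\<close> integrable on the whole space, and the
  intersection of that box with any other is again a box inside \<open>\<Omega>\<close>. Countably
  many closed boxes cover \<open>\<Omega>\<close>, so the null sets add up to a null set.\<close>

lemma fundamental_lemma:
  fixes g :: "real^'n \<Rightarrow> real"
  assumes \<Omega>: "open \<Omega>" and g: "g \<in> L2 \<Omega>"
    and orth: "\<forall>\<phi>\<in>test_fun \<Omega>. L2_ip \<Omega> g \<phi> = 0"
  shows "ae_eq \<Omega> g (\<lambda>\<omega>. 0)"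
proof -
  have on_box: "AE x in lebesgue. x \<in> cbox a b \<longrightarrow> g x = 0" if sub: "cbox a b \<subseteq> \<Omega>" for a b
  proof -
    let ?f = "\<lambda>x. indicator (box a b) x * g x"
    note box = integral_box_eq_0[OF \<Omega> g orth]
    \<comment> \<open>A Borel representative: \<open>g\<close> is only Lebesgue measurable, while
      the generator argument runs over Borel sets.\<close>
    obtain f where fm: "f \<in> borel_measurable lborel" and ff: "AE x in lborel. ?f x = f x"
      using completion_ex_borel_measurable_real[OF box(1)[OF sub]] by blast
    have ff': "AE x in lebesgue. ?f x = f x" using ff by (rule AE_completion)
    have fl: "f \<in> borel_measurable lebesgue" using fm by (rule measurable_completion)
    have eq: "(LINT x:box c d|lborel. f x) = (LINT x|lebesgue. indicator (box c d \<inter> box a b) x * g x)"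
      for c d
    proof -
      have "(LINT x:box c d|lborel. f x) = (LINT x|lebesgue. indicator (box c d) x *\<^sub>R f x)"
        unfolding set_lebesgue_integral_def
        by (rule integral_completion[symmetric]) (use fm in measurable)
      also have "\<dots> = (LINT x|lebesgue. indicator (box c d) x *\<^sub>R ?f x)"
        using ff' fl box(1)[OF sub]
        by (intro integral_cong_AE borel_measurable_scaleR borel_measurable_indicator) auto
      finally show ?thesis by (simp add: indicator_inter_arith mult.assoc)
    qed
    have "AE x in lborel. f x = 0"
    proof (rule AE_eq_0_if_box_integrals_eq_0)
      have "integrable lebesgue f"
        using box(2)[OF sub] ff' fl box(1)[OF sub] integrable_cong_AE[of ?f lebesgue f] by blast
      then show "integrable lborel f" using fm integrable_completion by blast
      have "(LINT x|lborel. f x) = (LINT x|lebesgue. f x)"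
        by (rule integral_completion[symmetric]) (rule fm)
      also have "\<dots> = (LINT x|lebesgue. ?f x)"
        using ff' fl box(1)[OF sub] by (intro integral_cong_AE) auto
      finally show "(LINT x|lborel. f x) = 0" using box(3)[OF sub] by simp
      show "(LINT x:box c d|lborel. f x) = 0" for c d
      proof -
        have "cbox (\<chi> i. max (c $ i) (a $ i)) (\<chi> i. min (d $ i) (b $ i)) \<subseteq> cbox a b"
          by (auto simp: mem_box_cart)
        then show ?thesis
          unfolding eq box_Int_box_cart using sub by (intro box(3)) auto
      qed
    qed
    then have "AE x in lebesgue. f x = 0" by (rule AE_completion)
    \<comment> \<open>The integrals see only the open box, the covering uses closed ones; the faces
      between them are null.\<close>
    moreover have "AE x in lebesgue. x \<notin> cbox a b - box a b"
      using negligible_frontier_interval[of a b] unfolding negligible_iff_null_sets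
      by (rule AE_not_in)
    ultimately show ?thesis using ff' by eventually_elim (auto simp: indicator_def split: if_splits)
  qed
  obtain D where D: "countable D" "D \<subseteq> Pow \<Omega>" "\<And>X. X \<in> D \<Longrightarrow> \<exists>a b. X = cbox a b" "\<Union>D = \<Omega>"
    by (rule open_countable_Union_open_cbox[OF \<Omega>]) (rule that)
  have "AE x in lebesgue. \<forall>X\<in>D. x \<in> X \<longrightarrow> g x = 0"
  proof (rule AE_ball_countable'[OF _ D(1)])
    fix X assume X: "X \<in> D"
    then obtain a b where "X = cbox a b" using D(3) by blast
    then show "AE x in lebesgue. x \<in> X \<longrightarrow> g x = 0" using on_box[of a b] D(2) X by auto
  qed
  then have "AE x in lebesgue. x \<in> \<Omega> \<longrightarrow> g x = 0"
    by eventually_elim (use D(4) in blast)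
  then show ?thesis
    unfolding ae_eq_def using \<Omega> by (simp add: AE_restrict_space_iff)
qed

section \<open>Weak derivatives and Sobolev spaces\<close>

definition grad :: "(real^'n \<Rightarrow> real) \<Rightarrow> real^'n \<Rightarrow> real^'n" where
  "grad f \<omega> = (\<chi> i. partial_deriv i f \<omega>)"

text \<open>Defined componentwise, so that facts about \<open>L2_ip\<close> carry over by summation.
  The pointwise form in \<open>vec_ip_eq_integral\<close> is used where the matrix or the field
  acts.\<close>

definition vec_ip :: "(real^'n) set \<Rightarrow> (real^'n \<Rightarrow> real^'n) \<Rightarrow> (real^'n \<Rightarrow> real^'n) \<Rightarrow> real" where
  "vec_ip \<Omega> F G = (\<Sum>i\<in>UNIV. L2_ip \<Omega> (\<lambda>\<omega>. F \<omega> $ i) (\<lambda>\<omega>. G \<omega> $ i))"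

lemma grad_nth [simp]: "grad f \<omega> $ i = partial_deriv i f \<omega>"
  by (simp add: grad_def)

lemma L2_vec_nth: "F \<in> L2_vec \<Omega> \<Longrightarrow> (\<lambda>\<omega>. F \<omega> $ i) \<in> L2 \<Omega>"
  by (simp add: L2_vec_def)

lemma L2_vecI: "(\<And>i. (\<lambda>\<omega>. F \<omega> $ i) \<in> L2 \<Omega>) \<Longrightarrow> F \<in> L2_vec \<Omega>"
  by (simp add: L2_vec_def)

lemma vec_ip_eq_integral:
  assumes F: "F \<in> L2_vec \<Omega>" and G: "G \<in> L2_vec \<Omega>"
  shows "integrable (lebesgue_on \<Omega>) (\<lambda>\<omega>. F \<omega> \<bullet> G \<omega>)"
    and "vec_ip \<Omega> F G = (LINT \<omega>|lebesgue_on \<Omega>. F \<omega> \<bullet> G \<omega>)"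
  using L2_mult_integrable[OF L2_vec_nth[OF F] L2_vec_nth[OF G]]
  by (auto simp: vec_ip_def L2_ip_def inner_vec_def)

lemma vec_ip_sym: "F \<in> L2_vec \<Omega> \<Longrightarrow> G \<in> L2_vec \<Omega> \<Longrightarrow> vec_ip \<Omega> F G = vec_ip \<Omega> G F"
  unfolding vec_ip_def by (intro sum.cong refl L2.sym L2_vec_nth)

lemma L2_vec_lin:
  "F \<in> L2_vec \<Omega> \<Longrightarrow> G \<in> L2_vec \<Omega> \<Longrightarrow> (\<lambda>\<omega>. s *\<^sub>R F \<omega> + t *\<^sub>R G \<omega>) \<in> L2_vec \<Omega>"
  by (simp add: L2_vec_def L2_lin)

lemma vec_ip_lin_left:
  "F \<in> L2_vec \<Omega> \<Longrightarrow> G \<in> L2_vec \<Omega> \<Longrightarrow> H \<in> L2_vec \<Omega> \<Longrightarrow>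
    vec_ip \<Omega> (\<lambda>\<omega>. s *\<^sub>R F \<omega> + t *\<^sub>R G \<omega>) H = s * vec_ip \<Omega> F H + t * vec_ip \<Omega> G H"
  by (simp add: vec_ip_def L2.lin_left L2_vec_nth sum.distrib sum_distrib_left)

lemma vec_ip_nonneg: "F \<in> L2_vec \<Omega> \<Longrightarrow> 0 \<le> vec_ip \<Omega> F F"
  unfolding vec_ip_def by (intro sum_nonneg L2.nonneg L2_vec_nth)

lemma vec_ip_ge_component:
  assumes "F \<in> L2_vec \<Omega>"
  shows "L2_ip \<Omega> (\<lambda>\<omega>. F \<omega> $ i) (\<lambda>\<omega>. F \<omega> $ i) \<le> vec_ip \<Omega> F F"
  unfolding vec_ip_def
  using member_le_sum[of i UNIV "\<lambda>i. L2_ip \<Omega> (\<lambda>\<omega>. F \<omega> $ i) (\<lambda>\<omega>. F \<omega> $ i)"]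
    L2.nonneg[OF L2_vec_nth[OF assms]] by simp

lemma vec_ip_cong:
  assumes "F \<in> L2_vec \<Omega>" "F' \<in> L2_vec \<Omega>" "G \<in> L2_vec \<Omega>" "G' \<in> L2_vec \<Omega>"
    and "ae_eq \<Omega> F F'" "ae_eq \<Omega> G G'"
  shows "vec_ip \<Omega> F G = vec_ip \<Omega> F' G'"
  unfolding vec_ip_def using assms
  by (intro sum.cong refl L2_ip_cong L2_vec_nth) (auto simp: ae_eq_def)

lemma has_weak_grad_iff:
  "has_weak_grad \<Omega> u G \<longleftrightarrow> u \<in> L2 \<Omega> \<and> G \<in> L2_vec \<Omega> \<and>
    (\<forall>\<phi>\<in>test_fun \<Omega>. \<forall>i. L2_ip \<Omega> u (partial_deriv i \<phi>) = - L2_ip \<Omega> (\<lambda>\<omega>. G \<omega> $ i) \<phi>)"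
  by (simp add: has_weak_grad_def L2_ip_def)

locale open_domain =
  fixes \<Omega> :: "(real^'n) set"
  assumes open_\<Omega>: "open \<Omega>"
begin

lemma \<Omega>_lebesgue: "\<Omega> \<in> sets lebesgue"
  using open_\<Omega> by simp

lemma test_L2: "\<phi> \<in> test_fun \<Omega> \<Longrightarrow> \<phi> \<in> L2 \<Omega>"
  by (rule test_fun_L2[OF open_\<Omega>])

lemma partial_test_L2: "\<phi> \<in> test_fun \<Omega> \<Longrightarrow> partial_deriv i \<phi> \<in> L2 \<Omega>"
  by (rule test_fun_L2[OF open_\<Omega>])

lemma grad_test_L2: "\<phi> \<in> test_fun \<Omega> \<Longrightarrow> grad \<phi> \<in> L2_vec \<Omega>"
  by (auto intro!: L2_vecI partial_test_L2)

lemma has_weak_div_iff: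
  "has_weak_div \<Omega> F g \<longleftrightarrow> F \<in> L2_vec \<Omega> \<and> g \<in> L2 \<Omega> \<and>
    (\<forall>\<phi>\<in>test_fun \<Omega>. vec_ip \<Omega> F (grad \<phi>) = - L2_ip \<Omega> g \<phi>)"
proof -
  have "(LINT \<omega>|lebesgue_on \<Omega>. (\<Sum>i\<in>UNIV. F \<omega> $ i * partial_deriv i \<phi> \<omega>)) = vec_ip \<Omega> F (grad \<phi>)"
    if "F \<in> L2_vec \<Omega>" "\<phi> \<in> test_fun \<Omega>" for \<phi>
    using vec_ip_eq_integral(2)[OF that(1) grad_test_L2[OF that(2)]] by (simp add: inner_vec_def)
  then show ?thesis unfolding has_weak_div_def L2_ip_def by auto
qed

section \<open>Uniqueness of weak derivatives and consistency with classical ones\<close>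

lemma eq_if_test_eq:
  assumes f: "f \<in> L2 \<Omega>" and g: "g \<in> L2 \<Omega>"
    and eq: "\<And>\<phi>. \<phi> \<in> test_fun \<Omega> \<Longrightarrow> L2_ip \<Omega> f \<phi> = L2_ip \<Omega> g \<phi>"
  shows "ae_eq \<Omega> f g"
  using fundamental_lemma[OF open_\<Omega> L2.diff_mem[OF f g]] eq
  by (simp add: L2.diff_left[OF f g test_L2] flip: ae_eq_iff_diff)

lemma weak_grad_unique:
  assumes G: "has_weak_grad \<Omega> u G" and F: "has_weak_grad \<Omega> u F"
  shows "ae_eq \<Omega> G F"
proof -
  have "ae_eq \<Omega> (\<lambda>\<omega>. G \<omega> $ i) (\<lambda>\<omega>. F \<omega> $ i)" for i
    using G F by (intro eq_if_test_eq L2_vec_nth) (auto simp: has_weak_grad_iff)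
  then have "AE \<omega> in lebesgue_on \<Omega>. \<forall>i\<in>UNIV. G \<omega> $ i = F \<omega> $ i"
    unfolding ae_eq_def by (intro eventually_ball_finite) auto
  then show ?thesis unfolding ae_eq_def vec_eq_iff by simp
qed

lemma weak_div_unique:
  assumes "has_weak_div \<Omega> F g" "has_weak_div \<Omega> F h"
  shows "ae_eq \<Omega> g h"
  using assms by (intro eq_if_test_eq) (auto simp: has_weak_div_iff)

lemma has_weak_grad_lin:
  assumes u: "has_weak_grad \<Omega> u G" and v: "has_weak_grad \<Omega> v F"
  shows "has_weak_grad \<Omega> (\<lambda>\<omega>. s * u \<omega> + t * v \<omega>) (\<lambda>\<omega>. s *\<^sub>R G \<omega> + t *\<^sub>R F \<omega>)"
  using assms
  by (simp add: has_weak_grad_iff L2_lin L2_vec_lin L2.lin_left test_L2 partial_test_L2 L2_vec_nth)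

lemma has_weak_grad_test:
  assumes \<phi>: "\<phi> \<in> test_fun \<Omega>"
  shows "has_weak_grad \<Omega> \<phi> (grad \<phi>)"
proof -
  have "L2_ip \<Omega> \<phi> (partial_deriv i \<psi>) = - L2_ip \<Omega> (partial_deriv i \<phi>) \<psi>"
    if \<psi>: "\<psi> \<in> test_fun \<Omega>" for \<psi> i
  proof -
    note s\<phi> = test_fun_smooth[OF \<phi>] and s\<psi> = test_fun_smooth[OF \<psi>]
    obtain K where K: "compact K" "K \<subseteq> \<Omega>" "\<And>\<omega>. \<omega> \<notin> K \<Longrightarrow> \<psi> \<omega> = 0"
      "\<And>\<omega> i. \<omega> \<notin> K \<Longrightarrow> partial_deriv i \<psi> \<omega> = 0"
      by (rule test_fun_support[OF \<psi>]) (rule that)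
    note cont = smooth_continuous[OF s\<phi>] smooth_continuous[OF s\<psi>]
      smooth_continuous[OF smooth_partial_deriv[OF s\<phi>]] smooth_continuous[OF smooth_partial_deriv[OF s\<psi>]]
    have "L2_ip \<Omega> \<phi> (partial_deriv i \<psi>) = (LINT x|lborel. \<phi> x * partial_deriv i \<psi> x)"
      unfolding L2_ip_def
      by (rule lebesgue_on_lborel(2)[OF \<Omega>_lebesgue])
        (use K(2,4) in \<open>auto intro!: borel_measurable_continuous_onI continuous_intros cont\<close>)
    also have "\<dots> = - (LINT x|lborel. partial_deriv i \<phi> x * \<psi> x)"
      by (rule integration_by_parts[OF _ _ _ _ K(1,3)])
        (auto intro: smooth_differentiable s\<phi> s\<psi> cont)
    also have "(LINT x|lborel. partial_deriv i \<phi> x * \<psi> x) = L2_ip \<Omega> (partial_deriv i \<phi>) \<psi>"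
      unfolding L2_ip_def
      by (rule lebesgue_on_lborel(2)[OF \<Omega>_lebesgue, symmetric])
        (use K(2,3) in \<open>auto intro!: borel_measurable_continuous_onI continuous_intros cont\<close>)
    finally show ?thesis .
  qed
  then show ?thesis
    using test_L2[OF \<phi>] grad_test_L2[OF \<phi>] by (simp add: has_weak_grad_iff)
qed

lemma weak_grad: "has_weak_grad \<Omega> u G \<Longrightarrow> has_weak_grad \<Omega> u (weak_grad \<Omega> u)"
  unfolding weak_grad_def by (rule someI[of "has_weak_grad \<Omega> u"])

lemma weak_div: "F \<in> Hdiv \<Omega> \<Longrightarrow> has_weak_div \<Omega> F (weak_div \<Omega> F)"
  unfolding Hdiv_def weak_div_def by (auto intro: someI[of "has_weak_div \<Omega> F"])

text \<open>The defining predicate sees \<open>u\<close> only through membership in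
  \<open>L2\<close> and integrals, so both sides choose from the same predicate. This gives equality
  of functions, stronger than equality almost everywhere.\<close>

lemma weak_grad_cong:
  assumes "u \<in> L2 \<Omega>" "v \<in> L2 \<Omega>" "ae_eq \<Omega> u v"
  shows "weak_grad \<Omega> u = weak_grad \<Omega> v"
proof -
  have "L2_ip \<Omega> u (partial_deriv i \<phi>) = L2_ip \<Omega> v (partial_deriv i \<phi>)" if "\<phi> \<in> test_fun \<Omega>" for \<phi> i
    using assms partial_test_L2[OF that] by (intro L2_ip_cong) (auto simp: ae_eq_def)
  then have "has_weak_grad \<Omega> u G \<longleftrightarrow> has_weak_grad \<Omega> v G" for G
    using assms by (auto simp: has_weak_grad_iff)
  then show ?thesis by (simp add: weak_grad_def)
qed

text \<open>Frees the norm from the particular choice made by \<open>weak_grad\<close>: an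
  explicitly known gradient, such as that of a sum or a limit, may be inserted.\<close>

lemma H1_norm_eq:
  assumes G: "has_weak_grad \<Omega> u G"
  shows "H1_norm \<Omega> u = sqrt (L2_ip \<Omega> u u + vec_ip \<Omega> G G)"
proof -
  have W: "has_weak_grad \<Omega> u (weak_grad \<Omega> u)" by (rule weak_grad[OF G])
  then have w: "weak_grad \<Omega> u \<in> L2_vec \<Omega>" and g: "G \<in> L2_vec \<Omega>" using G by (auto simp: has_weak_grad_iff)
  have "vec_ip \<Omega> G G = vec_ip \<Omega> (weak_grad \<Omega> u) (weak_grad \<Omega> u)"
    using weak_grad_unique[OF G W] by (intro vec_ip_cong w g)
  then show ?thesis
    unfolding H1_norm_def power2_norm_eq_inner vec_ip_eq_integral(2)[OF w w]
    by (simp add: L2_ip_def power2_eq_square)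
qed

lemma H1_norm_bounds:
  assumes G: "has_weak_grad \<Omega> u G"
  shows "L2_norm \<Omega> u \<le> H1_norm \<Omega> u" "L2_norm \<Omega> (\<lambda>\<omega>. G \<omega> $ i) \<le> H1_norm \<Omega> u"
proof -
  have u: "u \<in> L2 \<Omega>" and g: "G \<in> L2_vec \<Omega>" using G by (auto simp: has_weak_grad_iff)
  show "L2_norm \<Omega> u \<le> H1_norm \<Omega> u" "L2_norm \<Omega> (\<lambda>\<omega>. G \<omega> $ i) \<le> H1_norm \<Omega> u"
    using vec_ip_nonneg[OF g] L2.nonneg[OF u] vec_ip_ge_component[OF g, of i]
    by (auto simp: H1_norm_eq[OF G] L2.nrm_def)
qed

text \<open>The gradient is an argument, since \<open>weak_grad\<close> only picks one representative of its class.\<close>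

definition H10_pair :: "(real^'n \<Rightarrow> real) \<Rightarrow> (real^'n \<Rightarrow> real^'n) \<Rightarrow> bool" where
  "H10_pair u G \<longleftrightarrow> has_weak_grad \<Omega> u G \<and> (\<exists>\<phi>. (\<forall>k. \<phi> k \<in> test_fun \<Omega>) \<and> L2_conv \<Omega> \<phi> u \<and>
    (\<forall>i. L2_conv \<Omega> (\<lambda>k. partial_deriv i (\<phi> k)) (\<lambda>\<omega>. G \<omega> $ i)))"

lemma H10_pairE:
  assumes "H10_pair u G"
  obtains \<phi> where "u \<in> L2 \<Omega>" "G \<in> L2_vec \<Omega>" "\<And>k. \<phi> k \<in> test_fun \<Omega>" "L2_conv \<Omega> \<phi> u"
    "\<And>i. L2_conv \<Omega> (\<lambda>k. partial_deriv i (\<phi> k)) (\<lambda>\<omega>. G \<omega> $ i)"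
  using assms unfolding H10_pair_def has_weak_grad_iff by blast

text \<open>The \<open>H1\<close> distance to a test function is the root of the summed squared
  \<open>L2\<close> distances of the functions and their partial derivatives, so convergence of each
  component implies convergence in \<open>H1\<close>.\<close>

lemma H10_pair_imp_H10:
  assumes "H10_pair u G"
  shows "u \<in> H10 \<Omega>"
proof -
  obtain \<phi> where u: "u \<in> L2 \<Omega>" and G: "G \<in> L2_vec \<Omega>" and \<phi>: "\<And>k. \<phi> k \<in> test_fun \<Omega>"
    and c: "L2_conv \<Omega> \<phi> u" "\<And>i. L2_conv \<Omega> (\<lambda>k. partial_deriv i (\<phi> k)) (\<lambda>\<omega>. G \<omega> $ i)"
    using H10_pairE[OF assms] by blast
  have uG: "has_weak_grad \<Omega> u G" using assms by (simp add: H10_pair_def)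
  have eq: "H1_norm \<Omega> (\<lambda>\<omega>. u \<omega> - \<phi> k \<omega>) = sqrt ((L2_norm \<Omega> (\<lambda>\<omega>. \<phi> k \<omega> - u \<omega>))\<^sup>2 +
      (\<Sum>i\<in>UNIV. (L2_norm \<Omega> (\<lambda>\<omega>. partial_deriv i (\<phi> k) \<omega> - G \<omega> $ i))\<^sup>2))" for k
  proof -
    have "has_weak_grad \<Omega> (\<lambda>\<omega>. u \<omega> - \<phi> k \<omega>) (\<lambda>\<omega>. G \<omega> - grad (\<phi> k) \<omega>)"
      using has_weak_grad_lin[OF uG has_weak_grad_test[OF \<phi>], of 1 "-1" k] by simp
    moreover have "(f - g) * (f - g) = (g - f) * (g - f)" for f g :: real
      by (simp add: algebra_simps)
    then have "L2_ip \<Omega> (\<lambda>\<omega>. f \<omega> - g \<omega>) (\<lambda>\<omega>. f \<omega> - g \<omega>) = L2_ip \<Omega> (\<lambda>\<omega>. g \<omega> - f \<omega>) (\<lambda>\<omega>. g \<omega> - f \<omega>)"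
      for f g :: "real^'n \<Rightarrow> real" by (simp add: L2_ip_def)
    ultimately show ?thesis
      using L2.diff_mem[OF test_L2[OF \<phi>] u] L2.diff_mem[OF partial_test_L2[OF \<phi>] L2_vec_nth[OF G]]
      by (simp add: H1_norm_eq vec_ip_def L2.nrm_sq)
  qed
  have "(\<lambda>k. H1_norm \<Omega> (\<lambda>\<omega>. u \<omega> - \<phi> k \<omega>)) \<longlonglongrightarrow> sqrt (0\<^sup>2 + (\<Sum>i\<in>(UNIV::'n set). 0\<^sup>2))"
    unfolding eq using c unfolding L2.conv_def by (intro tendsto_intros)
  then show ?thesis using uG \<phi> by (auto simp: H10_def H1_def)
qed

lemma H10_imp_H10_pair:
  assumes u: "u \<in> H10 \<Omega>"
  shows "H10_pair u (weak_grad \<Omega> u)"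
proof -
  have W: "has_weak_grad \<Omega> u (weak_grad \<Omega> u)" using u weak_grad by (auto simp: H10_def H1_def)
  then have uL: "u \<in> L2 \<Omega>" and GL: "weak_grad \<Omega> u \<in> L2_vec \<Omega>" by (auto simp: has_weak_grad_iff)
  obtain \<phi> where \<phi>: "\<And>k. \<phi> k \<in> test_fun \<Omega>"
    and lim: "(\<lambda>k. H1_norm \<Omega> (\<lambda>\<omega>. u \<omega> - \<phi> k \<omega>)) \<longlonglongrightarrow> 0"
    using u by (auto simp: H10_def)
  have D: "has_weak_grad \<Omega> (\<lambda>\<omega>. u \<omega> - \<phi> k \<omega>) (\<lambda>\<omega>. weak_grad \<Omega> u \<omega> - grad (\<phi> k) \<omega>)" for k
    using has_weak_grad_lin[OF W has_weak_grad_test[OF \<phi>], of 1 "-1" k] by simp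
  have "L2_conv \<Omega> \<phi> u"
    unfolding L2.conv_def
  proof (rule Lim_null_comparison[OF _ lim])
    show "\<forall>\<^sub>F k in sequentially. norm (L2_norm \<Omega> (\<lambda>\<omega>. \<phi> k \<omega> - u \<omega>)) \<le> H1_norm \<Omega> (\<lambda>\<omega>. u \<omega> - \<phi> k \<omega>)"
      using H1_norm_bounds(1)[OF D] L2.nrm_diff_commute[OF uL test_L2[OF \<phi>]]
        L2.nrm_nonneg[OF L2.diff_mem[OF uL test_L2[OF \<phi>]]] by simp
  qed
  moreover have "L2_conv \<Omega> (\<lambda>k. partial_deriv i (\<phi> k)) (\<lambda>\<omega>. weak_grad \<Omega> u \<omega> $ i)" for i
    unfolding L2.conv_def
  proof (rule Lim_null_comparison[OF _ lim])
    note Gi = L2_vec_nth[OF GL, of i]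
    show "\<forall>\<^sub>F k in sequentially. norm (L2_norm \<Omega> (\<lambda>\<omega>. partial_deriv i (\<phi> k) \<omega> - weak_grad \<Omega> u \<omega> $ i))
        \<le> H1_norm \<Omega> (\<lambda>\<omega>. u \<omega> - \<phi> k \<omega>)"
      using H1_norm_bounds(2)[OF D, where i = i] L2.nrm_diff_commute[OF Gi partial_test_L2[OF \<phi>]]
        L2.nrm_nonneg[OF L2.diff_mem[OF Gi partial_test_L2[OF \<phi>]]] by simp
  qed
  ultimately show ?thesis unfolding H10_pair_def using W \<phi> by blast
qed

lemma H10_has_weak_grad:
  assumes "u \<in> H10 \<Omega>"
  shows "has_weak_grad \<Omega> u (weak_grad \<Omega> u)" "u \<in> L2 \<Omega>" "weak_grad \<Omega> u \<in> L2_vec \<Omega>"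
  using H10_imp_H10_pair[OF assms] by (auto simp: H10_pair_def has_weak_grad_iff)

lemma H10_pair_lin:
  assumes u: "H10_pair u G" and v: "H10_pair v F"
  shows "H10_pair (\<lambda>\<omega>. s * u \<omega> + t * v \<omega>) (\<lambda>\<omega>. s *\<^sub>R G \<omega> + t *\<^sub>R F \<omega>)"
proof -
  obtain \<phi> where uL: "u \<in> L2 \<Omega>" and GL: "G \<in> L2_vec \<Omega>" and \<phi>: "\<And>k. \<phi> k \<in> test_fun \<Omega>"
    and cu: "L2_conv \<Omega> \<phi> u" "\<And>i. L2_conv \<Omega> (\<lambda>k. partial_deriv i (\<phi> k)) (\<lambda>\<omega>. G \<omega> $ i)"
    using H10_pairE[OF u] by blast
  obtain \<psi> where vL: "v \<in> L2 \<Omega>" and FL: "F \<in> L2_vec \<Omega>" and \<psi>: "\<And>k. \<psi> k \<in> test_fun \<Omega>"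
    and cv: "L2_conv \<Omega> \<psi> v" "\<And>i. L2_conv \<Omega> (\<lambda>k. partial_deriv i (\<psi> k)) (\<lambda>\<omega>. F \<omega> $ i)"
    using H10_pairE[OF v] by blast
  have pd: "partial_deriv i (\<lambda>\<omega>. s * \<phi> k \<omega> + t * \<psi> k \<omega>) =
      (\<lambda>\<omega>. s * partial_deriv i (\<phi> k) \<omega> + t * partial_deriv i (\<psi> k) \<omega>)" for i k
    by (intro partial_deriv_lin smooth_differentiable test_fun_smooth[OF \<phi>] test_fun_smooth[OF \<psi>])
  have "L2_conv \<Omega> (\<lambda>k \<omega>. s * \<phi> k \<omega> + t * \<psi> k \<omega>) (\<lambda>\<omega>. s * u \<omega> + t * v \<omega>)"
    by (intro L2.conv_lin test_L2 \<phi> \<psi> uL vL cu cv)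
  moreover have "L2_conv \<Omega> (\<lambda>k. partial_deriv i (\<lambda>\<omega>. s * \<phi> k \<omega> + t * \<psi> k \<omega>))
      (\<lambda>\<omega>. (s *\<^sub>R G \<omega> + t *\<^sub>R F \<omega>) $ i)" for i
    unfolding pd vector_add_component vector_scaleR_component real_scaleR_def
    by (intro L2.conv_lin partial_test_L2 L2_vec_nth \<phi> \<psi> GL FL cu cv)
  moreover have "(\<lambda>\<omega>. s * \<phi> k \<omega> + t * \<psi> k \<omega>) \<in> test_fun \<Omega>" for k
    by (rule test_fun_lin[OF \<phi> \<psi>])
  moreover have "has_weak_grad \<Omega> (\<lambda>\<omega>. s * u \<omega> + t * v \<omega>) (\<lambda>\<omega>. s *\<^sub>R G \<omega> + t *\<^sub>R F \<omega>)"
    using u v by (intro has_weak_grad_lin) (auto simp: H10_pair_def)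
  ultimately show ?thesis
    unfolding H10_pair_def by (intro conjI exI[of _ "\<lambda>k \<omega>. s * \<phi> k \<omega> + t * \<psi> k \<omega>"] allI)
qed

lemma H10_lin:
  assumes "u \<in> H10 \<Omega>" "v \<in> H10 \<Omega>"
  shows "(\<lambda>\<omega>. s * u \<omega> + t * v \<omega>) \<in> H10 \<Omega>"
  using H10_pair_lin[OF assms[THEN H10_imp_H10_pair]] H10_pair_imp_H10 by blast

lemma weak_grad_lin:
  assumes u: "u \<in> H10 \<Omega>" and v: "v \<in> H10 \<Omega>"
  shows "ae_eq \<Omega> (weak_grad \<Omega> (\<lambda>\<omega>. s * u \<omega> + t * v \<omega>))
    (\<lambda>\<omega>. s *\<^sub>R weak_grad \<Omega> u \<omega> + t *\<^sub>R weak_grad \<Omega> v \<omega>)"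
  by (rule weak_grad_unique[OF H10_has_weak_grad(1)[OF H10_lin[OF u v]]
      has_weak_grad_lin[OF H10_has_weak_grad(1)[OF u] H10_has_weak_grad(1)[OF v]]])

text \<open>\<open>L2\<close> completeness supplies limits of the functions and of each partial
  derivative separately. They fit together because both sides of the weak gradient identity are
  \<open>L2\<close> continuous for a fixed test function.\<close>

lemma H10_complete:
  assumes \<phi>: "\<And>k. \<phi> k \<in> test_fun \<Omega>"
    and c0: "\<And>e. e > 0 \<Longrightarrow> \<exists>N. \<forall>m\<ge>N. \<forall>n\<ge>N. L2_norm \<Omega> (\<lambda>x. \<phi> m x - \<phi> n x) < e"
    and c1: "\<And>i e. e > 0 \<Longrightarrow> \<exists>N. \<forall>m\<ge>N. \<forall>n\<ge>N.
      L2_norm \<Omega> (\<lambda>x. partial_deriv i (\<phi> m) x - partial_deriv i (\<phi> n) x) < e"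
  obtains u G where "H10_pair u G" "L2_conv \<Omega> \<phi> u"
    "\<And>i. L2_conv \<Omega> (\<lambda>k. partial_deriv i (\<phi> k)) (\<lambda>\<omega>. G \<omega> $ i)"
proof -
  obtain u where u: "u \<in> L2 \<Omega>" "L2_conv \<Omega> \<phi> u"
    using L2_complete[OF \<Omega>_lebesgue test_L2[OF \<phi>] c0] by blast
  have "\<exists>g\<in>L2 \<Omega>. L2_conv \<Omega> (\<lambda>k. partial_deriv i (\<phi> k)) g" for i
    by (rule L2_complete[OF \<Omega>_lebesgue partial_test_L2[OF \<phi>] c1])
  then obtain g where g: "\<And>i. g i \<in> L2 \<Omega>" "\<And>i. L2_conv \<Omega> (\<lambda>k. partial_deriv i (\<phi> k)) (g i)"
    by metis
  define G where "G \<omega> = (\<chi> i. g i \<omega>)" for \<omega>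
  have Gi: "(\<lambda>\<omega>. G \<omega> $ i) = g i" for i by (simp add: G_def)
  have "L2_ip \<Omega> u (partial_deriv i \<psi>) = - L2_ip \<Omega> (g i) \<psi>" if \<psi>: "\<psi> \<in> test_fun \<Omega>" for \<psi> i
  proof (rule LIMSEQ_unique)
    show "(\<lambda>k. L2_ip \<Omega> (\<phi> k) (partial_deriv i \<psi>)) \<longlonglongrightarrow> L2_ip \<Omega> u (partial_deriv i \<psi>)"
      by (intro L2.conv_left test_L2 partial_test_L2 \<phi> \<psi> u)
    have "(\<lambda>k. - L2_ip \<Omega> (partial_deriv i (\<phi> k)) \<psi>) \<longlonglongrightarrow> - L2_ip \<Omega> (g i) \<psi>"
      by (intro tendsto_minus L2.conv_left test_L2 partial_test_L2 \<phi> \<psi> g)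
    then show "(\<lambda>k. L2_ip \<Omega> (\<phi> k) (partial_deriv i \<psi>)) \<longlonglongrightarrow> - L2_ip \<Omega> (g i) \<psi>"
      using has_weak_grad_test[OF \<phi>] \<psi> by (simp add: has_weak_grad_iff)
  qed
  then have "has_weak_grad \<Omega> u G"
    using u(1) g(1) by (auto simp: has_weak_grad_iff Gi intro: L2_vecI)
  then have "H10_pair u G" unfolding H10_pair_def using \<phi> u(2) g(2) by (auto simp: Gi)
  then show thesis using that u(2) g(2) by (simp add: Gi)
qed

text \<open>Both sides are continuous in the pair \<open>v\<close>, \<open>G\<close>, so the
  identity defining the weak divergence passes from test functions to their limits.\<close>

lemma weak_div_H10:
  assumes F: "has_weak_div \<Omega> F g" and v: "H10_pair v G"
  shows "vec_ip \<Omega> F G = - L2_ip \<Omega> g v"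
proof -
  obtain \<phi> where vL: "v \<in> L2 \<Omega>" and GL: "G \<in> L2_vec \<Omega>" and \<phi>: "\<And>k. \<phi> k \<in> test_fun \<Omega>"
    and c: "L2_conv \<Omega> \<phi> v" "\<And>i. L2_conv \<Omega> (\<lambda>k. partial_deriv i (\<phi> k)) (\<lambda>\<omega>. G \<omega> $ i)"
    using H10_pairE[OF v] by blast
  have FL: "F \<in> L2_vec \<Omega>" and gL: "g \<in> L2 \<Omega>" using F by (auto simp: has_weak_div_iff)
  show ?thesis
  proof (rule LIMSEQ_unique)
    show "(\<lambda>k. vec_ip \<Omega> F (grad (\<phi> k))) \<longlonglongrightarrow> vec_ip \<Omega> F G"
      unfolding vec_ip_def grad_nth
      by (intro tendsto_sum L2.conv_right partial_test_L2 L2_vec_nth \<phi> FL GL c)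
    have "(\<lambda>k. - L2_ip \<Omega> g (\<phi> k)) \<longlonglongrightarrow> - L2_ip \<Omega> g v"
      by (intro tendsto_minus L2.conv_right test_L2 \<phi> gL vL c)
    then show "(\<lambda>k. vec_ip \<Omega> F (grad (\<phi> k))) \<longlonglongrightarrow> - L2_ip \<Omega> g v"
      using F \<phi> by (simp add: has_weak_div_iff)
  qed
qed

text \<open>Integrating \<open>\<partial>\<^sub>i (x\<^sub>i \<phi>\<^sup>2)\<close> over the whole space gives \<open>\<integral>\<phi>\<^sup>2 = - 2 \<integral>x\<^sub>i \<phi> \<partial>\<^sub>i\<phi>\<close>.\<close>

lemma poincare_test:
  assumes R: "\<And>x. x \<in> \<Omega> \<Longrightarrow> norm x \<le> R" and \<phi>: "\<phi> \<in> test_fun \<Omega>"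
  shows "L2_ip \<Omega> \<phi> \<phi> \<le> (2 * R)\<^sup>2 * L2_ip \<Omega> (partial_deriv i \<phi>) (partial_deriv i \<phi>)"
proof -
  obtain K where K: "compact K" "K \<subseteq> \<Omega>" "\<And>\<omega>. \<omega> \<notin> K \<Longrightarrow> \<phi> \<omega> = 0"
    "\<And>\<omega> i. \<omega> \<notin> K \<Longrightarrow> partial_deriv i \<phi> \<omega> = 0"
    by (rule test_fun_support[OF \<phi>]) (rule that)
  note s = test_fun_smooth[OF \<phi>]
  note d = smooth_differentiable[OF s]
  note cont = smooth_continuous[OF s] smooth_continuous[OF smooth_partial_deriv[OF s]]
  have nth: "((\<lambda>x. x $ i) has_derivative (\<lambda>v. v $ i)) (at x)" for x :: "real^'n"
    by (rule bounded_linear_imp_has_derivative[OF bounded_linear_vec_nth])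
  have pnth: "partial_deriv i (\<lambda>x::real^'n. x $ i) = (\<lambda>x. 1)"
    using partial_deriv_eqI[OF nth] by (auto simp: fun_eq_iff)
  have psq: "partial_deriv i (\<lambda>x. \<phi> x * \<phi> x) = (\<lambda>x. \<phi> x * partial_deriv i \<phi> x + partial_deriv i \<phi> x * \<phi> x)"
    using partial_deriv_mult[OF d d] by blast
  have ibp: "(LINT x|lborel. x $ i * partial_deriv i (\<lambda>x. \<phi> x * \<phi> x) x) =
      - (LINT x|lborel. partial_deriv i (\<lambda>x. x $ i) x * (\<phi> x * \<phi> x))"
  proof (rule integration_by_parts[OF _ _ _ _ K(1)])
    show "(\<lambda>x::real^'n. x $ i) differentiable at x" for x using nth by (auto simp: differentiable_def)
    show "continuous_on UNIV (partial_deriv i (\<lambda>x::real^'n. x $ i))" unfolding pnth by simp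
    show "(\<lambda>x. \<phi> x * \<phi> x) differentiable at x" for x using d d by (rule differentiable_mult)
    show "continuous_on UNIV (partial_deriv i (\<lambda>x. \<phi> x * \<phi> x))"
      unfolding psq by (intro continuous_intros cont)
  qed (simp add: K(3))
  have m: "(\<lambda>x. x $ i * \<phi> x) \<in> L2 \<Omega>"
    and mb: "L2_ip \<Omega> (\<lambda>x. x $ i * \<phi> x) (\<lambda>x. x $ i * \<phi> x) \<le> R\<^sup>2 * L2_ip \<Omega> \<phi> \<phi>"
  proof -
    have meas: "(\<lambda>x. x $ i) \<in> borel_measurable (lebesgue_on \<Omega>)"
      using \<Omega>_lebesgue by (intro continuous_imp_measurable_on_sets_lebesgue continuous_intros)
    have bd: "AE x in lebesgue_on \<Omega>. \<bar>x $ i\<bar> \<le> R"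
      by (rule AE_I2) (use R component_le_norm_cart order_trans in \<open>fastforce simp: space_restrict_space\<close>)
    show "(\<lambda>x. x $ i * \<phi> x) \<in> L2 \<Omega>"
      "L2_ip \<Omega> (\<lambda>x. x $ i * \<phi> x) (\<lambda>x. x $ i * \<phi> x) \<le> R\<^sup>2 * L2_ip \<Omega> \<phi> \<phi>"
      by (rule L2_mult_bounded[OF meas bd test_L2[OF \<phi>]])+
  qed
  have "L2_ip \<Omega> \<phi> \<phi> = (LINT x|lborel. partial_deriv i (\<lambda>x. x $ i) x * (\<phi> x * \<phi> x))"
    unfolding L2_ip_def pnth mult_1
    by (rule lebesgue_on_lborel(2)[OF \<Omega>_lebesgue])
      (use K(2,3) in \<open>auto intro!: borel_measurable_continuous_onI continuous_intros cont\<close>)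
  also have "\<dots> = - (LINT x|lborel. 2 * ((x $ i * \<phi> x) * partial_deriv i \<phi> x))"
    using ibp unfolding psq by (simp add: algebra_simps)
  also have "(LINT x|lborel. 2 * ((x $ i * \<phi> x) * partial_deriv i \<phi> x)) =
      2 * L2_ip \<Omega> (\<lambda>x. x $ i * \<phi> x) (partial_deriv i \<phi>)"
    unfolding L2_ip_def integral_mult_right_zero
    by (subst lebesgue_on_lborel(2)[OF \<Omega>_lebesgue])
      (use K(2,3) in \<open>auto intro!: borel_measurable_continuous_onI continuous_intros cont\<close>)
  finally have eq: "L2_ip \<Omega> \<phi> \<phi> = - 2 * L2_ip \<Omega> (\<lambda>x. x $ i * \<phi> x) (partial_deriv i \<phi>)" by simp
  let ?a = "L2_ip \<Omega> \<phi> \<phi>" and ?b = "L2_ip \<Omega> (partial_deriv i \<phi>) (partial_deriv i \<phi>)"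
  have a: "0 \<le> ?a" and b: "0 \<le> ?b" using L2.nonneg test_L2[OF \<phi>] partial_test_L2[OF \<phi>] by auto
  have "?a\<^sup>2 = 4 * (L2_ip \<Omega> (\<lambda>x. x $ i * \<phi> x) (partial_deriv i \<phi>))\<^sup>2"
    unfolding eq by (simp add: power2_eq_square)
  also have "\<dots> \<le> 4 * (L2_ip \<Omega> (\<lambda>x. x $ i * \<phi> x) (\<lambda>x. x $ i * \<phi> x) * ?b)"
    using L2.cauchy_schwarz_sq[OF m partial_test_L2[OF \<phi>]] by simp
  also have "\<dots> \<le> 4 * ((R\<^sup>2 * ?a) * ?b)"
    using mb b by (intro mult_left_mono mult_right_mono) auto
  \<comment> \<open>One factor \<open>?a\<close> cancels unless it is 0; what remains is the claim
    with the constant \<open>(2 * R)\<^sup>2\<close>.\<close>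
  finally have "?a * ?a \<le> ?a * ((2 * R)\<^sup>2 * ?b)" by (simp add: power2_eq_square algebra_simps)
  then show ?thesis using a b by (cases "?a = 0") (auto simp: mult_le_cancel_left)
qed

lemma poincare_H10:
  assumes "bounded \<Omega>"
  obtains C where "C \<ge> 0" "\<And>\<phi>. \<phi> \<in> test_fun \<Omega> \<Longrightarrow> L2_ip \<Omega> \<phi> \<phi> \<le> C * vec_ip \<Omega> (grad \<phi>) (grad \<phi>)"
    "\<And>u G. H10_pair u G \<Longrightarrow> L2_ip \<Omega> u u \<le> C * vec_ip \<Omega> G G"
proof -
  obtain R where R: "\<And>x. x \<in> \<Omega> \<Longrightarrow> norm x \<le> R" using assms bounded_iff by blast
  let ?C = "(2 * R)\<^sup>2"
  have test: "L2_ip \<Omega> \<phi> \<phi> \<le> ?C * vec_ip \<Omega> (grad \<phi>) (grad \<phi>)" if \<phi>: "\<phi> \<in> test_fun \<Omega>" for \<phi>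
  proof -
    \<comment> \<open>One coordinate direction is enough; index types are nonempty, so there is
      one.\<close>
    fix i :: 'n
    have "L2_ip \<Omega> \<phi> \<phi> \<le> ?C * L2_ip \<Omega> (partial_deriv i \<phi>) (partial_deriv i \<phi>)"
      by (rule poincare_test[OF R \<phi>])
    also have "\<dots> \<le> ?C * vec_ip \<Omega> (grad \<phi>) (grad \<phi>)"
      using vec_ip_ge_component[OF grad_test_L2[OF \<phi>], of i] by (intro mult_left_mono) auto
    finally show ?thesis .
  qed
  have "L2_ip \<Omega> u u \<le> ?C * vec_ip \<Omega> G G" if p: "H10_pair u G" for u G
  proof -
    obtain \<phi> where uL: "u \<in> L2 \<Omega>" and GL: "G \<in> L2_vec \<Omega>" and \<phi>: "\<And>k. \<phi> k \<in> test_fun \<Omega>"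
      and c: "L2_conv \<Omega> \<phi> u" "\<And>i. L2_conv \<Omega> (\<lambda>k. partial_deriv i (\<phi> k)) (\<lambda>\<omega>. G \<omega> $ i)"
      using H10_pairE[OF p] by blast
    show ?thesis
    proof (rule LIMSEQ_le)
      show "(\<lambda>k. L2_ip \<Omega> (\<phi> k) (\<phi> k)) \<longlonglongrightarrow> L2_ip \<Omega> u u"
        by (intro L2.conv_quad test_L2 \<phi> uL c)
      show "(\<lambda>k. ?C * vec_ip \<Omega> (grad (\<phi> k)) (grad (\<phi> k))) \<longlonglongrightarrow> ?C * vec_ip \<Omega> G G"
        unfolding vec_ip_def grad_nth
        by (intro tendsto_mult tendsto_const tendsto_sum L2.conv_quad partial_test_L2 L2_vec_nth \<phi> GL c)
    qed (use test \<phi> in auto)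
  qed
  then show thesis using that[of ?C] test by simp
qed

end

section \<open>The elliptic operator\<close>

lemma ae_eq_sym: "ae_eq \<Omega> f g \<Longrightarrow> ae_eq \<Omega> g f"
  unfolding ae_eq_def by (simp add: eq_commute)

lemma ae_eq_trans [trans]: "ae_eq \<Omega> f g \<Longrightarrow> ae_eq \<Omega> g h \<Longrightarrow> ae_eq \<Omega> f h"
  unfolding ae_eq_def by (rule eventually_elim2) auto

lemma Linf_component:
  fixes A :: "real^'n \<Rightarrow> real^'n^'n"
  assumes "A \<in> Linf \<Omega>"
  obtains C where "\<And>i j. (\<lambda>\<omega>. A \<omega> $ i $ j) \<in> borel_measurable (lebesgue_on \<Omega>)"
    "\<And>i j. AE \<omega> in lebesgue_on \<Omega>. \<bar>A \<omega> $ i $ j\<bar> \<le> C"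
proof -
  obtain C where m: "A \<in> borel_measurable (lebesgue_on \<Omega>)"
    and C: "AE \<omega> in lebesgue_on \<Omega>. norm (A \<omega>) \<le> C"
    using assms by (auto simp: Linf_def)
  show thesis
  proof
    fix i j :: 'n
    have "continuous_on UNIV (\<lambda>B::real^'n^'n. B $ i $ j)" by (intro continuous_intros)
    from measurable_compose[OF m borel_measurable_continuous_onI[OF this]]
    show "(\<lambda>\<omega>. A \<omega> $ i $ j) \<in> borel_measurable (lebesgue_on \<Omega>)" .
    show "AE \<omega> in lebesgue_on \<Omega>. \<bar>A \<omega> $ i $ j\<bar> \<le> C"
      using C
    proof eventually_elim
      case (elim \<omega>)
      then show ?case
        using component_le_norm_cart[of "A \<omega> $ i" j] Finite_Cartesian_Product.norm_nth_le[of "A \<omega>" i] by linarith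
    qed
  qed
qed

context open_domain
begin

section \<open>The advection operator and sums in the \<open>H1\<close> norm\<close>

lemma op_S_L2:
  assumes b: "b \<in> Linf \<Omega>"
  obtains C where "C \<ge> 0" "\<And>x. x \<in> H10 \<Omega> \<Longrightarrow> op_S \<Omega> b x \<in> L2 \<Omega>"
    "\<And>x. x \<in> H10 \<Omega> \<Longrightarrow>
      L2_ip \<Omega> (op_S \<Omega> b x) (op_S \<Omega> b x) \<le> C * vec_ip \<Omega> (weak_grad \<Omega> x) (weak_grad \<Omega> x)"
proof -
  obtain C where m: "b \<in> borel_measurable (lebesgue_on \<Omega>)"
    and C: "AE \<omega> in lebesgue_on \<Omega>. norm (b \<omega>) \<le> C"
    using b by (auto simp: Linf_def)
  have mem: "op_S \<Omega> b x \<in> L2 \<Omega>" if x: "x \<in> H10 \<Omega>" for x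
  proof -
    have "(\<lambda>\<omega>. b \<omega> $ i * weak_grad \<Omega> x \<omega> $ i) \<in> L2 \<Omega>" for i
    proof (rule L2_mult_bounded(1)[OF _ _ L2_vec_nth[OF H10_has_weak_grad(3)[OF x]]])
      have "continuous_on UNIV (\<lambda>v::real^'n. v $ i)" by (intro continuous_intros)
      from measurable_compose[OF m borel_measurable_continuous_onI[OF this]]
      show "(\<lambda>\<omega>. b \<omega> $ i) \<in> borel_measurable (lebesgue_on \<Omega>)" .
      show "AE \<omega> in lebesgue_on \<Omega>. \<bar>b \<omega> $ i\<bar> \<le> C"
        using C by eventually_elim (rule order_trans[OF component_le_norm_cart])
    qed
    then show ?thesis unfolding op_S_def inner_vec_def by (simp add: L2_sum)
  qed
  have "L2_ip \<Omega> (op_S \<Omega> b x) (op_S \<Omega> b x) \<le> C\<^sup>2 * vec_ip \<Omega> (weak_grad \<Omega> x) (weak_grad \<Omega> x)"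
    if x: "x \<in> H10 \<Omega>" for x
  proof -
    let ?G = "weak_grad \<Omega> x"
    note G = H10_has_weak_grad(3)[OF x]
    have "L2_ip \<Omega> (op_S \<Omega> b x) (op_S \<Omega> b x) \<le> (LINT \<omega>|lebesgue_on \<Omega>. C\<^sup>2 * (?G \<omega> \<bullet> ?G \<omega>))"
      unfolding L2_ip_def
    proof (rule integral_mono_AE[OF L2_mult_integrable[OF mem[OF x] mem[OF x]]])
      show "integrable (lebesgue_on \<Omega>) (\<lambda>\<omega>. C\<^sup>2 * (?G \<omega> \<bullet> ?G \<omega>))"
        using vec_ip_eq_integral(1)[OF G G] by simp
      show "AE \<omega> in lebesgue_on \<Omega>. op_S \<Omega> b x \<omega> * op_S \<Omega> b x \<omega> \<le> C\<^sup>2 * (?G \<omega> \<bullet> ?G \<omega>)"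
        using C
      proof eventually_elim
        case (elim \<omega>)
        have "\<bar>b \<omega> \<bullet> ?G \<omega>\<bar> \<le> C * norm (?G \<omega>)"
          using Cauchy_Schwarz_ineq2[of "b \<omega>" "?G \<omega>"] mult_right_mono[OF elim norm_ge_zero[of "?G \<omega>"]]
          by linarith
        then have "\<bar>b \<omega> \<bullet> ?G \<omega>\<bar>\<^sup>2 \<le> (C * norm (?G \<omega>))\<^sup>2" by (rule power_mono) simp
        then show ?case
          by (simp add: op_S_def power_mult_distrib power2_norm_eq_inner flip: power2_eq_square)
      qed
    qed
    then show ?thesis by (simp add: vec_ip_eq_integral(2)[OF G G])
  qed
  then show thesis using that[of "C\<^sup>2"] mem by simp
qed

lemma op_S_lin:
  assumes "x \<in> H10 \<Omega>" "y \<in> H10 \<Omega>"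
  shows "ae_eq \<Omega> (op_S \<Omega> b (\<lambda>\<omega>. s * x \<omega> + t * y \<omega>)) (\<lambda>\<omega>. s * op_S \<Omega> b x \<omega> + t * op_S \<Omega> b y \<omega>)"
  using weak_grad_lin[OF assms, of s t] unfolding ae_eq_def op_S_def
  by eventually_elim (simp add: inner_add_right)

lemma H1_norm_sq:
  assumes "x \<in> H10 \<Omega>"
  shows "H1_norm \<Omega> x = sqrt (L2_ip \<Omega> x x + vec_ip \<Omega> (weak_grad \<Omega> x) (weak_grad \<Omega> x))"
  using H1_norm_eq[OF H10_has_weak_grad(1)[OF assms]] .

text \<open>The parallelogram law in each component, dropping the square of the difference. It
  replaces the triangle inequality at the price of a factor, which boundedness tolerates.\<close>

lemma H1_norm_add:
  assumes x: "x \<in> H10 \<Omega>" and y: "y \<in> H10 \<Omega>"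
  shows "(H1_norm \<Omega> (\<lambda>\<omega>. x \<omega> + y \<omega>))\<^sup>2 \<le> 2 * (H1_norm \<Omega> x)\<^sup>2 + 2 * (H1_norm \<Omega> y)\<^sup>2"
proof -
  have ip: "L2_ip \<Omega> (\<lambda>\<omega>. f \<omega> + g \<omega>) (\<lambda>\<omega>. f \<omega> + g \<omega>) \<le> 2 * L2_ip \<Omega> f f + 2 * L2_ip \<Omega> g g"
    if "f \<in> L2 \<Omega>" "g \<in> L2 \<Omega>" for f g
    using L2.quad[OF that, of 1 1] L2.quad_diff[OF that] L2.nonneg[OF L2.diff_mem[OF that]] by simp
  let ?F = "weak_grad \<Omega> x" and ?G = "weak_grad \<Omega> y"
  note x' = H10_has_weak_grad[OF x] and y' = H10_has_weak_grad[OF y]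
  have g: "has_weak_grad \<Omega> (\<lambda>\<omega>. x \<omega> + y \<omega>) (\<lambda>\<omega>. ?F \<omega> + ?G \<omega>)"
    using has_weak_grad_lin[OF x'(1) y'(1), of 1 1] by simp
  then have s: "(\<lambda>\<omega>. x \<omega> + y \<omega>) \<in> L2 \<Omega>" and S: "(\<lambda>\<omega>. ?F \<omega> + ?G \<omega>) \<in> L2_vec \<Omega>"
    by (auto simp: has_weak_grad_iff)
  have "vec_ip \<Omega> (\<lambda>\<omega>. ?F \<omega> + ?G \<omega>) (\<lambda>\<omega>. ?F \<omega> + ?G \<omega>) \<le> 2 * vec_ip \<Omega> ?F ?F + 2 * vec_ip \<Omega> ?G ?G"
    unfolding vec_ip_def sum_distrib_left sum.distrib[symmetric] vector_add_component
    by (intro sum_mono ip L2_vec_nth x' y')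
  then show ?thesis
    using ip[OF x'(2) y'(2)] L2.nonneg[OF s] vec_ip_nonneg[OF S]
      L2.nonneg[OF x'(2)] vec_ip_nonneg[OF x'(3)] L2.nonneg[OF y'(2)] vec_ip_nonneg[OF y'(3)]
    by (simp add: H1_norm_eq[OF g] H1_norm_sq x y)
qed

end

locale elliptic = open_domain \<Omega> for \<Omega> :: "(real^'n) set" +
  fixes \<nu> :: "real^'n \<Rightarrow> real^'n^'n" and c :: "real^'n \<Rightarrow> real" and \<nu>0 :: real
  assumes nu_Linf: "\<nu> \<in> Linf \<Omega>"
    and nu_sym: "\<forall>\<omega>\<in>\<Omega>. transpose (\<nu> \<omega>) = \<nu> \<omega>"
    and nu0: "\<nu>0 > 0"
    and nu_pos: "\<forall>\<omega>\<in>\<Omega>. \<forall>v. v \<bullet> (\<nu> \<omega> *v v) \<ge> \<nu>0 * (norm v)\<^sup>2"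
    and c_Linf: "c \<in> Linf \<Omega>"
    and c_nonneg: "AE \<omega> in lebesgue_on \<Omega>. c \<omega> \<ge> 0"
begin

section \<open>The energy form\<close>

abbreviation flux :: "(real^'n \<Rightarrow> real^'n) \<Rightarrow> real^'n \<Rightarrow> real^'n" where
  "flux G \<equiv> (\<lambda>\<omega>. \<nu> \<omega> *v G \<omega>)"

text \<open>Functions and gradients are separate arguments, so that the form is exactly linear in
  the pairs; with \<open>weak_grad\<close> built in, each sum would require a change of
  representative.\<close>

definition form ::
  "(real^'n \<Rightarrow> real) \<Rightarrow> (real^'n \<Rightarrow> real^'n) \<Rightarrow> (real^'n \<Rightarrow> real) \<Rightarrow> (real^'n \<Rightarrow> real^'n) \<Rightarrow> real" where
  "form u G v F = vec_ip \<Omega> (flux G) F + L2_ip \<Omega> (\<lambda>\<omega>. c \<omega> * u \<omega>) v"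

lemma flux_L2:
  assumes G: "G \<in> L2_vec \<Omega>"
  shows "flux G \<in> L2_vec \<Omega>"
proof (rule L2_vecI)
  fix i
  obtain C where C: "\<And>i j. (\<lambda>\<omega>. \<nu> \<omega> $ i $ j) \<in> borel_measurable (lebesgue_on \<Omega>)"
    "\<And>i j. AE \<omega> in lebesgue_on \<Omega>. \<bar>\<nu> \<omega> $ i $ j\<bar> \<le> C"
    using Linf_component[OF nu_Linf] by blast
  show "(\<lambda>\<omega>. (\<nu> \<omega> *v G \<omega>) $ i) \<in> L2 \<Omega>"
    unfolding matrix_vector_mult_def vec_lambda_beta
    by (intro L2_sum L2_mult_bounded(1)[OF C] L2_vec_nth[OF G]) simp
qed

text \<open>Symmetry of the matrix enters here. It makes the energy form symmetric, which both the
  minimization and the symmetry of the inverse depend on.\<close>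

lemma flux_sym:
  assumes F: "F \<in> L2_vec \<Omega>" and G: "G \<in> L2_vec \<Omega>"
  shows "vec_ip \<Omega> (flux F) G = vec_ip \<Omega> F (flux G)"
proof -
  have "(\<nu> \<omega> *v F \<omega>) \<bullet> G \<omega> = F \<omega> \<bullet> (\<nu> \<omega> *v G \<omega>)" if "\<omega> \<in> \<Omega>" for \<omega>
  proof -
    have "\<nu> \<omega> *v F \<omega> = F \<omega> v* \<nu> \<omega>"
      using nu_sym that vector_transpose_matrix[of "F \<omega>" "\<nu> \<omega>"] by simp
    then show ?thesis by (simp add: dot_lmul_matrix)
  qed
  then show ?thesis
    unfolding vec_ip_eq_integral(2)[OF flux_L2[OF F] G] vec_ip_eq_integral(2)[OF F flux_L2[OF G]]
    by (intro Bochner_Integration.integral_cong) (auto simp: space_restrict_space)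
qed

lemma flux_pos:
  assumes G: "G \<in> L2_vec \<Omega>"
  shows "\<nu>0 * vec_ip \<Omega> G G \<le> vec_ip \<Omega> (flux G) G"
proof -
  have "(LINT \<omega>|lebesgue_on \<Omega>. \<nu>0 * (G \<omega> \<bullet> G \<omega>)) \<le> (LINT \<omega>|lebesgue_on \<Omega>. flux G \<omega> \<bullet> G \<omega>)"
  proof (rule integral_mono)
    show "integrable (lebesgue_on \<Omega>) (\<lambda>\<omega>. \<nu>0 * (G \<omega> \<bullet> G \<omega>))"
      using vec_ip_eq_integral(1)[OF G G] by simp
    show "integrable (lebesgue_on \<Omega>) (\<lambda>\<omega>. flux G \<omega> \<bullet> G \<omega>)"
      by (rule vec_ip_eq_integral(1)[OF flux_L2[OF G] G])
    show "\<nu>0 * (G \<omega> \<bullet> G \<omega>) \<le> flux G \<omega> \<bullet> G \<omega>" if "\<omega> \<in> space (lebesgue_on \<Omega>)" for \<omega>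
      using nu_pos that by (simp add: space_restrict_space power2_norm_eq_inner inner_commute)
  qed
  then show ?thesis
    by (simp add: vec_ip_eq_integral(2)[OF flux_L2[OF G] G] vec_ip_eq_integral(2)[OF G G])
qed

lemma c_mult_L2:
  assumes "u \<in> L2 \<Omega>"
  shows "(\<lambda>\<omega>. c \<omega> * u \<omega>) \<in> L2 \<Omega>"
  using L2_mult_bounded(1)[OF _ _ assms] c_Linf by (auto simp: Linf_def)

lemma c_mult_sym: "L2_ip \<Omega> (\<lambda>\<omega>. c \<omega> * u \<omega>) v = L2_ip \<Omega> u (\<lambda>\<omega>. c \<omega> * v \<omega>)"
  by (simp add: L2_ip_def ac_simps)

lemma c_mult_nonneg: "0 \<le> L2_ip \<Omega> (\<lambda>\<omega>. c \<omega> * u \<omega>) u"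
  unfolding L2_ip_def
  by (rule integral_nonneg_AE) (use c_nonneg in \<open>eventually_elim, simp add: mult.assoc\<close>)

lemma form_sym:
  assumes "u \<in> L2 \<Omega>" "G \<in> L2_vec \<Omega>" "v \<in> L2 \<Omega>" "F \<in> L2_vec \<Omega>"
  shows "form u G v F = form v F u G"
  unfolding form_def flux_sym[OF assms(2,4)] c_mult_sym[of u]
  using vec_ip_sym[OF assms(2) flux_L2[OF assms(4)]] L2.sym[OF assms(1) c_mult_L2[OF assms(3)]] by simp

lemma form_coercive: "G \<in> L2_vec \<Omega> \<Longrightarrow> \<nu>0 * vec_ip \<Omega> G G \<le> form u G u G"
  using flux_pos[of G] c_mult_nonneg[of u] by (simp add: form_def)

lemma form_lin_left:
  assumes u: "u \<in> L2 \<Omega>" "G \<in> L2_vec \<Omega>" and v: "v \<in> L2 \<Omega>" "F \<in> L2_vec \<Omega>"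
    and w: "w \<in> L2 \<Omega>" "H \<in> L2_vec \<Omega>"
  shows "form (\<lambda>\<omega>. s * u \<omega> + t * v \<omega>) (\<lambda>\<omega>. s *\<^sub>R G \<omega> + t *\<^sub>R F \<omega>) w H =
    s * form u G w H + t * form v F w H"
  unfolding form_def flux_sym[OF L2_vec_lin[OF u(2) v(2)] w(2)] flux_sym[OF u(2) w(2)]
    flux_sym[OF v(2) w(2)] c_mult_sym[of _ w] vec_ip_lin_left[OF u(2) v(2) flux_L2[OF w(2)]]
    L2.lin_left[OF u(1) v(1) c_mult_L2[OF w(1)]]
  by (simp add: algebra_simps)

lemma form_grad_cong:
  assumes "G \<in> L2_vec \<Omega>" "G' \<in> L2_vec \<Omega>" "ae_eq \<Omega> G G'" "F \<in> L2_vec \<Omega>"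
  shows "form u G v F = form u G' v F"
  unfolding form_def flux_sym[OF assms(1,4)] flux_sym[OF assms(2,4)]
  using assms by (simp add: vec_ip_cong[OF assms(1,2) _ _ assms(3)] flux_L2 ae_eq_def)

section \<open>Weak solutions and their relation to the operator\<close>

definition weak_sol :: "(real^'n \<Rightarrow> real) \<Rightarrow> (real^'n \<Rightarrow> real) \<Rightarrow> bool" where
  "weak_sol x f \<longleftrightarrow> x \<in> H10 \<Omega> \<and> f \<in> L2 \<Omega> \<and>
    (\<forall>\<phi>\<in>test_fun \<Omega>. form x (weak_grad \<Omega> x) \<phi> (grad \<phi>) = L2_ip \<Omega> f \<phi>)"

lemma weak_solI:
  assumes x: "H10_pair x G" and f: "f \<in> L2 \<Omega>"
    and eq: "\<And>\<phi>. \<phi> \<in> test_fun \<Omega> \<Longrightarrow> form x G \<phi> (grad \<phi>) = L2_ip \<Omega> f \<phi>"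
  shows "weak_sol x f"
proof -
  have xH: "x \<in> H10 \<Omega>" by (rule H10_pair_imp_H10[OF x])
  have G: "has_weak_grad \<Omega> x G" using x by (simp add: H10_pair_def)
  note W = H10_has_weak_grad[OF xH]
  have GL: "G \<in> L2_vec \<Omega>" using G by (simp add: has_weak_grad_iff)
  have "form x (weak_grad \<Omega> x) \<phi> (grad \<phi>) = L2_ip \<Omega> f \<phi>" if "\<phi> \<in> test_fun \<Omega>" for \<phi>
    using eq[OF that] form_grad_cong[OF W(3) GL weak_grad_unique[OF W(1) G] grad_test_L2[OF that]] by simp
  then show ?thesis using xH f by (simp add: weak_sol_def)
qed

text \<open>Moving the reaction term to the right turns the tested equation into the definition of a
  weak divergence, so the domain condition comes for free.\<close>

lemma weak_sol_iff_div:
  "weak_sol x f \<longleftrightarrow> x \<in> H10 \<Omega> \<and> f \<in> L2 \<Omega> \<and>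
    has_weak_div \<Omega> (flux (weak_grad \<Omega> x)) (\<lambda>\<omega>. c \<omega> * x \<omega> - f \<omega>)"
proof (cases "x \<in> H10 \<Omega> \<and> f \<in> L2 \<Omega>")
  case True
  then have x: "x \<in> H10 \<Omega>" and f: "f \<in> L2 \<Omega>" by auto
  note cx = c_mult_L2[OF H10_has_weak_grad(2)[OF x]]
  have "form x (weak_grad \<Omega> x) \<phi> (grad \<phi>) = L2_ip \<Omega> f \<phi> \<longleftrightarrow>
      vec_ip \<Omega> (flux (weak_grad \<Omega> x)) (grad \<phi>) = - L2_ip \<Omega> (\<lambda>\<omega>. c \<omega> * x \<omega> - f \<omega>) \<phi>"
    if "\<phi> \<in> test_fun \<Omega>" for \<phi>
    unfolding form_def L2.diff_left[OF cx f test_L2[OF that]] by auto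
  then show ?thesis
    using x f flux_L2[OF H10_has_weak_grad(3)[OF x]] L2.diff_mem[OF cx f]
    by (auto simp: weak_sol_def has_weak_div_iff)
qed (auto simp: weak_sol_def)

lemma op_H_L2:
  assumes "x \<in> dom_H \<Omega> \<nu>"
  shows "op_H \<Omega> \<nu> c x \<in> L2 \<Omega>"
proof -
  have x: "x \<in> H10 \<Omega>" and F: "flux (weak_grad \<Omega> x) \<in> Hdiv \<Omega>" using assms by (auto simp: dom_H_def)
  have d: "weak_div \<Omega> (flux (weak_grad \<Omega> x)) \<in> L2 \<Omega>"
    using weak_div[OF F] by (simp add: has_weak_div_iff)
  show ?thesis
    using L2_lin[OF d c_mult_L2[OF H10_has_weak_grad(2)[OF x]], of "-1" 1] by (simp add: op_H_def)
qed

text \<open>\<open>op_H\<close> uses a chosen weak divergence. Uniqueness identifies the choice with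
  \<open>c * x - f\<close> in one direction; in the other, integrals do not notice the change of
  representative.\<close>

lemma weak_sol_iff_op_H:
  "weak_sol x f \<longleftrightarrow> x \<in> dom_H \<Omega> \<nu> \<and> f \<in> L2 \<Omega> \<and> ae_eq \<Omega> (op_H \<Omega> \<nu> c x) f"
proof
  let ?F = "flux (weak_grad \<Omega> x)"
  assume s: "weak_sol x f"
  then have div: "has_weak_div \<Omega> ?F (\<lambda>\<omega>. c \<omega> * x \<omega> - f \<omega>)" by (simp add: weak_sol_iff_div)
  then have F: "?F \<in> Hdiv \<Omega>" by (auto simp: Hdiv_def)
  have "ae_eq \<Omega> (weak_div \<Omega> ?F) (\<lambda>\<omega>. c \<omega> * x \<omega> - f \<omega>)"
    by (rule weak_div_unique[OF weak_div[OF F] div])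
  then have "ae_eq \<Omega> (op_H \<Omega> \<nu> c x) f" by (simp add: ae_eq_def op_H_def) (elim eventually_mono; simp)
  then show "x \<in> dom_H \<Omega> \<nu> \<and> f \<in> L2 \<Omega> \<and> ae_eq \<Omega> (op_H \<Omega> \<nu> c x) f"
    using s F by (simp add: weak_sol_def dom_H_def)
next
  let ?F = "flux (weak_grad \<Omega> x)"
  assume a: "x \<in> dom_H \<Omega> \<nu> \<and> f \<in> L2 \<Omega> \<and> ae_eq \<Omega> (op_H \<Omega> \<nu> c x) f"
  then have x: "x \<in> H10 \<Omega>" and F: "?F \<in> Hdiv \<Omega>" and f: "f \<in> L2 \<Omega>" by (auto simp: dom_H_def)
  note cf = L2.diff_mem[OF c_mult_L2[OF H10_has_weak_grad(2)[OF x]] f]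
  have D: "has_weak_div \<Omega> ?F (weak_div \<Omega> ?F)" by (rule weak_div[OF F])
  have "ae_eq \<Omega> (weak_div \<Omega> ?F) (\<lambda>\<omega>. c \<omega> * x \<omega> - f \<omega>)"
    using a by (simp add: ae_eq_def op_H_def) (elim conjE eventually_mono; simp)
  then have "L2_ip \<Omega> (weak_div \<Omega> ?F) \<phi> = L2_ip \<Omega> (\<lambda>\<omega>. c \<omega> * x \<omega> - f \<omega>) \<phi>" if "\<phi> \<in> test_fun \<Omega>" for \<phi>
    using D cf test_L2[OF that] by (intro L2_ip_cong) (auto simp: has_weak_div_iff ae_eq_def)
  then show "weak_sol x f"
    using D x f cf by (simp add: weak_sol_iff_div has_weak_div_iff)
qed

text \<open>Enlarges the class of admissible test elements to \<open>H10\<close>, so that solutions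
  can be tested with themselves and with each other.\<close>

lemma weak_sol_H10:
  assumes s: "weak_sol x f" and v: "H10_pair v F"
  shows "form x (weak_grad \<Omega> x) v F = L2_ip \<Omega> f v"
proof -
  have x: "x \<in> H10 \<Omega>" and f: "f \<in> L2 \<Omega>"
    and d: "has_weak_div \<Omega> (flux (weak_grad \<Omega> x)) (\<lambda>\<omega>. c \<omega> * x \<omega> - f \<omega>)"
    using s by (auto simp: weak_sol_iff_div)
  have vL: "v \<in> L2 \<Omega>" using v by (simp add: H10_pair_def has_weak_grad_iff)
  show ?thesis
    unfolding form_def weak_div_H10[OF d v]
    by (simp add: L2.diff_left[OF c_mult_L2[OF H10_has_weak_grad(2)[OF x]] f vL])
qed

lemma weak_sol_lin:
  assumes x: "weak_sol x f" and y: "weak_sol y g"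
  shows "weak_sol (\<lambda>\<omega>. s * x \<omega> + t * y \<omega>) (\<lambda>\<omega>. s * f \<omega> + t * g \<omega>)"
proof -
  have xH: "x \<in> H10 \<Omega>" and f: "f \<in> L2 \<Omega>" and yH: "y \<in> H10 \<Omega>" and g: "g \<in> L2 \<Omega>"
    using x y by (auto simp: weak_sol_def)
  note X = H10_has_weak_grad[OF xH] and Y = H10_has_weak_grad[OF yH]
  show ?thesis
  proof (rule weak_solI[OF H10_pair_lin[OF H10_imp_H10_pair[OF xH] H10_imp_H10_pair[OF yH]] L2_lin[OF f g]])
    fix \<phi> assume \<phi>: "\<phi> \<in> test_fun \<Omega>"
    show "form (\<lambda>\<omega>. s * x \<omega> + t * y \<omega>) (\<lambda>\<omega>. s *\<^sub>R weak_grad \<Omega> x \<omega> + t *\<^sub>R weak_grad \<Omega> y \<omega>) \<phi> (grad \<phi>) =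
        L2_ip \<Omega> (\<lambda>\<omega>. s * f \<omega> + t * g \<omega>) \<phi>"
      using x y \<phi>
      by (simp add: form_lin_left X Y test_L2[OF \<phi>] grad_test_L2[OF \<phi>] L2.lin_left[OF f g test_L2[OF \<phi>]]
          weak_sol_def)
  qed
qed

lemma weak_sol_coercive:
  assumes "weak_sol x f"
  shows "\<nu>0 * vec_ip \<Omega> (weak_grad \<Omega> x) (weak_grad \<Omega> x) \<le> L2_ip \<Omega> f x"
proof -
  have x: "x \<in> H10 \<Omega>" using assms by (simp add: weak_sol_def)
  show ?thesis
    using form_coercive[OF H10_has_weak_grad(3)[OF x], of x] weak_sol_H10[OF assms H10_imp_H10_pair[OF x]]
    by simp
qed

text \<open>Testing each equation with the other solution gives the two sides of
  \<open>form_sym\<close>. This is the symmetry of the inverse, expressed without mentioning an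
  inverse.\<close>

lemma weak_sol_sym:
  assumes "weak_sol x f" "weak_sol y g"
  shows "L2_ip \<Omega> f y = L2_ip \<Omega> g x"
proof -
  have x: "x \<in> H10 \<Omega>" and y: "y \<in> H10 \<Omega>" using assms by (auto simp: weak_sol_def)
  note X = H10_has_weak_grad[OF x] and Y = H10_has_weak_grad[OF y]
  show ?thesis
    using weak_sol_H10[OF assms(1) H10_imp_H10_pair[OF y]] weak_sol_H10[OF assms(2) H10_imp_H10_pair[OF x]]
      form_sym[OF X(2,3) Y(2,3)] by simp
qed

text \<open>The difference solves the equation with right side 0 almost everywhere. Tested with
  itself it has no gradient energy, and the Poincare inequality makes it vanish.\<close>

lemma weak_sol_unique:
  assumes bd: "bounded \<Omega>" and x: "weak_sol x f" and y: "weak_sol y g" and fg: "ae_eq \<Omega> f g"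
  shows "ae_eq \<Omega> x y"
proof -
  obtain C where C: "C \<ge> 0" "\<And>\<phi>. \<phi> \<in> test_fun \<Omega> \<Longrightarrow> L2_ip \<Omega> \<phi> \<phi> \<le> C * vec_ip \<Omega> (grad \<phi>) (grad \<phi>)"
    "\<And>u G. H10_pair u G \<Longrightarrow> L2_ip \<Omega> u u \<le> C * vec_ip \<Omega> G G"
    by (rule poincare_H10[OF bd]) (rule that)
  let ?z = "\<lambda>\<omega>. x \<omega> - y \<omega>" and ?h = "\<lambda>\<omega>. f \<omega> - g \<omega>"
  have z: "weak_sol ?z ?h" using weak_sol_lin[OF x y, of 1 "-1"] by simp
  then have zH: "?z \<in> H10 \<Omega>" and h: "?h \<in> L2 \<Omega>" by (auto simp: weak_sol_def)
  note Z = H10_has_weak_grad[OF zH]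
  have "L2_ip \<Omega> ?h ?z = L2_ip \<Omega> (\<lambda>\<omega>. 0) ?z"
    using fg h Z(2) L2.zero_mem by (intro L2_ip_cong) (auto simp: ae_eq_def)
  then have "L2_ip \<Omega> ?h ?z = 0" by (simp add: L2_ip_def)
  then have "\<nu>0 * vec_ip \<Omega> (weak_grad \<Omega> ?z) (weak_grad \<Omega> ?z) \<le> 0"
    using weak_sol_coercive[OF z] by simp
  then have "vec_ip \<Omega> (weak_grad \<Omega> ?z) (weak_grad \<Omega> ?z) \<le> 0"
    using nu0 by (simp add: mult_le_0_iff)
  then have "L2_ip \<Omega> ?z ?z \<le> 0"
    using C(3)[OF H10_imp_H10_pair[OF zH]] mult_nonneg_nonpos[OF C(1)] order_trans by blast
  then have "L2_ip \<Omega> ?z ?z = 0" using L2.nonneg[OF Z(2)] by simp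
  then show ?thesis using L2_ip_self_eq_0[OF Z(2)] by (subst ae_eq_iff_diff) simp
qed

lemma weak_sol_exists:
  assumes bd: "bounded \<Omega>" and f: "f \<in> L2 \<Omega>"
  shows "\<exists>x. weak_sol x f"
proof -
  obtain C where C: "C \<ge> 0" "\<And>\<phi>. \<phi> \<in> test_fun \<Omega> \<Longrightarrow> L2_ip \<Omega> \<phi> \<phi> \<le> C * vec_ip \<Omega> (grad \<phi>) (grad \<phi>)"
    "\<And>u G. H10_pair u G \<Longrightarrow> L2_ip \<Omega> u u \<le> C * vec_ip \<Omega> G G"
    by (rule poincare_H10[OF bd]) (rule that)
  let ?E = "\<lambda>\<phi> \<psi>. form \<phi> (grad \<phi>) \<psi> (grad \<psi>)"
  have grad_lin: "grad (\<lambda>\<omega>. s * \<phi> \<omega> + t * \<psi> \<omega>) = (\<lambda>\<omega>. s *\<^sub>R grad \<phi> \<omega> + t *\<^sub>R grad \<psi> \<omega>)"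
    if "\<phi> \<in> test_fun \<Omega>" "\<psi> \<in> test_fun \<Omega>" for \<phi> \<psi> s t
  proof -
    have "partial_deriv i (\<lambda>\<omega>. s * \<phi> \<omega> + t * \<psi> \<omega>) =
        (\<lambda>\<omega>. s * partial_deriv i \<phi> \<omega> + t * partial_deriv i \<psi> \<omega>)" for i
      by (intro partial_deriv_lin smooth_differentiable test_fun_smooth[OF that(1)] test_fun_smooth[OF that(2)])
    then show ?thesis by (simp add: fun_eq_iff vec_eq_iff)
  qed
  have coer: "\<nu>0 * vec_ip \<Omega> (grad \<phi>) (grad \<phi>) \<le> ?E \<phi> \<phi>" if "\<phi> \<in> test_fun \<Omega>" for \<phi>
    by (rule form_coercive[OF grad_test_L2[OF that]])
  interpret E: psd_form "test_fun \<Omega>" ?E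
  proof
    show "?E (\<lambda>x. s * \<phi> x + t * \<psi> x) \<eta> = s * ?E \<phi> \<eta> + t * ?E \<psi> \<eta>"
      if "\<phi> \<in> test_fun \<Omega>" "\<psi> \<in> test_fun \<Omega>" "\<eta> \<in> test_fun \<Omega>" for \<phi> \<psi> \<eta> s t
      using that by (simp add: grad_lin form_lin_left test_L2 grad_test_L2)
    show "?E \<phi> \<psi> = ?E \<psi> \<phi>" if "\<phi> \<in> test_fun \<Omega>" "\<psi> \<in> test_fun \<Omega>" for \<phi> \<psi>
      using that by (intro form_sym test_L2 grad_test_L2)
    show "0 \<le> ?E \<phi> \<phi>" if "\<phi> \<in> test_fun \<Omega>" for \<phi>
      using coer[OF that] nu0 vec_ip_nonneg[OF grad_test_L2[OF that]]
      by (meson mult_nonneg_nonneg less_imp_le order_trans)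
  qed (auto intro: zero_test_fun test_fun_lin)
  have part: "L2_norm \<Omega> (partial_deriv i \<phi>) \<le> sqrt (1 / \<nu>0) * E.nrm \<phi>" if \<phi>: "\<phi> \<in> test_fun \<Omega>" for \<phi> i
  proof -
    have "L2_ip \<Omega> (partial_deriv i \<phi>) (partial_deriv i \<phi>) \<le> (1 / \<nu>0) * ?E \<phi> \<phi>"
      using vec_ip_ge_component[OF grad_test_L2[OF \<phi>], of i] coer[OF \<phi>] nu0
      by (simp add: field_simps) (smt (verit) mult_left_mono)
    then show ?thesis unfolding L2.nrm_def E.nrm_def real_sqrt_mult[symmetric] by (rule real_sqrt_le_mono)
  qed
  have fn: "L2_norm \<Omega> \<phi> \<le> sqrt (C / \<nu>0) * E.nrm \<phi>" if \<phi>: "\<phi> \<in> test_fun \<Omega>" for \<phi>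
  proof -
    have "vec_ip \<Omega> (grad \<phi>) (grad \<phi>) \<le> ?E \<phi> \<phi> / \<nu>0"
      using coer[OF \<phi>] nu0 by (simp add: field_simps)
    then have "L2_ip \<Omega> \<phi> \<phi> \<le> C * (?E \<phi> \<phi> / \<nu>0)"
      using C(2)[OF \<phi>] mult_left_mono[OF _ C(1)] order_trans by blast
    then have "L2_ip \<Omega> \<phi> \<phi> \<le> (C / \<nu>0) * ?E \<phi> \<phi>" by simp
    then show ?thesis unfolding L2.nrm_def E.nrm_def real_sqrt_mult[symmetric] by (rule real_sqrt_le_mono)
  qed
  have l_lin: "L2_ip \<Omega> f (\<lambda>x. s * \<phi> x + t * \<psi> x) = s * L2_ip \<Omega> f \<phi> + t * L2_ip \<Omega> f \<psi>"
    if "\<phi> \<in> test_fun \<Omega>" "\<psi> \<in> test_fun \<Omega>" for \<phi> \<psi> s t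
    using that by (intro L2.lin_right test_L2 f)
  have l_bd: "L2_ip \<Omega> f \<phi> \<le> (L2_norm \<Omega> f * sqrt (C / \<nu>0)) * E.nrm \<phi>" if \<phi>: "\<phi> \<in> test_fun \<Omega>" for \<phi>
    using L2.cauchy_schwarz[OF f test_L2[OF \<phi>]] mult_left_mono[OF fn[OF \<phi>] L2.nrm_nonneg[OF f]]
    by (simp add: mult.assoc)
  obtain s where s: "\<And>k. s k \<in> test_fun \<Omega>"
    and cauchy: "\<And>e. e > 0 \<Longrightarrow> \<exists>N. \<forall>m\<ge>N. \<forall>n\<ge>N. E.nrm (\<lambda>x. s m x - s n x) < e"
    and lim: "\<And>\<phi>. \<phi> \<in> test_fun \<Omega> \<Longrightarrow> (\<lambda>k. ?E (s k) \<phi>) \<longlonglongrightarrow> L2_ip \<Omega> f \<phi>"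
    by (rule E.riesz_sequence[of "L2_ip \<Omega> f", OF l_lin l_bd]) (auto intro: that)
  \<comment> \<open>Transfers the Cauchy property from the energy norm to any quantity it dominates,
    here the \<open>L2\<close> norms of the differences and of their partial derivatives.
    \<open>M + 1\<close> avoids a division by zero.\<close>
  have dom: "\<exists>N. \<forall>m\<ge>N. \<forall>n\<ge>N. q m n < e"
    if M: "\<And>m n. q m n \<le> M * E.nrm (\<lambda>x. s m x - s n x)" "M \<ge> 0" and e: "e > 0" for q M e
  proof -
    obtain N where N: "\<And>m n. m \<ge> N \<Longrightarrow> n \<ge> N \<Longrightarrow> E.nrm (\<lambda>x. s m x - s n x) < e / (M + 1)"
      using cauchy[of "e / (M + 1)"] e M(2) by auto
    have "q m n < e" if "m \<ge> N" "n \<ge> N" for m n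
    proof -
      have "q m n \<le> M * (e / (M + 1))"
        using M(1)[of m n] mult_left_mono[OF less_imp_le[OF N[OF that]] M(2)] by linarith
      also have "\<dots> < e" using M(2) e by (simp add: divide_less_eq)
      finally show ?thesis .
    qed
    then show ?thesis by blast
  qed
  have sd: "(\<lambda>x. s m x - s n x) \<in> test_fun \<Omega>" for m n by (rule E.diff_mem[OF s s])
  have pd: "partial_deriv i (\<lambda>x. s m x - s n x) = (\<lambda>x. partial_deriv i (s m) x - partial_deriv i (s n) x)"
    for i m n
    using partial_deriv_lin[of "s m" "s n" i 1 "-1"] smooth_differentiable[OF test_fun_smooth[OF s]] by simp
  obtain u G where p: "H10_pair u G" and cu: "L2_conv \<Omega> s u"
    and cG: "\<And>i. L2_conv \<Omega> (\<lambda>k. partial_deriv i (s k)) (\<lambda>\<omega>. G \<omega> $ i)"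
  proof (rule H10_complete[of s])
    show "s k \<in> test_fun \<Omega>" for k by (rule s)
    show "\<exists>N. \<forall>m\<ge>N. \<forall>n\<ge>N. L2_norm \<Omega> (\<lambda>x. s m x - s n x) < e" if "e > 0" for e
      using fn[OF sd] C(1) nu0 that by (intro dom[where M = "sqrt (C / \<nu>0)"]) auto
    show "\<exists>N. \<forall>m\<ge>N. \<forall>n\<ge>N. L2_norm \<Omega> (\<lambda>x. partial_deriv i (s m) x - partial_deriv i (s n) x) < e"
      if "e > 0" for e i
      using part[OF sd] nu0 that unfolding pd by (intro dom[where M = "sqrt (1 / \<nu>0)"]) auto
  qed (rule that)
  have uL: "u \<in> L2 \<Omega>" and GL: "G \<in> L2_vec \<Omega>" using p by (auto simp: H10_pair_def has_weak_grad_iff)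
  have "form u G \<phi> (grad \<phi>) = L2_ip \<Omega> f \<phi>" if \<phi>: "\<phi> \<in> test_fun \<Omega>" for \<phi>
  proof (rule LIMSEQ_unique[OF _ lim[OF \<phi>]])
    \<comment> \<open>The matrix is shifted onto the fixed test function, so convergence of the
      partial derivatives against a fixed \<open>L2\<close> field suffices.\<close>
    have "(\<lambda>k. vec_ip \<Omega> (grad (s k)) (flux (grad \<phi>))) \<longlonglongrightarrow> vec_ip \<Omega> G (flux (grad \<phi>))"
      unfolding vec_ip_def grad_nth
      by (intro tendsto_sum L2.conv_left partial_test_L2 s L2_vec_nth flux_L2 grad_test_L2 \<phi> GL cG)
    moreover have "(\<lambda>k. L2_ip \<Omega> (s k) (\<lambda>\<omega>. c \<omega> * \<phi> \<omega>)) \<longlonglongrightarrow> L2_ip \<Omega> u (\<lambda>\<omega>. c \<omega> * \<phi> \<omega>)"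
      by (intro L2.conv_left test_L2 s c_mult_L2 \<phi> uL cu)
    ultimately show "(\<lambda>k. ?E (s k) \<phi>) \<longlonglongrightarrow> form u G \<phi> (grad \<phi>)"
      unfolding form_def flux_sym[OF GL grad_test_L2[OF \<phi>]] flux_sym[OF grad_test_L2[OF s] grad_test_L2[OF \<phi>]]
        c_mult_sym[of _ \<phi>]
      by (rule tendsto_add)
  qed
  then show ?thesis using weak_solI[OF p f] by blast
qed

lemma op_H_bij:
  assumes bd: "bounded \<Omega>"
  shows "ae_bij_betw \<Omega> (op_H \<Omega> \<nu> c) (dom_H \<Omega> \<nu>) (L2 \<Omega>)"
  unfolding ae_bij_betw_def
proof (intro conjI ballI)
  show "op_H \<Omega> \<nu> c x \<in> L2 \<Omega>" if "x \<in> dom_H \<Omega> \<nu>" for x by (rule op_H_L2[OF that])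
  show "\<exists>x\<in>dom_H \<Omega> \<nu>. ae_eq \<Omega> (op_H \<Omega> \<nu> c x) f" if "f \<in> L2 \<Omega>" for f
    using weak_sol_exists[OF bd that] weak_sol_iff_op_H by blast
  fix x y assume x: "x \<in> dom_H \<Omega> \<nu>" and y: "y \<in> dom_H \<Omega> \<nu>"
  have sol: "weak_sol x (op_H \<Omega> \<nu> c x)" "weak_sol y (op_H \<Omega> \<nu> c y)"
    using x y op_H_L2 by (auto simp: weak_sol_iff_op_H ae_eq_def)
  have xy: "x \<in> L2 \<Omega>" "y \<in> L2 \<Omega>" using x y H10_has_weak_grad(2) by (auto simp: dom_H_def)
  show "ae_eq \<Omega> (op_H \<Omega> \<nu> c x) (op_H \<Omega> \<nu> c y) \<longleftrightarrow> ae_eq \<Omega> x y"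
  proof
    assume "ae_eq \<Omega> (op_H \<Omega> \<nu> c x) (op_H \<Omega> \<nu> c y)"
    then show "ae_eq \<Omega> x y" by (rule weak_sol_unique[OF bd sol])
  next
    assume e: "ae_eq \<Omega> x y"
    then show "ae_eq \<Omega> (op_H \<Omega> \<nu> c x) (op_H \<Omega> \<nu> c y)"
      unfolding op_H_def weak_grad_cong[OF xy e] ae_eq_def by eventually_elim simp
  qed
qed

section \<open>The inverse under the assumption of bijectivity, on any open domain\<close>

context
  assumes bij: "ae_bij_betw \<Omega> (op_H \<Omega> \<nu> c) (dom_H \<Omega> \<nu>) (L2 \<Omega>)"
begin

lemma inv_H_sol:
  assumes f: "f \<in> L2 \<Omega>"
  shows "weak_sol (inv_H \<Omega> \<nu> c f) f"
proof -
  have "\<exists>x. x \<in> dom_H \<Omega> \<nu> \<and> ae_eq \<Omega> (op_H \<Omega> \<nu> c x) f"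
    using bij f unfolding ae_bij_betw_def by blast
  from someI_ex[OF this] show ?thesis
    using f by (simp add: weak_sol_iff_op_H inv_H_def ae_inv_into_def)
qed

text \<open>Injectivity from the assumption takes over the role that the Poincare inequality has on
  bounded domains.\<close>

lemma weak_sol_unique_bij:
  assumes x: "weak_sol x f" and y: "weak_sol y g" and fg: "ae_eq \<Omega> f g"
  shows "ae_eq \<Omega> x y"
proof -
  have "ae_eq \<Omega> (op_H \<Omega> \<nu> c x) f" "ae_eq \<Omega> g (op_H \<Omega> \<nu> c y)"
    using x y by (auto simp: weak_sol_iff_op_H intro: ae_eq_sym)
  then have "ae_eq \<Omega> (op_H \<Omega> \<nu> c x) (op_H \<Omega> \<nu> c y)" using fg ae_eq_trans by blast
  then show ?thesis using bij x y unfolding ae_bij_betw_def by (simp add: weak_sol_iff_op_H)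
qed

text \<open>The right side \<open>h\<close> may be any representative, since \<open>op_S\<close> of
  a linear combination agrees with the combination of the images only almost everywhere.\<close>

lemma inv_H_lin:
  assumes f: "f \<in> L2 \<Omega>" and g: "g \<in> L2 \<Omega>" and h: "h \<in> L2 \<Omega>"
    and e: "ae_eq \<Omega> h (\<lambda>\<omega>. s * f \<omega> + t * g \<omega>)"
  shows "ae_eq \<Omega> (inv_H \<Omega> \<nu> c h) (\<lambda>\<omega>. s * inv_H \<Omega> \<nu> c f \<omega> + t * inv_H \<Omega> \<nu> c g \<omega>)"
  by (rule weak_sol_unique_bij[OF inv_H_sol[OF h] weak_sol_lin[OF inv_H_sol[OF f] inv_H_sol[OF g]] e])

lemma inv_H_H10: "f \<in> L2 \<Omega> \<Longrightarrow> inv_H \<Omega> \<nu> c f \<in> H10 \<Omega>"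
  using inv_H_sol by (simp add: weak_sol_def)

lemma inv_H_L2: "f \<in> L2 \<Omega> \<Longrightarrow> inv_H \<Omega> \<nu> c f \<in> L2 \<Omega>"
  using inv_H_H10 H10_has_weak_grad(2) by blast

text \<open>In the constant, \<open>K / \<nu>0\<close> bounds the gradient through coercivity, and
  the square of \<open>K\<close> bounds the function itself through Cauchy-Schwarz for the form of
  the inverse.\<close>

lemma inv_H_bounded: "\<exists>K\<ge>0. \<forall>f\<in>L2 \<Omega>. (H1_norm \<Omega> (inv_H \<Omega> \<nu> c f))\<^sup>2 \<le> K * L2_ip \<Omega> f f"
proof -
  let ?T = "inv_H \<Omega> \<nu> c"
  have T_lin: "L2_ip \<Omega> (?T (\<lambda>x. s * f x + t * g x)) h = s * L2_ip \<Omega> (?T f) h + t * L2_ip \<Omega> (?T g) h"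
    if f: "f \<in> L2 \<Omega>" and g: "g \<in> L2 \<Omega>" and h: "h \<in> L2 \<Omega>" for f g h s t
  proof -
    have "L2_ip \<Omega> (?T (\<lambda>x. s * f x + t * g x)) h = L2_ip \<Omega> (\<lambda>x. s * ?T f x + t * ?T g x) h"
      using inv_H_lin[OF f g L2_lin[OF f g]] h
      by (intro L2_ip_cong inv_H_L2 L2_lin f g h) (auto simp: ae_eq_def)
    also have "\<dots> = s * L2_ip \<Omega> (?T f) h + t * L2_ip \<Omega> (?T g) h"
      by (intro L2.lin_left inv_H_L2 f g h)
    finally show ?thesis .
  qed
  have T_sym: "L2_ip \<Omega> (?T f) g = L2_ip \<Omega> f (?T g)" if f: "f \<in> L2 \<Omega>" and g: "g \<in> L2 \<Omega>" for f g
    using weak_sol_sym[OF inv_H_sol[OF f] inv_H_sol[OF g]] L2.sym[OF inv_H_L2[OF f] g] by simp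
  have coer: "\<nu>0 * vec_ip \<Omega> (weak_grad \<Omega> (?T f)) (weak_grad \<Omega> (?T f)) \<le> L2_ip \<Omega> (?T f) f"
    if f: "f \<in> L2 \<Omega>" for f
    using weak_sol_coercive[OF inv_H_sol[OF f]] L2.sym[OF inv_H_L2[OF f] f] by simp
  have T_pos: "0 \<le> L2_ip \<Omega> (?T f) f" if f: "f \<in> L2 \<Omega>" for f
    using coer[OF f] nu0 vec_ip_nonneg[OF H10_has_weak_grad(3)[OF inv_H_H10[OF f]]]
    by (meson mult_nonneg_nonneg less_imp_le order_trans)
  have "\<exists>K\<ge>0. \<forall>f\<in>L2 \<Omega>. L2_ip \<Omega> (?T f) f \<le> K * L2_ip \<Omega> f f"
    by (rule L2.hellinger_toeplitz[OF L2_complete[OF \<Omega>_lebesgue] inv_H_L2 T_lin T_sym T_pos])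
  then obtain K where K: "K \<ge> 0" "\<And>f. f \<in> L2 \<Omega> \<Longrightarrow> L2_ip \<Omega> (?T f) f \<le> K * L2_ip \<Omega> f f" by blast
  interpret T: psd_form "L2 \<Omega>" "\<lambda>f g. L2_ip \<Omega> (?T f) g"
  proof
    show "L2_ip \<Omega> (?T f) g = L2_ip \<Omega> (?T g) f" if f: "f \<in> L2 \<Omega>" and g: "g \<in> L2 \<Omega>" for f g
      using T_sym[OF f g] L2.sym[OF f inv_H_L2[OF g]] by simp
  qed (fact L2.zero_mem | rule L2_lin T_lin T_pos; assumption)+
  have "(H1_norm \<Omega> (?T f))\<^sup>2 \<le> (K\<^sup>2 + K / \<nu>0) * L2_ip \<Omega> f f" if f: "f \<in> L2 \<Omega>" for f
  proof -
    note Tf = inv_H_L2[OF f] and TfH = inv_H_H10[OF f]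
    let ?n = "L2_ip \<Omega> (?T f) (?T f)" and ?v = "vec_ip \<Omega> (weak_grad \<Omega> (?T f)) (weak_grad \<Omega> (?T f))"
    have n0: "0 \<le> ?n" and v0: "0 \<le> ?v" and f0: "0 \<le> L2_ip \<Omega> f f"
      using L2.nonneg[OF Tf] L2.nonneg[OF f] vec_ip_nonneg[OF H10_has_weak_grad(3)[OF TfH]] by auto
    \<comment> \<open>Cauchy-Schwarz for \<open>L2_ip (T f) g\<close> at \<open>g = T f\<close>.
      Both factors are values of the quadratic form bounded by \<open>K\<close>, and one
      \<open>?n\<close> cancels.\<close>
    have "?n\<^sup>2 \<le> L2_ip \<Omega> (?T f) f * L2_ip \<Omega> (?T (?T f)) (?T f)"
      by (rule T.cauchy_schwarz_sq[OF f Tf])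
    also have "\<dots> \<le> (K * L2_ip \<Omega> f f) * (K * ?n)"
      using K f Tf f0 T_pos by (intro mult_mono) auto
    finally have "?n * ?n \<le> ?n * (K\<^sup>2 * L2_ip \<Omega> f f)" by (simp add: power2_eq_square algebra_simps)
    then have "?n \<le> K\<^sup>2 * L2_ip \<Omega> f f"
      using n0 f0 by (cases "?n = 0") (auto simp: mult_le_cancel_left)
    moreover have "?v \<le> K / \<nu>0 * L2_ip \<Omega> f f"
      using order_trans[OF coer[OF f] K(2)[OF f]] nu0 by (simp add: field_simps)
    ultimately show ?thesis using n0 v0 by (simp add: H1_norm_sq[OF TfH] algebra_simps)
  qed
  then show ?thesis using K(1) nu0 by (intro exI[of _ "K\<^sup>2 + K / \<nu>0"]) auto
qed

lemma preconditioned_bounded: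
  assumes b: "b \<in> Linf \<Omega>"
  shows "bounded_operator \<Omega> (H10 \<Omega>) (H1_norm \<Omega>) (H10 \<Omega>) (H1_norm \<Omega>)
    (\<lambda>x \<omega>. x \<omega> + inv_H \<Omega> \<nu> c (op_S \<Omega> b x) \<omega>)"
proof -
  let ?P = "\<lambda>x. inv_H \<Omega> \<nu> c (op_S \<Omega> b x)"
  obtain C where C: "C \<ge> 0" and S: "\<And>x. x \<in> H10 \<Omega> \<Longrightarrow> op_S \<Omega> b x \<in> L2 \<Omega>"
    and SC: "\<And>x. x \<in> H10 \<Omega> \<Longrightarrow>
      L2_ip \<Omega> (op_S \<Omega> b x) (op_S \<Omega> b x) \<le> C * vec_ip \<Omega> (weak_grad \<Omega> x) (weak_grad \<Omega> x)"
    by (rule op_S_L2[OF b]) (rule that)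
  obtain K where K: "K \<ge> 0"
    and TK: "\<And>f. f \<in> L2 \<Omega> \<Longrightarrow> (H1_norm \<Omega> (inv_H \<Omega> \<nu> c f))\<^sup>2 \<le> K * L2_ip \<Omega> f f"
    using inv_H_bounded by blast
  have P: "?P x \<in> H10 \<Omega>" if "x \<in> H10 \<Omega>" for x using inv_H_H10[OF S[OF that]] .
  have add: "(\<lambda>\<omega>. x \<omega> + y \<omega>) \<in> H10 \<Omega>" if "x \<in> H10 \<Omega>" "y \<in> H10 \<Omega>" for x y
    using H10_lin[OF that, of 1 1] by simp
  have P_lin: "ae_eq \<Omega> (?P (\<lambda>\<omega>. s * x \<omega> + t * y \<omega>)) (\<lambda>\<omega>. s * ?P x \<omega> + t * ?P y \<omega>)"
    if "x \<in> H10 \<Omega>" "y \<in> H10 \<Omega>" for x y s t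
    by (rule inv_H_lin[OF S[OF that(1)] S[OF that(2)] S[OF H10_lin[OF that]] op_S_lin[OF that]])
  show ?thesis
    unfolding bounded_operator_def
  proof (intro conjI ballI allI impI)
    show "(\<lambda>\<omega>. x \<omega> + ?P x \<omega>) \<in> H10 \<Omega>" if "x \<in> H10 \<Omega>" for x by (rule add[OF that P[OF that]])
    show "ae_eq \<Omega> (\<lambda>\<omega>. x \<omega> + ?P x \<omega>) (\<lambda>\<omega>. y \<omega> + ?P y \<omega>)"
      if "x \<in> H10 \<Omega>" "y \<in> H10 \<Omega>" "ae_eq \<Omega> x y" for x y
    proof -
      \<comment> \<open>Equality as functions, by \<open>weak_grad_cong\<close>;
        \<open>inv_H\<close> thus receives the same argument and makes the same choice.\<close>
      have "op_S \<Omega> b x = op_S \<Omega> b y"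
        unfolding op_S_def using weak_grad_cong that H10_has_weak_grad(2) by metis
      then show ?thesis using that(3) by (simp add: ae_eq_def)
    qed
    show "ae_eq \<Omega> (\<lambda>\<omega>. (x \<omega> + y \<omega>) + ?P (\<lambda>\<omega>. x \<omega> + y \<omega>) \<omega>) (\<lambda>\<omega>. (x \<omega> + ?P x \<omega>) + (y \<omega> + ?P y \<omega>))"
      if "x \<in> H10 \<Omega>" "y \<in> H10 \<Omega>" for x y
      using P_lin[OF that, of 1 1] by (simp add: ae_eq_def)
    show "ae_eq \<Omega> (\<lambda>\<omega>. a * x \<omega> + ?P (\<lambda>\<omega>. a * x \<omega>) \<omega>) (\<lambda>\<omega>. a * (x \<omega> + ?P x \<omega>))"
      if "x \<in> H10 \<Omega>" for a x
      using P_lin[OF that that, of a 0] by (simp add: ae_eq_def distrib_left)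
    show "\<exists>D. \<forall>x\<in>H10 \<Omega>. H1_norm \<Omega> (\<lambda>\<omega>. x \<omega> + ?P x \<omega>) \<le> D * H1_norm \<Omega> x"
    proof (intro exI ballI)
      fix x assume x: "x \<in> H10 \<Omega>"
      note X = H10_has_weak_grad[OF x]
      have h0: "0 \<le> H1_norm \<Omega> x" and hv: "vec_ip \<Omega> (weak_grad \<Omega> x) (weak_grad \<Omega> x) \<le> (H1_norm \<Omega> x)\<^sup>2"
        using L2.nonneg[OF X(2)] vec_ip_nonneg[OF X(3)] by (auto simp: H1_norm_sq[OF x])
      have "(H1_norm \<Omega> (?P x))\<^sup>2 \<le> K * (C * (H1_norm \<Omega> x)\<^sup>2)"
        using TK[OF S[OF x]] mult_left_mono[OF order_trans[OF SC[OF x] mult_left_mono[OF hv C]] K]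
        by linarith
      \<comment> \<open>The factor 2 comes from \<open>H1_norm_add\<close>, \<open>K\<close> from
        the inverse and \<open>C\<close> from the advection operator.\<close>
      then have "(H1_norm \<Omega> (\<lambda>\<omega>. x \<omega> + ?P x \<omega>))\<^sup>2 \<le> (2 + 2 * K * C) * (H1_norm \<Omega> x)\<^sup>2"
        using H1_norm_add[OF x P[OF x]] by (simp add: algebra_simps)
      also have "\<dots> = (sqrt (2 + 2 * K * C) * H1_norm \<Omega> x)\<^sup>2"
        using K C by (simp add: power_mult_distrib)
      finally show "H1_norm \<Omega> (\<lambda>\<omega>. x \<omega> + ?P x \<omega>) \<le> sqrt (2 + 2 * K * C) * H1_norm \<Omega> x"
        by (rule power2_le_imp_le) (use K C h0 in simp)
    qed
  qed
qed

end

end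

text \<open>The inverse presupposes bijectivity, which can fail on unbounded domains: the negative
  Laplacian with \<open>c = 0\<close> on the whole space is not onto \<open>L2\<close>. Bijectivity
  is therefore proved for bounded domains and is a premise of the boundedness claim, which covers
  all domains where the inverse exists.\<close>

theorem proposition2:
  fixes \<Omega> :: "(real^'n) set"
    and \<nu> :: "real^'n \<Rightarrow> real^'n^'n"
    and b :: "real^'n \<Rightarrow> real^'n"
    and c :: "real^'n \<Rightarrow> real"
  assumes domain: "open \<Omega>" "connected \<Omega>" "\<Omega> \<noteq> {}"
    and nu_Linf: "\<nu> \<in> Linf \<Omega>"
    and nu_sym: "\<forall>\<omega>\<in>\<Omega>. transpose (\<nu> \<omega>) = \<nu> \<omega>"
    and nu_pos: "\<exists>\<nu>0>0. \<forall>\<omega>\<in>\<Omega>. \<forall>v. v \<bullet> (\<nu> \<omega> *v v) \<ge> \<nu>0 * (norm v)\<^sup>2"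
    and b_Linf: "b \<in> Linf \<Omega>"
    and b_Hdiv: "b \<in> Hdiv \<Omega>"
    and b_div: "AE \<omega> in lebesgue_on \<Omega>. weak_div \<Omega> b \<omega> = 0"
    and c_Linf: "c \<in> Linf \<Omega>"
    and c_nonneg: "AE \<omega> in lebesgue_on \<Omega>. c \<omega> \<ge> 0"
  shows "(bounded \<Omega> \<longrightarrow> ae_bij_betw \<Omega> (op_H \<Omega> \<nu> c) (dom_H \<Omega> \<nu>) (L2 \<Omega>)) \<and>
         (ae_bij_betw \<Omega> (op_H \<Omega> \<nu> c) (dom_H \<Omega> \<nu>) (L2 \<Omega>) \<longrightarrow>
            bounded_operator \<Omega> (H10 \<Omega>) (H1_norm \<Omega>) (H10 \<Omega>) (H1_norm \<Omega>)
              (\<lambda>x \<omega>. x \<omega> + inv_H \<Omega> \<nu> c (op_S \<Omega> b x) \<omega>))"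
proof -
  obtain \<nu>0 where \<nu>0: "\<nu>0 > 0" "\<forall>\<omega>\<in>\<Omega>. \<forall>v. v \<bullet> (\<nu> \<omega> *v v) \<ge> \<nu>0 * (norm v)\<^sup>2"
    using nu_pos by blast
  interpret elliptic \<Omega> \<nu> c \<nu>0
    by unfold_locales (fact \<nu>0 domain(1) nu_Linf nu_sym c_Linf c_nonneg)+
  show ?thesis using op_H_bij preconditioned_bounded b_Linf by blast
qed

end
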